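(* Let $M$ be a smooth compact manifold without boundary. Let $\mathfrak{G}$ and $\mathcal{G}$ be two smooth Sub-Semi-Riemannian metrics on $M$ with the same rank and the same signature. Let $g$ be a smooth Riemannian metric on $M$, let $p\in[1,\infty)$ and let $\epsilon>0$. Then there exist a smooth diffeomorphism $\Phi:M\to M$ and a smooth positive function $f$ on $M$ such that $\Phi^*(f\mathcal{G})-\mathfrak{G}$ is $\epsilon$-close to zero in the $L^p$ norm relative to $g$, i.e. $\|\Phi^*(f\mathcal{G})-\mathfrak{G}\|_{L^p(M,g)}\leq\epsilon$.
   Context: A Sub-Semi-Riemannian metric on $M$ is a symmetric covariant 2-tensor field on $M$ with constant signature and constant rank (it may be degenerate and indefinite). The $L^p$ norm relative to $g$ of a covariant 2-tensor field $h$ is $\left(\int_M |h|_g^p\, d\mu_g\right)^{1/p}$, where $|\cdot|_g$ is the pointwise norm and $d\mu_g$ the Riemannian measure induced by $g$. *)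

theory Defs
  imports "HOL-Analysis.Analysis" "HOL-Library.Function_Algebras"
begin

text \<open>
  Pointwise scaling makes function spaces real vector spaces. Tangent spaces below are subspaces of
  a function space, so the library notions \<^const>\<open>subspace\<close>, \<^const>\<open>span\<close> and \<^const>\<open>dim\<close> apply to them,
  and tensor fields can be subtracted.
\<close>

instantiation "fun" :: (type, real_vector) real_vector
begin

definition scaleR_fun :: "real \<Rightarrow> ('a \<Rightarrow> 'b) \<Rightarrow> 'a \<Rightarrow> 'b"
  where "scaleR_fun r f = (\<lambda>x. r *\<^sub>R f x)"

instance
  by standard (auto simp: scaleR_fun_def fun_eq_iff scaleR_add_left scaleR_add_right)

end

subsection \<open>Smooth functions on open subsets of Euclidean spaces\<close>

fun Ck_on :: "nat \<Rightarrow> 'a::euclidean_space set \<Rightarrow> ('a \<Rightarrow> 'b::real_normed_vector) \<Rightarrow> bool" where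
  "Ck_on 0 S f \<longleftrightarrow> continuous_on S f"
| "Ck_on (Suc k) S f \<longleftrightarrow>
    (\<forall>x\<in>S. f differentiable (at x)) \<and> (\<forall>v. Ck_on k S (\<lambda>x. frechet_derivative f (at x) v))"

text \<open>Only meant for open \<open>S\<close>.\<close>

definition smooth_on :: "'a::euclidean_space set \<Rightarrow> ('a \<Rightarrow> 'b::real_normed_vector) \<Rightarrow> bool"
  where "smooth_on S f \<longleftrightarrow> (\<forall>k. Ck_on k S f)"

subsection \<open>Smooth manifolds\<close>

text \<open>
  The manifold is the whole topological space \<open>'m\<close> with the smooth structure generated by an atlas,
  which need not be maximal. A chart is a pair \<open>(U, \<phi>)\<close>; the values of \<open>\<phi>\<close> outside \<open>U\<close> are irrelevant.
  The index type of \<^typ>\<open>real^'n\<close> will be of sort \<open>{finite, wellorder}\<close> as in the library's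
  change-of-variables theorems. The order plays no role and, for every \<open>n \<ge> 1\<close>, there is such a type
  with \<open>n\<close> elements.
\<close>

type_synonym ('m, 'n) chart = "'m set \<times> ('m \<Rightarrow> real^'n)"

definition cdom :: "('m, 'n) chart \<Rightarrow> 'm set"
  where "cdom c = fst c"

definition cmap :: "('m, 'n) chart \<Rightarrow> 'm \<Rightarrow> real^'n"
  where "cmap c = snd c"

definition cinv :: "('m, 'n) chart \<Rightarrow> real^'n \<Rightarrow> 'm"
  where "cinv c = inv_into (cdom c) (cmap c)"

definition smooth_atlas ::
    "('m::{t2_space,second_countable_topology}, 'n::finite) chart set \<Rightarrow> bool" where
  "smooth_atlas A \<longleftrightarrow>
    (\<forall>c\<in>A. open (cdom c) \<and> open (cmap c ` cdom c) \<and>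
       homeomorphism (cdom c) (cmap c ` cdom c) (cmap c) (cinv c)) \<and>
    (\<Union>c\<in>A. cdom c) = UNIV \<and>
    (\<forall>c\<in>A. \<forall>d\<in>A. smooth_on (cmap c ` (cdom c \<inter> cdom d)) (cmap d \<circ> cinv c))"

definition smooth_function ::
    "('m::topological_space, 'n::finite) chart set \<Rightarrow> ('m \<Rightarrow> real) \<Rightarrow> bool" where
  "smooth_function A f \<longleftrightarrow> (\<forall>c\<in>A. smooth_on (cmap c ` cdom c) (f \<circ> cinv c))"

definition smooth_map ::
    "('m::topological_space, 'n::finite) chart set \<Rightarrow> ('m \<Rightarrow> 'm) \<Rightarrow> bool" where
  "smooth_map A \<Phi> \<longleftrightarrow> continuous_on UNIV \<Phi> \<and>
    (\<forall>c\<in>A. \<forall>d\<in>A. smooth_on (cmap c ` (cdom c \<inter> \<Phi> -` cdom d)) (cmap d \<circ> \<Phi> \<circ> cinv c))"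

definition smooth_diffeomorphism ::
    "('m::topological_space, 'n::finite) chart set \<Rightarrow> ('m \<Rightarrow> 'm) \<Rightarrow> bool" where
  "smooth_diffeomorphism A \<Phi> \<longleftrightarrow> bij \<Phi> \<and> smooth_map A \<Phi> \<and> smooth_map A (inv \<Phi>)"

subsection \<open>Tangent spaces\<close>

text \<open>
  A tangent vector at \<open>x\<close> is an equivalence class of pairs (chart around \<open>x\<close>, vector in \<^typ>\<open>real^'n\<close>)
  under change of coordinates. The class is encoded as the function assigning to each chart of the
  atlas around \<open>x\<close> its representative in that chart, and \<open>0\<close> to everything else.
\<close>

type_synonym ('m, 'n) tvec = "('m, 'n) chart \<Rightarrow> real^'n"

definition tangent_space ::
    "('m, 'n::finite) chart set \<Rightarrow> 'm \<Rightarrow> ('m, 'n) tvec set" where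
  "tangent_space A x =
    {v. (\<forall>c. \<not> (c \<in> A \<and> x \<in> cdom c) \<longrightarrow> v c = 0) \<and>
        (\<forall>c\<in>A. \<forall>d\<in>A. x \<in> cdom c \<inter> cdom d \<longrightarrow>
           v d = frechet_derivative (cmap d \<circ> cinv c) (at (cmap c x)) (v c))}"

text \<open>The tangent vector at \<open>x\<close> represented by \<open>u\<close> in the chart \<open>c\<close>.\<close>

definition tangent_vec ::
    "('m, 'n::finite) chart set \<Rightarrow> ('m, 'n) chart \<Rightarrow> 'm \<Rightarrow> real^'n \<Rightarrow> ('m, 'n) tvec" where
  "tangent_vec A c x u =
    (\<lambda>d. if d \<in> A \<and> x \<in> cdom d
         then frechet_derivative (cmap d \<circ> cinv c) (at (cmap c x)) u else 0)"

text \<open>The choice of \<open>c\<close> does not matter when \<open>v\<close> is a tangent vector at \<open>x\<close>.\<close>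

definition differential ::
    "('m, 'n::finite) chart set \<Rightarrow> ('m \<Rightarrow> 'm) \<Rightarrow> 'm \<Rightarrow> ('m, 'n) tvec \<Rightarrow> ('m, 'n) tvec" where
  "differential A \<Phi> x v =
    (let c = SOME c. c \<in> A \<and> x \<in> cdom c
     in (\<lambda>d. if d \<in> A \<and> \<Phi> x \<in> cdom d
             then frechet_derivative (cmap d \<circ> \<Phi> \<circ> cinv c) (at (cmap c x)) (v c) else 0))"

subsection \<open>Bilinear forms on a subspace\<close>

definition bilinear_form_on :: "'v::real_vector set \<Rightarrow> ('v \<Rightarrow> 'v \<Rightarrow> real) \<Rightarrow> bool" where
  "bilinear_form_on V b \<longleftrightarrow>
    (\<forall>u\<in>V. \<forall>v\<in>V. \<forall>w\<in>V. \<forall>r. b (u + v) w = b u w + b v w \<and> b w (u + v) = b w u + b w v \<and>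
       b (r *\<^sub>R u) w = r * b u w \<and> b w (r *\<^sub>R u) = r * b w u)"

definition symmetric_on :: "'v set \<Rightarrow> ('v \<Rightarrow> 'v \<Rightarrow> real) \<Rightarrow> bool" where
  "symmetric_on V b \<longleftrightarrow> (\<forall>u\<in>V. \<forall>v\<in>V. b u v = b v u)"

definition positive_definite_on :: "'v::real_vector set \<Rightarrow> ('v \<Rightarrow> 'v \<Rightarrow> real) \<Rightarrow> bool" where
  "positive_definite_on V b \<longleftrightarrow> (\<forall>v\<in>V. v \<noteq> 0 \<longrightarrow> 0 < b v v)"

definition form_rank :: "'v::real_vector set \<Rightarrow> ('v \<Rightarrow> 'v \<Rightarrow> real) \<Rightarrow> nat" where
  "form_rank V b = dim V - dim {u\<in>V. \<forall>v\<in>V. b u v = 0}"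

text \<open>
  By Sylvester's law of inertia, this is the number of positive diagonal entries in any
  diagonalisation of the symmetric form \<open>b\<close> on the finite-dimensional space \<open>V\<close>.
\<close>

definition positive_index :: "'v::real_vector set \<Rightarrow> ('v \<Rightarrow> 'v \<Rightarrow> real) \<Rightarrow> nat" where
  "positive_index V b = Max (dim ` {S. subspace S \<and> S \<subseteq> V \<and> positive_definite_on S b})"

definition signature :: "'v::real_vector set \<Rightarrow> ('v \<Rightarrow> 'v \<Rightarrow> real) \<Rightarrow> nat \<times> nat" where
  "signature V b = (positive_index V b, positive_index V (\<lambda>u v. - b u v))"

definition orthonormal_basis_of ::
    "'v::real_vector set \<Rightarrow> ('v \<Rightarrow> 'v \<Rightarrow> real) \<Rightarrow> 'v set \<Rightarrow> bool" where
  "orthonormal_basis_of V b E \<longleftrightarrow>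
    E \<subseteq> V \<and> span E = V \<and> (\<forall>e\<in>E. \<forall>e'\<in>E. b e e' = (if e = e' then 1 else 0))"

subsection \<open>Covariant 2-tensor fields and metrics\<close>

text \<open>Only the values on tangent vectors at the base point matter.\<close>

type_synonym ('m, 'n) tensor2 = "'m \<Rightarrow> ('m, 'n) tvec \<Rightarrow> ('m, 'n) tvec \<Rightarrow> real"

definition components ::
    "('m, 'n::finite) chart set \<Rightarrow> ('m, 'n) tensor2 \<Rightarrow> ('m, 'n) chart \<Rightarrow> 'm \<Rightarrow> real^'n^'n" where
  "components A h c x =
    (\<chi> i j. h x (tangent_vec A c x (axis i 1)) (tangent_vec A c x (axis j 1)))"

definition smooth_tensor2 ::
    "('m::topological_space, 'n::finite) chart set \<Rightarrow> ('m, 'n) tensor2 \<Rightarrow> bool" where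
  "smooth_tensor2 A h \<longleftrightarrow>
    (\<forall>x. bilinear_form_on (tangent_space A x) (h x)) \<and>
    (\<forall>c\<in>A. \<forall>i j. smooth_on (cmap c ` cdom c) (\<lambda>y. components A h c (cinv c y) $ i $ j))"

definition sub_semi_riemannian_metric ::
    "('m::topological_space, 'n::finite) chart set \<Rightarrow> ('m, 'n) tensor2 \<Rightarrow> bool" where
  "sub_semi_riemannian_metric A h \<longleftrightarrow> smooth_tensor2 A h \<and>
    (\<forall>x. symmetric_on (tangent_space A x) (h x)) \<and>
    (\<forall>x y. form_rank (tangent_space A x) (h x) = form_rank (tangent_space A y) (h y)) \<and>
    (\<forall>x y. signature (tangent_space A x) (h x) = signature (tangent_space A y) (h y))"

definition riemannian_metric ::
    "('m::topological_space, 'n::finite) chart set \<Rightarrow> ('m, 'n) tensor2 \<Rightarrow> bool" where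
  "riemannian_metric A g \<longleftrightarrow> smooth_tensor2 A g \<and>
    (\<forall>x. symmetric_on (tangent_space A x) (g x)) \<and>
    (\<forall>x. positive_definite_on (tangent_space A x) (g x))"

definition pullback ::
    "('m, 'n::finite) chart set \<Rightarrow> ('m \<Rightarrow> 'm) \<Rightarrow> ('m, 'n) tensor2 \<Rightarrow> ('m, 'n) tensor2" where
  "pullback A \<Phi> h = (\<lambda>x u v. h (\<Phi> x) (differential A \<Phi> x u) (differential A \<Phi> x v))"

subsection \<open>The \<open>L\<^sup>p\<close> norm relative to a Riemannian metric\<close>

text \<open>
  In coordinates, \<open>|h|\<^sub>g\<^sup>2 = g\<^sup>i\<^sup>k g\<^sup>j\<^sup>l h\<^sub>i\<^sub>j h\<^sub>k\<^sub>l\<close>; the value does not depend on the orthonormal basis.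
\<close>

definition pointwise_norm ::
    "('m, 'n::finite) chart set \<Rightarrow> ('m, 'n) tensor2 \<Rightarrow> ('m, 'n) tensor2 \<Rightarrow> 'm \<Rightarrow> real" where
  "pointwise_norm A g h x =
    (let E = SOME E. orthonormal_basis_of (tangent_space A x) (g x) E
     in sqrt (\<Sum>e\<in>E. \<Sum>e'\<in>E. (h x e e')\<^sup>2))"

text \<open>The unique Borel measure with density \<open>sqrt (det (g\<^sub>i\<^sub>j))\<close> in every chart.\<close>

definition riemannian_measure ::
    "('m::topological_space, 'n::finite) chart set \<Rightarrow> ('m, 'n) tensor2 \<Rightarrow> 'm measure" where
  "riemannian_measure A g =
    (THE \<mu>. sets \<mu> = sets borel \<and>
       (\<forall>c\<in>A. \<forall>B\<in>sets borel. B \<subseteq> cdom c \<longrightarrow>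
          emeasure \<mu> B =
            (\<integral>\<^sup>+ y \<in> cmap c ` B. ennreal (sqrt (det (components A g c (cinv c y)))) \<partial>lborel)))"

definition in_Lp ::
    "('m::topological_space, 'n::finite) chart set \<Rightarrow> ('m, 'n) tensor2 \<Rightarrow> real \<Rightarrow>
     ('m, 'n) tensor2 \<Rightarrow> bool" where
  "in_Lp A g p h \<longleftrightarrow> integrable (riemannian_measure A g) (\<lambda>x. pointwise_norm A g h x powr p)"

text \<open>The value is meaningful only under \<^const>\<open>in_Lp\<close>: the Bochner integral is \<open>0\<close> otherwise.\<close>

definition Lp_norm ::
    "('m::topological_space, 'n::finite) chart set \<Rightarrow> ('m, 'n) tensor2 \<Rightarrow> real \<Rightarrow>
     ('m, 'n) tensor2 \<Rightarrow> real" where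
  "Lp_norm A g p h =
    (LINT x|riemannian_measure A g. pointwise_norm A g h x powr p) powr (1 / p)"

end

theory Submission
  imports Defs
begin

text \<open>
  In a chart around \<open>a\<close>, equality of the signatures gives a linear isomorphism \<open>L\<close> pulling the form
  of \<open>G\<close> at \<open>a\<close> back to that of \<open>\<GG>\<close> at \<open>a\<close>. Fill \<open>M\<close> up to small measure with disjoint small chart
  balls, and let \<open>\<Phi>\<close> be a diffeomorphism preserving each ball and equal to \<open>y \<mapsto> a + \<delta> L(y - a)\<close> on
  most of it; for small \<open>\<delta>\<close> such a map exists because, after composing with a reflection that is an
  isometry, \<open>L\<close> is a product of linear maps close to the identity. Put \<open>f = F \<circ> \<Phi>\<^sup>-\<^sup>1\<close> with
  \<open>F = \<eta> + \<Sum>\<^sub>i \<delta>\<^sub>i\<^sup>-\<^sup>2 \<theta>\<^sub>i\<close>, where \<open>\<theta>\<^sub>i\<close> is a cutoff function of the \<open>i\<close>-th ball. The factors \<open>\<delta>\<^sup>2\<close> cancel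
  in \<open>\<Phi>\<^sup>*(f G) = F \<Phi>\<^sup>*G\<close>, so this tensor is uniformly close to \<open>(\<Sum>\<^sub>i \<theta>\<^sub>i) \<GG>\<close>, which differs from
  \<open>\<GG>\<close> only on a set of small measure.
\<close>

subsection \<open>Calculus of smooth functions\<close>

text \<open>The factor \<delta> is there because \<open>L\<close> need not map a ball into itself;
  the shrunken map does, and can be joined to the identity near the boundary sphere. A
  diffeomorphism that is the identity near the sphere preserves orientation, which is why
  \<open>L\<close> must have positive determinant and a reflection may be required. In the shell
  where the two maps are joined, \<open>\<Phi>\<close> is not controlled at all, and no bound on its
  derivatives is prescribed in advance. Two choices make this harmless. Each cutoff function lives
  on a middle ball where \<open>\<Phi>\<close> is still affine, so that on the shell only
  \<open>\<eta>\<close> times the pullback of \<open>G\<close> is left. And \<open>\<eta>\<close>,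
  which keeps \<open>f\<close> positive off the middle balls, is fixed last: once
  \<open>\<Phi>\<close> is known, the norm of the pullback is continuous on a compact manifold,
  hence bounded by some \<open>B\<close>, and \<open>\<eta> = e / B\<close> suffices. Likewise the
  radius up to which \<open>L\<close> stays nearly isometric depends on the centre only and is known
  before any ball is selected.\<close>

lemma Ck_on_SucD:
  assumes "Ck_on (Suc k) S f" "x \<in> S"
  shows "(f has_derivative frechet_derivative f (at x)) (at x)"
  using assms by (auto simp: frechet_derivative_works)

lemma Ck_on_continuous: "Ck_on k S f \<Longrightarrow> continuous_on S f"
  by (cases k) (auto simp: differentiable_on_def differentiable_at_withinI
      intro!: differentiable_imp_continuous_on)

lemma Ck_on_Suc_imp: "Ck_on (Suc k) S f \<Longrightarrow> Ck_on k S f"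
proof (induction k arbitrary: f)
  case 0
  then show ?case using Ck_on_continuous[OF 0] by simp
next
  case (Suc k)
  then show ?case by (auto simp del: Ck_on.simps simp: Ck_on.simps(2)[of "Suc k"] Ck_on.simps(2)[of k])
qed

lemma Ck_on_cong_imp:
  assumes "open S" "\<And>x. x \<in> S \<Longrightarrow> f x = g x" "Ck_on k S f"
  shows "Ck_on k S g"
  using assms(2,3)
proof (induction k arbitrary: f g)
  case 0
  then show ?case using continuous_on_cong by fastforce
next
  case (Suc k)
  have d: "f differentiable at x" if "x \<in> S" for x
    using Suc.prems that by auto
  have fr: "frechet_derivative f (at x) = frechet_derivative g (at x)" if "x \<in> S" for x
    using frechet_derivative_transform_within_open[OF d[OF that] assms(1) that] Suc.prems(1) by simp
  have "g differentiable at x" if "x \<in> S" for x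
    using d[OF that] Suc.prems(1) assms(1) that
    by (meson differentiable_def has_derivative_transform_within_open)
  moreover have "Ck_on k S (\<lambda>x. frechet_derivative g (at x) v)" for v
    by (rule Suc.IH[where f="\<lambda>x. frechet_derivative f (at x) v"]) (use Suc.prems fr in auto)
  ultimately show ?case by auto
qed

text \<open>Derivatives at a point of an open set are unique, so a formula found by any rule of
  calculus may replace \<open>frechet_derivative\<close>, which is defined by choice. Most closure
  properties below are inductions through this rule.\<close>

lemma Ck_on_SucI:
  assumes "open S" "\<And>x. x \<in> S \<Longrightarrow> (f has_derivative f' x) (at x)"
    "\<And>v. Ck_on k S (\<lambda>x. f' x v)"
  shows "Ck_on (Suc k) S f"
proof -
  have "f' x = frechet_derivative f (at x)" if "x \<in> S" for x
    using assms(2)[OF that] frechet_derivative_at by blast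
  then have "Ck_on k S (\<lambda>x. frechet_derivative f (at x) v)" for v
    using Ck_on_cong_imp[OF assms(1) _ assms(3)[of v]] by simp
  then show ?thesis using assms(2) by (auto simp: differentiable_def)
qed

lemma Ck_on_subset: "Ck_on k S f \<Longrightarrow> T \<subseteq> S \<Longrightarrow> Ck_on k T f"
  by (induction k arbitrary: f) (auto intro: continuous_on_subset)

lemma Ck_on_local:
  assumes "\<And>x. x \<in> S \<Longrightarrow> \<exists>U. open U \<and> x \<in> U \<and> Ck_on k U f"
  shows "Ck_on k S f"
  using assms
proof (induction k arbitrary: f)
  case 0
  have "isCont f x" if "x \<in> S" for x
  proof -
    obtain U where "open U" "x \<in> U" "continuous_on U f" using 0[OF \<open>x \<in> S\<close>] by auto
    then show ?thesis by (simp add: continuous_on_eq_continuous_at)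
  qed
  then show ?case by (simp add: continuous_at_imp_continuous_on)
next
  case (Suc k)
  have "f differentiable at x" if "x \<in> S" for x
    using Suc.prems[OF that] by auto
  moreover have "Ck_on k S (\<lambda>x. frechet_derivative f (at x) v)" for v
    by (rule Suc.IH) (use Suc.prems in force)
  ultimately show ?case by simp
qed

lemma Ck_on_const: "open S \<Longrightarrow> Ck_on k S (\<lambda>x. c)"
proof (induction k arbitrary: c)
  case (Suc k)
  then show ?case by (intro Ck_on_SucI[where f'="\<lambda>x v. 0"]) auto
qed simp

lemma Ck_on_bounded_linear:
  assumes "open S" "bounded_linear L" "Ck_on k S f"
  shows "Ck_on k S (\<lambda>x. L (f x))"
  using assms(3)
proof (induction k arbitrary: f)
  case 0
  then show ?case using bounded_linear.continuous_on[OF assms(2)] by auto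
next
  case (Suc k)
  show ?case
  proof (rule Ck_on_SucI[OF assms(1)])
    show "((\<lambda>x. L (f x)) has_derivative (\<lambda>v. L (frechet_derivative f (at x) v))) (at x)" if "x \<in> S" for x
      using bounded_linear.has_derivative[OF assms(2) Ck_on_SucD[OF Suc.prems that]] .
    show "Ck_on k S (\<lambda>x. L (frechet_derivative f (at x) v))" for v
      by (rule Suc.IH) (use Suc.prems in auto)
  qed
qed

lemma Ck_on_id: "open S \<Longrightarrow> Ck_on k S (\<lambda>x. x)"
  by (cases k) (auto intro!: Ck_on_SucI[where f'="\<lambda>x v. v"] Ck_on_const simp del: Ck_on.simps(2))

lemma Ck_on_add:
  assumes "open S" "Ck_on k S f" "Ck_on k S g"
  shows "Ck_on k S (\<lambda>x. f x + g x)"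
  using assms(2,3)
proof (induction k arbitrary: f g)
  case (Suc k)
  show ?case
  proof (rule Ck_on_SucI[OF assms(1)])
    show "((\<lambda>x. f x + g x) has_derivative
        (\<lambda>v. frechet_derivative f (at x) v + frechet_derivative g (at x) v)) (at x)" if "x \<in> S" for x
      using has_derivative_add[OF Ck_on_SucD[OF Suc.prems(1) that] Ck_on_SucD[OF Suc.prems(2) that]] .
    show "Ck_on k S (\<lambda>x. frechet_derivative f (at x) v + frechet_derivative g (at x) v)" for v
      by (rule Suc.IH) (use Suc.prems in auto)
  qed
qed (auto intro: continuous_on_add)

lemma Ck_on_scaleR:
  fixes f :: "'a::euclidean_space \<Rightarrow> real"
  assumes "open S" "Ck_on k S f" "Ck_on k S g"
  shows "Ck_on k S (\<lambda>x. f x *\<^sub>R g x)"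
  using assms(2,3)
proof (induction k arbitrary: f g)
  case (Suc k)
  show ?case
  proof (rule Ck_on_SucI[OF assms(1)])
    show "((\<lambda>x. f x *\<^sub>R g x) has_derivative
        (\<lambda>v. f x *\<^sub>R frechet_derivative g (at x) v + frechet_derivative f (at x) v *\<^sub>R g x)) (at x)" if "x \<in> S" for x
      using has_derivative_scaleR[OF Ck_on_SucD[OF Suc.prems(1) that] Ck_on_SucD[OF Suc.prems(2) that]] .
    show "Ck_on k S (\<lambda>x. f x *\<^sub>R frechet_derivative g (at x) v + frechet_derivative f (at x) v *\<^sub>R g x)" for v
      by (intro Ck_on_add assms(1) Suc.IH)
        (use Suc.prems Ck_on_Suc_imp[OF Suc.prems(1)] Ck_on_Suc_imp[OF Suc.prems(2)] in auto)
  qed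
qed (auto intro: continuous_on_scaleR)

lemma Ck_on_mult:
  fixes f g :: "'a::euclidean_space \<Rightarrow> real"
  assumes "open S" "Ck_on k S f" "Ck_on k S g"
  shows "Ck_on k S (\<lambda>x. f x * g x)"
  using Ck_on_scaleR[OF assms] by simp

lemma Ck_on_sum:
  assumes "open S" "\<And>i. i \<in> I \<Longrightarrow> Ck_on k S (f i)"
  shows "Ck_on k S (\<lambda>x. \<Sum>i\<in>I. f i x)"
  using assms(2) by (induction I rule: infinite_finite_induct) (auto intro: Ck_on_add Ck_on_const assms(1))

lemma Ck_on_prod:
  fixes f :: "'i \<Rightarrow> 'a::euclidean_space \<Rightarrow> real"
  assumes "open S" "\<And>i. i \<in> I \<Longrightarrow> Ck_on k S (f i)"
  shows "Ck_on k S (\<lambda>x. \<Prod>i\<in>I. f i x)"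
  using assms(2) by (induction I rule: infinite_finite_induct) (auto intro: Ck_on_mult Ck_on_const assms(1))

lemma Ck_on_inverse:
  fixes f :: "'a::euclidean_space \<Rightarrow> real"
  assumes "open S" "Ck_on k S f" "\<And>x. x \<in> S \<Longrightarrow> f x \<noteq> 0"
  shows "Ck_on k S (\<lambda>x. inverse (f x))"
  using assms(2)
proof (induction k)
  case 0
  then show ?case using assms(3) by (auto intro: continuous_on_inverse)
next
  case (Suc k)
  have i: "Ck_on k S (\<lambda>x. inverse (f x))" using Suc Ck_on_Suc_imp by blast
  show ?case
  proof (rule Ck_on_SucI[OF assms(1)])
    show "((\<lambda>x. inverse (f x)) has_derivative
        (\<lambda>v. (-1) *\<^sub>R (inverse (f x) * frechet_derivative f (at x) v * inverse (f x)))) (at x)" if "x \<in> S" for x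
      using Deriv.has_derivative_inverse[OF assms(3)[OF that] Ck_on_SucD[OF Suc.prems that]]
      by simp
    show "Ck_on k S (\<lambda>x. (-1) *\<^sub>R (inverse (f x) * frechet_derivative f (at x) v * inverse (f x)))" for v
      by (intro Ck_on_scaleR Ck_on_mult Ck_on_const assms(1) i) (use Suc.prems in auto)
  qed
qed

text \<open>The chain rule yields the derivative of \<open>g\<close> at \<open>f x\<close> applied
  to a vector that itself varies with \<open>x\<close>, which the induction hypothesis does not
  cover. Expanding this vector in \<open>Basis\<close> leaves scalar coefficients from the
  derivative of \<open>f\<close> times partial derivatives of \<open>g\<close> composed with
  \<open>f\<close>, and these are covered.\<close>

lemma Ck_on_compose:
  fixes f :: "'a::euclidean_space \<Rightarrow> 'b::euclidean_space"
  assumes "open S" "open T" "f ` S \<subseteq> T" "Ck_on k S f" "Ck_on k T g"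
  shows "Ck_on k S (\<lambda>x. g (f x))"
  using assms(4,5)
proof (induction k arbitrary: g)
  case 0
  then show ?case using continuous_on_compose2[of T g S f] assms(3) by auto
next
  case (Suc k)
  have lin: "linear (frechet_derivative g (at y))" if "y \<in> T" for y
    using has_derivative_linear[OF Ck_on_SucD[OF Suc.prems(2) that]] .
  show ?case
  proof (rule Ck_on_SucI[OF assms(1)])
    show "((\<lambda>x. g (f x)) has_derivative (\<lambda>v. \<Sum>b\<in>Basis. (frechet_derivative f (at x) v \<bullet> b) *\<^sub>R
        frechet_derivative g (at (f x)) b)) (at x)" if x: "x \<in> S" for x
    proof -
      have fx: "f x \<in> T" using x assms(3) by auto
      have der: "((\<lambda>x. g (f x)) has_derivative (\<lambda>v. frechet_derivative g (at (f x)) (frechet_derivative f (at x) v))) (at x)"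
        using has_derivative_compose[OF Ck_on_SucD[OF Suc.prems(1) x] Ck_on_SucD[OF Suc.prems(2) fx]] .
      have "frechet_derivative g (at (f x)) w = (\<Sum>b\<in>Basis. (w \<bullet> b) *\<^sub>R
        frechet_derivative g (at (f x)) b)" for w
      proof -
        have "frechet_derivative g (at (f x)) w = frechet_derivative g (at (f x)) (\<Sum>b\<in>Basis. (w \<bullet> b) *\<^sub>R b)"
          by (simp add: euclidean_representation)
        also have "\<dots> = (\<Sum>b\<in>Basis. (w \<bullet> b) *\<^sub>R frechet_derivative g (at (f x)) b)"
          by (subst linear_sum[OF lin[OF fx]], subst linear_cmul[OF lin[OF fx]], rule refl)
        finally show ?thesis .
      qed
      then have "(\<lambda>v. frechet_derivative g (at (f x)) (frechet_derivative f (at x) v)) =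
          (\<lambda>v. \<Sum>b\<in>Basis. (frechet_derivative f (at x) v \<bullet> b) *\<^sub>R frechet_derivative g (at (f x)) b)"
        by (rule ext)
      with der show ?thesis by (rule back_subst)
    qed
    show "Ck_on k S (\<lambda>x. \<Sum>b\<in>Basis. (frechet_derivative f (at x) v \<bullet> b) *\<^sub>R
        frechet_derivative g (at (f x)) b)" for v
    proof (intro Ck_on_sum Ck_on_scaleR assms(1))
      fix b :: 'b
      show "Ck_on k S (\<lambda>x. frechet_derivative f (at x) v \<bullet> b)"
        by (rule Ck_on_bounded_linear[OF assms(1) bounded_linear_inner_left]) (use Suc.prems in auto)
      show "Ck_on k S (\<lambda>x. frechet_derivative g (at (f x)) b)"
        by (rule Suc.IH) (use Suc.prems Ck_on_Suc_imp[OF Suc.prems(1)] in auto)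
    qed
  qed
qed

lemma Ck_on_vec_nth:
  fixes f :: "'a::euclidean_space \<Rightarrow> real^'n"
  assumes "open S" "Ck_on k S f"
  shows "Ck_on k S (\<lambda>x. f x $ i)"
  by (rule Ck_on_bounded_linear[OF assms(1) bounded_linear_vec_nth assms(2)])

lemma Ck_on_vec:
  fixes f :: "'a::euclidean_space \<Rightarrow> real^'n"
  assumes "open S" "\<And>i. Ck_on k S (\<lambda>x. f x $ i)"
  shows "Ck_on k S f"
proof -
  have "f = (\<lambda>x. \<Sum>i\<in>UNIV. (f x $ i) *\<^sub>R axis i 1)"
    using basis_expansion[of "f _"] by (auto simp: fun_eq_iff scalar_mult_eq_scaleR)
  moreover have "Ck_on k S (\<lambda>x. \<Sum>i\<in>UNIV. (f x $ i) *\<^sub>R axis i (1::real))"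
    by (intro Ck_on_sum Ck_on_scaleR Ck_on_const assms)
  ultimately show ?thesis by simp
qed

lemma Ck_on_det:
  fixes M :: "'a::euclidean_space \<Rightarrow> real^'n^'n"
  assumes "open S" "\<And>i j. Ck_on k S (\<lambda>x. M x $ i $ j)"
  shows "Ck_on k S (\<lambda>x. det (M x))"
  unfolding det_def by (intro Ck_on_sum Ck_on_mult Ck_on_prod Ck_on_const assms)

lemma smooth_on_imp_Ck: "smooth_on S f \<Longrightarrow> Ck_on k S f"
  by (simp add: smooth_on_def)

lemma smooth_on_subset: "smooth_on S f \<Longrightarrow> T \<subseteq> S \<Longrightarrow> smooth_on T f"
  unfolding smooth_on_def using Ck_on_subset by blast

lemma smooth_on_cong_imp:
  "open S \<Longrightarrow> (\<And>x. x \<in> S \<Longrightarrow> f x = g x) \<Longrightarrow> smooth_on S f \<Longrightarrow> smooth_on S g"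
  unfolding smooth_on_def using Ck_on_cong_imp by blast

lemma smooth_on_local:
  "(\<And>x. x \<in> S \<Longrightarrow> \<exists>U. open U \<and> x \<in> U \<and> smooth_on U f) \<Longrightarrow> smooth_on S f"
  unfolding smooth_on_def by (meson Ck_on_local)

lemma smooth_on_const: "open S \<Longrightarrow> smooth_on S (\<lambda>x. c)"
  by (simp add: smooth_on_def Ck_on_const)

lemma smooth_on_id: "open S \<Longrightarrow> smooth_on S (\<lambda>x. x)"
  by (simp add: smooth_on_def Ck_on_id)

lemma smooth_on_bounded_linear:
  "open S \<Longrightarrow> bounded_linear L \<Longrightarrow> smooth_on S f \<Longrightarrow> smooth_on S (\<lambda>x. L (f x))"
  by (simp add: smooth_on_def Ck_on_bounded_linear)

lemma smooth_on_add:
  "open S \<Longrightarrow> smooth_on S f \<Longrightarrow> smooth_on S g \<Longrightarrow> smooth_on S (\<lambda>x. f x + g x)"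
  by (simp add: smooth_on_def Ck_on_add)

lemma smooth_on_scaleR:
  fixes f :: "'a::euclidean_space \<Rightarrow> real"
  shows "open S \<Longrightarrow> smooth_on S f \<Longrightarrow> smooth_on S g \<Longrightarrow> smooth_on S (\<lambda>x. f x *\<^sub>R g x)"
  by (simp add: smooth_on_def Ck_on_scaleR)

lemma smooth_on_compose:
  fixes f :: "'a::euclidean_space \<Rightarrow> 'b::euclidean_space"
  assumes "open S" "open T" "f ` S \<subseteq> T" "smooth_on S f" "smooth_on T g"
  shows "smooth_on S (\<lambda>x. g (f x))"
  using assms Ck_on_compose unfolding smooth_on_def by blast

lemma smooth_on_imp_continuous_on: "smooth_on S f \<Longrightarrow> continuous_on S f"
  using Ck_on_continuous smooth_on_def by blast

lemma smooth_on_has_derivative: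
  "smooth_on S f \<Longrightarrow> x \<in> S \<Longrightarrow> (f has_derivative frechet_derivative f (at x)) (at x)"
  using Ck_on_SucD smooth_on_def by blast

lemma smooth_on_frechet_derivative:
  "smooth_on S f \<Longrightarrow> smooth_on S (\<lambda>x. frechet_derivative f (at x) v)"
  unfolding smooth_on_def by (metis Ck_on.simps(2))

text \<open>A bootstrapping argument: existence and continuity of the inverse are given. If
  \<open>G\<close> is of class k, then so is its derivative, the inverse of the derivative of
  \<open>F\<close> at \<open>G y\<close>, because Cramer's rule writes it as a rational expression
  in entries that are of class k. Hence \<open>G\<close> is of class k + 1.\<close>

lemma smooth_on_inverse_function:
  fixes F G :: "real^'n \<Rightarrow> real^'n"
  assumes S: "open S" and T: "open T" and F: "smooth_on S F" and GS: "G ` T \<subseteq> S"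
    and FG: "\<And>y. y \<in> T \<Longrightarrow> F (G y) = y" and G: "continuous_on T G"
    and inj: "\<And>x. x \<in> S \<Longrightarrow> inj (frechet_derivative F (at x))"
  shows "smooth_on T G"
proof -
  have "Ck_on k T G" for k
  proof (induction k)
    case 0
    then show ?case using G by simp
  next
    case (Suc k)
    define D where "D y = frechet_derivative F (at (G y))" for y
    have lD: "linear (D y)" "bij (D y)" if "y \<in> T" for y
    proof -
      have gs: "G y \<in> S" using GS that by auto
      show l: "linear (D y)" unfolding D_def
        using has_derivative_linear smooth_on_has_derivative[OF F gs] by blast
      show "bij (D y)" using linear_injective_imp_surjective[OF l] inj[OF gs] by (simp add: D_def bij_def)
    qed
    define N where "N y = (\<chi> i j. D y (axis j 1) $ i)" for y
    define M where "M v k y = (\<chi> i j. if j = k then v $ i else N y $ i $ j)" for v k y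
    have N: "N y = matrix (D y)" for y by (simp add: N_def matrix_def)
    have detN: "det (N y) \<noteq> 0" if "y \<in> T" for y
      using lD[OF that] by (metis N bij_is_inj det_nz_iff_inj)
    have inv_eq: "inv (D y) v = (\<chi> k. det (M v k y) / det (N y))" if "y \<in> T" for y v
    proof -
      have "N y *v (inv (D y) v) = v"
        by (metis N lD[OF that] bij_inv_eq_iff matrix_works linear_matrix_vector_mul_eq)
      then show ?thesis
        using cramer[OF detN[OF that], of "inv (D y) v" v] by (simp add: M_def)
    qed
    have CD: "Ck_on k T (\<lambda>y. D y (axis j 1) $ i)" for i j
    proof (rule Ck_on_vec_nth[OF T])
      show "Ck_on k T (\<lambda>y. D y (axis j 1))"
        unfolding D_def
        by (rule Ck_on_compose[OF T S GS Suc, of "\<lambda>z. frechet_derivative F (at z) (axis j 1)"])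
          (rule smooth_on_imp_Ck[OF smooth_on_frechet_derivative[OF F]])
    qed
    show ?case
    proof (rule Ck_on_SucI[OF T])
      fix y assume y: "y \<in> T"
      show "(G has_derivative inv (D y)) (at y)"
      proof (rule has_derivative_inverse_basic[where T=T and f=F and f'="D y"])
        show "(F has_derivative D y) (at (G y))"
          unfolding D_def by (rule smooth_on_has_derivative[OF F]) (use GS y in auto)
        show "bounded_linear (inv (D y))"
          using inj_linear_imp_inv_linear[OF lD(1)[OF y] bij_is_inj[OF lD(2)[OF y]]]
          by (simp add: linear_conv_bounded_linear)
        show "inv (D y) \<circ> D y = id" using lD[OF y] by (simp add: bij_is_inj)
        show "isCont G y" using G T y continuous_on_eq_continuous_at by blast
      qed (use T y FG in auto)
    next
      fix v
      have "Ck_on k T (\<lambda>y. (\<chi> k. det (M v k y) / det (N y)))"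
      proof (rule Ck_on_vec[OF T], simp add: divide_inverse, intro Ck_on_mult Ck_on_inverse T Ck_on_det)
        fix i j l
        show "Ck_on k T (\<lambda>x. M v l x $ i $ j)"
          using CD T by (cases "j = l") (auto simp: M_def N_def Ck_on_const)
        show "Ck_on k T (\<lambda>x. N x $ i $ j)" using CD by (simp add: N_def)
      qed (use detN in auto)
      then show "Ck_on k T (\<lambda>y. inv (D y) v)"
        by (rule Ck_on_cong_imp[OF T, rotated]) (use inv_eq in auto)
    qed
  qed
  then show ?thesis by (simp add: smooth_on_def)
qed

subsection \<open>Bump functions\<close>

text \<open>The span of the functions x^-m exp(-1/x), extended by 0, is closed under
  differentiation. Treating all exponents \<open>m\<close> together makes smoothness at 0 a plain
  induction.\<close>

definition flat :: "nat \<Rightarrow> real \<Rightarrow> real"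
  where "flat m x = (if x \<le> 0 then 0 else inverse x ^ m * exp (- inverse x))"

lemma flat_tendsto_0: "(flat m \<longlongrightarrow> 0) (at 0)"
proof -
  have "((\<lambda>x. inverse x ^ m / exp (inverse x)) \<longlongrightarrow> (0::real)) (at_right 0)"
    by (rule filterlim_compose[OF tendsto_power_div_exp_0 filterlim_inverse_at_top_right])
  then have r: "(flat m \<longlongrightarrow> 0) (at_right 0)"
    by (rule Lim_transform_eventually)
      (auto simp: eventually_at_filter flat_def exp_minus divide_inverse intro: always_eventually)
  have "(flat m \<longlongrightarrow> 0) (at_left 0)"
    by (rule Lim_transform_eventually[OF tendsto_const])
      (auto simp: eventually_at_filter flat_def intro: always_eventually)
  with r show ?thesis by (simp add: filterlim_at_split)
qed

lemma flat_has_derivative: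
  "(flat m has_real_derivative (flat (m+2) x - real m * flat (m+1) x)) (at x)"
proof -
  consider "x < 0" | "x = 0" | "x > 0" by linarith
  then show ?thesis
  proof cases
    case 1
    have "((\<lambda>x. 0) has_real_derivative 0) (at x)" by simp
    then have "(flat m has_real_derivative 0) (at x)"
      by (rule has_field_derivative_transform_within[where d="-x"]) (use 1 in \<open>auto simp: flat_def dist_real_def\<close>)
    then show ?thesis using 1 by (simp add: flat_def)
  next
    case 2
    \<comment> \<open>The difference quotient of \<open>flat m\<close> at 0 is
      \<open>flat (m+1)\<close>, whose limit at 0 is already known.\<close>
    have "((\<lambda>h. (flat m (0 + h) - flat m 0) / h) \<longlongrightarrow> 0) (at 0)"
      by (rule Lim_transform_eventually[OF flat_tendsto_0[of "m+1"]])
        (auto simp: eventually_at_filter flat_def field_simps intro: always_eventually)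
    then show ?thesis using 2 by (simp add: DERIV_def flat_def)
  next
    case 3
    have "((\<lambda>x. inverse x ^ m * exp (- inverse x)) has_real_derivative
        (inverse x ^ (m+2) * exp (- inverse x) - real m * (inverse x ^ (m+1) * exp (- inverse x)))) (at x)"
    proof -
      have i: "(inverse has_real_derivative - (inverse x ^ 2)) (at x)"
        using DERIV_inverse[of x UNIV] 3 by (simp add: numeral_2_eq_2)
      have e: "((\<lambda>x. exp (- inverse x)) has_real_derivative exp (- inverse x) * inverse x ^ 2) (at x)"
        using DERIV_chain2[OF DERIV_exp DERIV_minus[OF i]] by simp
      have "((\<lambda>x. inverse x ^ m * exp (- inverse x)) has_real_derivative
          real m * (inverse x ^ (m - 1) * - (inverse x ^ 2)) * exp (- inverse x)
          + exp (- inverse x) * inverse x ^ 2 * inverse x ^ m) (at x)"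
        using DERIV_mult[OF DERIV_power[OF i, of m] e] by (simp add: algebra_simps)
      then show ?thesis by (cases m) (simp_all add: algebra_simps power2_eq_square)
    qed
    then have "(flat m has_real_derivative
        (inverse x ^ (m+2) * exp (- inverse x) - real m * (inverse x ^ (m+1) * exp (- inverse x)))) (at x)"
      by (rule has_field_derivative_transform_within[where d=x]) (use 3 in \<open>auto simp: flat_def dist_real_def\<close>)
    then show ?thesis using 3 by (simp add: flat_def)
  qed
qed

lemma Ck_on_flat: "Ck_on k UNIV (flat m)"
proof (induction k arbitrary: m)
  case 0
  then show ?case
    using flat_has_derivative[of m] by (auto intro!: continuous_at_imp_continuous_on DERIV_isCont)
next
  case (Suc k)
  show ?case
  proof (rule Ck_on_SucI)
    show "(flat m has_derivative (\<lambda>v. (flat (m+2) x + (- real m) * flat (m+1) x) * v)) (at x)" for x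
      using flat_has_derivative[of m x] unfolding has_field_derivative_def by simp
    show "Ck_on k UNIV (\<lambda>x. (flat (m+2) x + (- real m) * flat (m+1) x) * v)" for v
      by (intro Ck_on_mult Ck_on_add Ck_on_const Suc open_UNIV)
  qed simp
qed

text \<open>The quotient \<open>u / (u + w)\<close>, with \<open>u\<close> positive exactly inside
  radius \<open>r\<close> and \<open>w\<close> positive exactly outside radius \<open>s\<close>. As
  \<open>s < r\<close>, they never vanish together and the denominator is positive.\<close>

lemma smooth_bump:
  fixes a :: "real^'n"
  assumes "0 < s" "s < r"
  obtains \<theta> where "smooth_on UNIV \<theta>" "\<And>x. 0 \<le> \<theta> x" "\<And>x. \<theta> x \<le> (1::real)"
    "\<And>x. x \<in> cball a s \<Longrightarrow> \<theta> x = 1" "\<And>x. x \<notin> ball a r \<Longrightarrow> \<theta> x = 0"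
proof -
  \<comment> \<open>The squared distance from \<open>a\<close> as a polynomial in the coordinates,
    hence smooth at \<open>a\<close> too, unlike the distance.\<close>
  define q where "q x = (\<Sum>i\<in>UNIV. (x $ i + (- a $ i)) * (x $ i + (- a $ i)))" for x
  have q: "q x = (dist a x)\<^sup>2" for x
    by (simp add: q_def dist_norm norm_vec_def L2_set_def sum_nonneg power2_eq_square[symmetric])
      (rule sum.cong, auto simp: power2_commute)
  have Cq: "Ck_on k UNIV q" for k
    unfolding q_def by (intro Ck_on_sum Ck_on_mult Ck_on_add Ck_on_const Ck_on_vec_nth Ck_on_id open_UNIV)
  define E where "E = flat 0"
  have E: "E x = 0" if "x \<le> 0" for x using that by (simp add: E_def flat_def)
  have E': "E x > 0" if "x > 0" for x using that by (simp add: E_def flat_def)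
  have E0: "E x \<ge> 0" for x using E[of x] E'[of x] by (cases "x \<le> 0") auto
  define u where "u x = E (r\<^sup>2 + (-1) * q x)" for x
  define w where "w x = E (q x + (- s\<^sup>2))" for x
  have uw: "u x + w x > 0" for x
  proof (cases "q x < r\<^sup>2")
    case True
    then show ?thesis using E'[of "r\<^sup>2 - q x"] E0 unfolding u_def w_def by (simp add: add_pos_nonneg)
  next
    case False
    have "s\<^sup>2 < r\<^sup>2" using assms by (simp add: power_strict_mono)
    then show ?thesis using False E'[of "q x - s\<^sup>2"] E0 unfolding u_def w_def by (simp add: add_nonneg_pos)
  qed
  have Cu: "Ck_on k UNIV u" for k
    unfolding u_def E_def
    by (rule Ck_on_compose[OF open_UNIV open_UNIV _ _ Ck_on_flat])
      (auto intro: Ck_on_add[OF open_UNIV Ck_on_const Ck_on_mult[OF open_UNIV Ck_on_const Cq], of k "r\<^sup>2" "- 1", simplified])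
  have Cw: "Ck_on k UNIV w" for k
    unfolding w_def E_def
    by (rule Ck_on_compose[OF open_UNIV open_UNIV _ _ Ck_on_flat])
      (rule subset_UNIV, rule Ck_on_add[OF open_UNIV Cq Ck_on_const[OF open_UNIV]])
  show thesis
  proof (rule that[of "\<lambda>x. u x * inverse (u x + w x)"])
    show "smooth_on UNIV (\<lambda>x. u x * inverse (u x + w x))"
      unfolding smooth_on_def
      using uw by (intro allI Ck_on_mult Ck_on_inverse Ck_on_add Cu Cw open_UNIV) (simp add: less_imp_neq[symmetric])
    show "0 \<le> u x * inverse (u x + w x)" for x
      using uw[of x] E0 by (simp add: u_def)
    show "u x * inverse (u x + w x) \<le> 1" for x
      using uw[of x] E0 by (simp add: divide_inverse[symmetric] w_def)
    show "u x * inverse (u x + w x) = 1" if "x \<in> cball a s" for x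
    proof -
      have "q x \<le> s\<^sup>2" using that assms by (simp add: q power_mono)
      then have "w x = 0" by (simp add: w_def E)
      then show ?thesis using uw[of x] by simp
    qed
    show "u x * inverse (u x + w x) = 0" if "x \<notin> ball a r" for x
    proof -
      have "r\<^sup>2 \<le> q x" using that assms by (simp add: q power_mono)
      then show ?thesis by (simp add: u_def E)
    qed
  qed
qed

subsection \<open>Diffeomorphisms of Euclidean space with prescribed linear part\<close>

definition rdiffeo :: "(real^'n \<Rightarrow> real^'n) \<Rightarrow> (real^'n \<Rightarrow> real^'n) \<Rightarrow> bool" where
  "rdiffeo T T' \<longleftrightarrow> smooth_on UNIV T \<and> smooth_on UNIV T' \<and> (\<forall>x. T' (T x) = x) \<and> (\<forall>x. T (T' x) = x)"

lemma rdiffeo_id: "rdiffeo (\<lambda>x. x) (\<lambda>x. x)"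
  by (simp add: rdiffeo_def smooth_on_id)

lemma rdiffeo_comp:
  assumes "rdiffeo S S'" "rdiffeo T T'"
  shows "rdiffeo (\<lambda>x. S (T x)) (\<lambda>x. T' (S' x))"
  using assms unfolding rdiffeo_def by (auto intro: smooth_on_compose[OF open_UNIV open_UNIV])

text \<open>The bound makes \<psi> a contraction, so x + \<psi> x = y is a fixed point problem with
  exactly one solution. The same bound makes the inverse 2-Lipschitz and the derivative of the map
  injective, as \<open>smooth_on_inverse_function\<close> requires.\<close>

lemma rdiffeo_near_id:
  fixes \<psi> :: "real^'n \<Rightarrow> real^'n"
  assumes \<psi>: "smooth_on UNIV \<psi>"
    and bd: "\<And>x. onorm (frechet_derivative \<psi> (at x)) \<le> 1/2"
  shows "\<exists>T'. rdiffeo (\<lambda>x. x + \<psi> x) T'"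
proof -
  define T where "T x = x + \<psi> x" for x
  have der: "(\<psi> has_derivative frechet_derivative \<psi> (at x)) (at x)" for x
    using smooth_on_has_derivative[OF \<psi>] by simp
  have lip: "norm (\<psi> x - \<psi> y) \<le> 1/2 * norm (x - y)" for x y
    by (rule differentiable_bound[OF convex_UNIV _ bd]) (use der in auto)
  have Tlip: "norm (x - y) \<le> 2 * norm (T x - T y)" for x y
  proof -
    have "norm (x - y) \<le> norm (T x - T y) + norm (\<psi> x - \<psi> y)"
      using norm_triangle_ineq4[of "T x - T y" "\<psi> x - \<psi> y"] by (simp add: T_def)
    then show ?thesis using lip[of x y] by simp
  qed
  have "inj T" by (rule injI) (metis Tlip diff_self mult_zero_right norm_zero norm_le_zero_iff right_minus_eq)
  have "\<exists>x. T x = y" for y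
  proof -
    have "\<exists>!x. y - \<psi> x = x"
      by (rule banach_fix_type[of "1/2"]) (use lip in \<open>auto simp: dist_norm norm_minus_commute\<close>)
    then show ?thesis by (metis T_def diff_add_cancel)
  qed
  then have "surj T" by (metis surjI)
  define T' where "T' = inv T"
  have T'T: "T' (T x) = x" for x using \<open>inj T\<close> by (simp add: T'_def)
  have TT': "T (T' x) = x" for x using \<open>surj T\<close> by (simp add: T'_def surj_f_inv_f)
  have sT: "smooth_on UNIV T" unfolding T_def by (intro smooth_on_add smooth_on_id \<psi> open_UNIV)
  have "2-lipschitz_on UNIV T'"
    by (rule lipschitz_onI) (use Tlip TT' in \<open>auto simp: dist_norm\<close>, metis Tlip TT')
  then have cT': "continuous_on UNIV T'" by (rule lipschitz_on_continuous_on)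
  have "inj (frechet_derivative T (at x))" for x
  proof -
    have dT: "(T has_derivative (\<lambda>v. v + frechet_derivative \<psi> (at x) v)) (at x)"
      unfolding T_def by (intro has_derivative_add has_derivative_ident der)
    then have eq: "frechet_derivative T (at x) = (\<lambda>v. v + frechet_derivative \<psi> (at x) v)"
      using frechet_derivative_at by metis
    have lin: "linear (\<lambda>v. v + frechet_derivative \<psi> (at x) v)"
      using dT has_derivative_linear by blast
    have bl: "bounded_linear (frechet_derivative \<psi> (at x))" using der has_derivative_bounded_linear by blast
    have "v = 0" if "v + frechet_derivative \<psi> (at x) v = 0" for v
    proof -
      have "norm v = norm (frechet_derivative \<psi> (at x) v)"
        using that by (metis add.inverse_unique norm_minus_cancel)
      also have "\<dots> \<le> 1/2 * norm v"
        using onorm[OF bl, of v] mult_right_mono[OF bd, of "norm v" x] by simp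
      finally show ?thesis by simp
    qed
    then show ?thesis unfolding eq linear_injective_0[OF lin] by blast
  qed
  then have "smooth_on UNIV T'"
    by (intro smooth_on_inverse_function[of UNIV UNIV T T']) (use sT cT' TT' in auto)
  then have "rdiffeo T T'" using sT T'T TT' by (simp add: rdiffeo_def)
  then show ?thesis unfolding T_def by blast
qed

text \<open>The field \<open>k x = \<theta> x *\<^sub>R (x - a)\<close> vanishes off a ball, so its
  derivative is bounded by some \<open>B\<close>; after composition with a linear map of norm at
  most 1 / (2 B) it meets the bound 1/2 of \<open>rdiffeo_near_id\<close>. The constant
  \<open>c\<close> does not depend on \<open>M\<close>, so one cutoff serves all factors of a
  product of linear maps.\<close>

lemma rdiffeo_bump:
  fixes \<theta> :: "real^'n \<Rightarrow> real" and a :: "real^'n"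
  assumes \<theta>: "smooth_on UNIV \<theta>" and out: "\<And>x. x \<notin> ball a r \<Longrightarrow> \<theta> x = 0"
  shows "\<exists>c>0. \<forall>M. linear M \<longrightarrow> (\<forall>v. norm (M v) \<le> c * norm v) \<longrightarrow>
    (\<exists>T'. rdiffeo (\<lambda>x. x + \<theta> x *\<^sub>R M (x - a)) T')"
proof -
  define k where "k x = \<theta> x *\<^sub>R (x + (- a))" for x
  define D where "D x = frechet_derivative k (at x)" for x
  have sk: "smooth_on UNIV k"
    unfolding k_def by (intro smooth_on_scaleR smooth_on_add smooth_on_id smooth_on_const \<theta> open_UNIV)
  have dk: "(k has_derivative D x) (at x)" for x unfolding D_def by (rule smooth_on_has_derivative[OF sk]) simp
  have D0: "D x = (\<lambda>v. 0)" if "x \<notin> cball a r" for x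
  proof -
    have "(k has_derivative (\<lambda>v. 0)) (at x)"
      by (rule has_derivative_transform_within_open[where f="\<lambda>x. 0" and s="- cball a r"])
        (use that out in \<open>auto simp: k_def\<close>)
    then show ?thesis using dk has_derivative_unique by blast
  qed
  have "\<exists>C. \<forall>x. norm (D x b) \<le> C" for b
  proof -
    have "continuous_on (cball a r) (\<lambda>x. D x b)"
      unfolding D_def using smooth_on_imp_continuous_on[OF smooth_on_frechet_derivative[OF sk]]
      by (rule continuous_on_subset) simp
    then have "bounded ((\<lambda>x. D x b) ` cball a r)" by (intro compact_imp_bounded compact_continuous_image compact_cball)
    then obtain C where C: "C > 0" "\<forall>y\<in>(\<lambda>x. D x b) ` cball a r. norm y \<le> C" unfolding bounded_pos by blast
    have "norm (D x b) \<le> C" for x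
      using C D0[of x] by (cases "x \<in> cball a r") auto
    then show ?thesis by auto
  qed
  then obtain C where C: "\<And>x b. norm (D x b) \<le> C b" by metis
  \<comment> \<open>The summand 1 makes \<open>B\<close> positive, so that it may be divided
    by.\<close>
  define B where "B = (\<Sum>b\<in>Basis. C b) + 1"
  have Cpos: "C b \<ge> 0" for b using C[of a b] norm_ge_zero order_trans by blast
  have B: "B > 0" unfolding B_def using Cpos by (simp add: sum_nonneg add_nonneg_pos)
  have DB: "norm (D x v) \<le> B * norm v" for x v
  proof -
    have l: "linear (D x)" using dk has_derivative_linear by blast
    have "D x v = D x (\<Sum>b\<in>Basis. (v \<bullet> b) *\<^sub>R b)" by (simp add: euclidean_representation)
    also have "\<dots> = (\<Sum>b\<in>Basis. (v \<bullet> b) *\<^sub>R D x b)" by (simp only: linear_sum[OF l] linear_cmul[OF l])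
    finally have "norm (D x v) \<le> (\<Sum>b\<in>Basis. norm ((v \<bullet> b) *\<^sub>R D x b))" by (metis norm_sum)
    also have "\<dots> \<le> (\<Sum>b\<in>Basis. norm v * C b)"
      by (intro sum_mono) (simp add: C mult_mono Basis_le_norm)
    also have "\<dots> \<le> B * norm v" by (simp only: sum_distrib_left[symmetric] B_def) (simp add: algebra_simps)
    finally show ?thesis .
  qed
  show ?thesis
  proof (intro exI[of _ "1 / (2 * B)"] conjI allI impI)
    fix M :: "real^'n \<Rightarrow> real^'n"
    assume M: "linear M" and Mc: "\<forall>v. norm (M v) \<le> 1 / (2 * B) * norm v"
    have bM: "bounded_linear M" using M by (simp add: linear_conv_bounded_linear)
    have "\<exists>T'. rdiffeo (\<lambda>x. x + M (k x)) T'"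
    proof (rule rdiffeo_near_id)
      show "smooth_on UNIV (\<lambda>x. M (k x))" by (rule smooth_on_bounded_linear[OF open_UNIV bM sk])
      show "onorm (frechet_derivative (\<lambda>x. M (k x)) (at x)) \<le> 1/2" for x
      proof -
        have "((\<lambda>x. M (k x)) has_derivative (\<lambda>v. M (D x v))) (at x)"
          by (rule bounded_linear.has_derivative[OF bM dk])
        then have "frechet_derivative (\<lambda>x. M (k x)) (at x) = (\<lambda>v. M (D x v))"
          using frechet_derivative_at by metis
        moreover have "norm (M (D x v)) \<le> 1/2 * norm v" for v
        proof -
          have "norm (M (D x v)) \<le> 1 / (2 * B) * norm (D x v)" using Mc by blast
          also have "\<dots> \<le> 1 / (2 * B) * (B * norm v)" by (intro mult_left_mono DB) (use B in auto)
          finally show ?thesis using B by simp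
        qed
        ultimately show ?thesis using onorm_le[of "\<lambda>v. M (D x v)" "1/2"] by simp
      qed
    qed
    then show "\<exists>T'. rdiffeo (\<lambda>x. x + \<theta> x *\<^sub>R M (x - a)) T'"
      by (simp add: k_def linear_cmul[OF M])
  qed (use B in simp)
qed

text \<open>
  For \<open>0 < c < 1\<close> these are exactly the linear maps of positive determinant. A bijective linear map
  of negative determinant becomes one after flipping a coordinate, which is how the sign of the
  determinant is tracked below.
\<close>

inductive near_gen :: "real \<Rightarrow> ('a::real_normed_vector \<Rightarrow> 'a) \<Rightarrow> bool" for c where
  near_gen_id: "near_gen c (\<lambda>x. x)"
| near_gen_step: "linear f \<Longrightarrow> (\<And>x. norm (f x - x) \<le> c * norm x) \<Longrightarrow> near_gen c g \<Longrightarrow> near_gen c (\<lambda>x. f (g x))"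

lemma near_gen_linear: "near_gen c f \<Longrightarrow> linear f"
  by (induction rule: near_gen.induct) (auto simp: linear_iff)

lemma near_gen_single: "linear f \<Longrightarrow> (\<And>x. norm (f x - x) \<le> c * norm x) \<Longrightarrow> near_gen c f"
  using near_gen_step[OF _ _ near_gen_id] by force

lemma near_gen_comp: "near_gen c f \<Longrightarrow> near_gen c g \<Longrightarrow> near_gen c (\<lambda>x. f (g x))"
  by (induction rule: near_gen.induct) (auto intro: near_gen_step[of _ c "\<lambda>x. _ (g x)"])

lemma near_gen_mono: "near_gen c f \<Longrightarrow> c \<le> c' \<Longrightarrow> near_gen c' f"
proof (induction rule: near_gen.induct)
  case (near_gen_step f g)
  show ?case
  proof (rule near_gen.near_gen_step[OF near_gen_step(1)])
    show "norm (f x - x) \<le> c' * norm x" for x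
      using near_gen_step(2)[of x] mult_right_mono[OF \<open>c \<le> c'\<close>, of "norm x"] by simp
  qed (use near_gen_step in simp)
qed (rule near_gen_id)

lemma near_gen_funpow: "near_gen c f \<Longrightarrow> near_gen c (f ^^ N)"
proof (induction N)
  case 0
  then show ?case using near_gen_id by (simp add: id_def)
next
  case (Suc N)
  then show ?case using near_gen_comp[of c f "f ^^ N"] by (simp add: o_def)
qed

text \<open>A map lying on a one-parameter group has N-th roots that tend to the identity. Taking
  such a root for large N breaks the map into N equal factors close to the identity.\<close>

lemma near_gen_root:
  assumes "near_gen c f" "f ^^ N = g"
  shows "near_gen c g"
  using near_gen_funpow assms by metis

section \<open>Factoring linear maps into factors close to the identity\<close>

definition shear :: "'n \<Rightarrow> 'n \<Rightarrow> real \<Rightarrow> real^'n \<Rightarrow> real^'n" where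
  "shear i j t x = (\<chi> l. if l = i then x $ i + t * x $ j else x $ l)"

text \<open>For fixed \<open>i \<noteq> j\<close> shears compose by adding their parameters, so the
  root is the shear with parameter \<open>t / N\<close>, at distance at most
  \<open>\<bar>t\<bar> / N < c\<close> from the identity.\<close>

lemma near_gen_shear:
  fixes i j :: "'n::finite"
  assumes "i \<noteq> j" "c > 0"
  shows "near_gen c (shear i j t)"
proof -
  obtain N :: nat where N: "\<bar>t\<bar> / c < real N" using reals_Archimedean2 by blast
  then have N0: "real N > 0" using assms by (meson abs_ge_zero divide_nonneg_pos le_less_trans)
  have pow: "shear i j (t / N) ^^ k = shear i j (real k * (t / N))" for k
    by (induction k) (use assms in \<open>auto simp: shear_def fun_eq_iff vec_eq_iff algebra_simps add_divide_distrib\<close>)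
  show ?thesis
  proof (rule near_gen_root)
    show "shear i j (t / N) ^^ N = shear i j t" using pow[of N] N0 by simp
    show "near_gen c (shear i j (t / N))"
    proof (rule near_gen_single)
      show "linear (shear i j (t / N))" by (auto simp: linear_iff shear_def vec_eq_iff algebra_simps add_divide_distrib)
      show "norm (shear i j (t / N) x - x) \<le> c * norm x" for x
      proof -
        have "shear i j (t / N) x - x = (t / N * x $ j) *\<^sub>R axis i 1"
          by (auto simp: shear_def vec_eq_iff axis_def)
        then have "norm (shear i j (t / N) x - x) = \<bar>t / N\<bar> * \<bar>x $ j\<bar>"
          by (simp add: norm_axis_1 abs_mult)
        also have "\<dots> \<le> c * norm x"
          using N N0 assms by (intro mult_mono component_le_norm_cart) (auto simp: field_simps)
        finally show ?thesis .
      qed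
    qed
  qed
qed

text \<open>Positive entries have real N-th roots tending to 1, and as there are finitely many of
  them, one N serves all.\<close>

lemma near_gen_diag_pos:
  fixes d :: "'n::finite \<Rightarrow> real"
  assumes d: "\<And>i. d i > 0" and "c > 0"
  shows "near_gen c (\<lambda>x. \<chi> i. d i * x $ i)"
proof -
  have "\<forall>\<^sub>F N in sequentially. \<forall>i\<in>UNIV. \<bar>root N (d i) - 1\<bar> < c"
  proof (rule eventually_ball_finite)
    show "\<forall>i\<in>UNIV. \<forall>\<^sub>F N in sequentially. \<bar>root N (d i) - 1\<bar> < c"
      using LIMSEQ_root_const[OF d] \<open>c > 0\<close> by (auto simp: tendsto_iff dist_real_def)
  qed simp
  then have "\<forall>\<^sub>F N in sequentially. N > 0 \<and> (\<forall>i\<in>UNIV. \<bar>root N (d i) - 1\<bar> < c)"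
    by (intro eventually_conj eventually_gt_at_top)
  then obtain N where N: "N > 0" "\<And>i. \<bar>root N (d i) - 1\<bar> < c"
    by (auto simp: eventually_sequentially)
  let ?f = "\<lambda>x::real^'n. \<chi> i. root N (d i) * x $ i"
  have pow: "(?f ^^ k) = (\<lambda>x. \<chi> i. root N (d i) ^ k * x $ i)" for k
    by (induction k) (auto simp: fun_eq_iff vec_eq_iff)
  show ?thesis
  proof (rule near_gen_root)
    show "?f ^^ N = (\<lambda>x. \<chi> i. d i * x $ i)"
      using N d by (simp add: pow less_imp_le)
    show "near_gen c ?f"
    proof (rule near_gen_single)
      show "linear ?f" by (auto simp: linear_iff vec_eq_iff algebra_simps)
      show "norm (?f x - x) \<le> c * norm x" for x
      proof -
        have "norm (?f x - x) \<le> norm (c *\<^sub>R x)"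
        proof (rule norm_le_componentwise_cart)
          fix i
          have "norm ((?f x - x) $ i) = \<bar>root N (d i) - 1\<bar> * \<bar>x $ i\<bar>"
            by (simp add: abs_mult[symmetric] algebra_simps)
          also have "\<dots> \<le> c * \<bar>x $ i\<bar>" by (intro mult_right_mono) (use N(2)[of i] in auto)
          finally show "norm ((?f x - x) $ i) \<le> norm ((c *\<^sub>R x) $ i)"
            using \<open>c > 0\<close> by (simp add: abs_mult)
        qed
        then show ?thesis using \<open>c > 0\<close> by simp
      qed
    qed
  qed
qed

definition flip :: "'n set \<Rightarrow> real^'n \<Rightarrow> real^'n" where
  "flip I x = (\<chi> i. if i \<in> I then - x $ i else x $ i)"

lemma flip_flip [simp]: "flip I (flip I x) = x"
  by (simp add: flip_def vec_eq_iff)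

lemma linear_flip: "linear (flip I)"
  by (auto simp: linear_iff flip_def vec_eq_iff)

lemma norm_flip [simp]: "norm (flip I x) = norm (x :: real^'n)"
  by (intro antisym norm_le_componentwise_cart) (auto simp: flip_def)

text \<open>Flips preserve the Euclidean norm, so conjugation by a flip leaves every factor equally
  close to the identity. This is how a flip is moved through a product.\<close>

lemma near_gen_conj: "near_gen c f \<Longrightarrow> near_gen c (\<lambda>x. flip I (f (flip I x)))"
proof (induction rule: near_gen.induct)
  case near_gen_id
  then show ?case using near_gen.near_gen_id by simp
next
  case (near_gen_step f g)
  have "near_gen c (\<lambda>x. (\<lambda>y. flip I (f (flip I y))) (flip I (g (flip I x))))"
  proof (rule near_gen.near_gen_step[where f="\<lambda>y. flip I (f (flip I y))" and g="\<lambda>x. flip I (g (flip I x))"])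
    show "linear (\<lambda>y. flip I (f (flip I y)))"
      using linear_compose[OF linear_compose[OF linear_flip near_gen_step(1)] linear_flip] by (simp add: o_def)
    show "norm (flip I (f (flip I x)) - x) \<le> c * norm x" for x
    proof -
      have "flip I (f (flip I x)) - x = flip I (f (flip I x) - flip I x)"
        by (simp add: linear_diff[OF linear_flip])
      then show ?thesis using near_gen_step(2)[of "flip I x"] by simp
    qed
  qed (rule near_gen_step)
  then show ?case by simp
qed

definition near_gen_pm :: "'n::finite \<Rightarrow> real \<Rightarrow> (real^'n \<Rightarrow> real^'n) \<Rightarrow> bool" where
  "near_gen_pm k c f \<longleftrightarrow> near_gen c f \<or> near_gen c (\<lambda>x. flip {k} (f x))"

lemma near_gen_pm_comp:
  assumes "near_gen_pm k c f" "near_gen_pm k c g"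
  shows "near_gen_pm k c (\<lambda>x. f (g x))"
proof -
  have 1: "near_gen c (\<lambda>x. flip {k} (f (g x)))" if "near_gen c f" "near_gen c (\<lambda>x. flip {k} (g x))"
    using near_gen_comp[OF near_gen_conj[OF that(1), of "{k}"] that(2)] by simp
  have 2: "near_gen c (\<lambda>x. flip {k} (f (g x)))" if "near_gen c (\<lambda>x. flip {k} (f x))" "near_gen c g"
    using near_gen_comp[OF that] .
  have 3: "near_gen c (\<lambda>x. f (g x))" if "near_gen c (\<lambda>x. flip {k} (f x))" "near_gen c (\<lambda>x. flip {k} (g x))"
    using near_gen_comp[OF near_gen_conj[OF that(1), of "{k}"] that(2)] by simp
  show ?thesis using assms near_gen_comp[of c f g] 1 2 3 unfolding near_gen_pm_def by blast
qed

text \<open>Three shears compose to a quarter turn in the (i, j) plane, and the square of the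
  quarter turn is the double reflection.\<close>

lemma near_gen_flip2:
  assumes "i \<noteq> j" "c > 0"
  shows "near_gen c (flip {i, j} :: real^'n \<Rightarrow> real^'n)"
    "near_gen c (\<lambda>x::real^'n. \<chi> l. if l = i then x $ j else if l = j then - x $ i else x $ l)"
proof -
  let ?w = "\<lambda>x::real^'n. \<chi> l. if l = i then x $ j else if l = j then - x $ i else x $ l"
  have "?w = (\<lambda>x. shear i j 1 (shear j i (-1) (shear i j 1 x)))"
    using assms by (auto simp: fun_eq_iff vec_eq_iff shear_def)
  then show w: "near_gen c ?w"
    using assms near_gen_shear[of i j c 1] near_gen_shear[of j i c "-1"] by (auto intro: near_gen_comp)
  have "flip {i,j} = (\<lambda>x. ?w (?w x))"
    using assms by (auto simp: fun_eq_iff vec_eq_iff flip_def)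
  then show "near_gen c (flip {i, j} :: real^'n \<Rightarrow> real^'n)" using near_gen_comp[OF w w] by simp
qed

lemma near_gen_pm_flip1:
  assumes "c > 0"
  shows "near_gen_pm k c (flip {j} :: real^'n \<Rightarrow> real^'n)"
proof (cases "j = k")
  case True
  then show ?thesis by (simp add: near_gen_pm_def near_gen_id)
next
  case False
  then have "(\<lambda>x::real^'n. flip {k} (flip {j} x)) = flip {k, j}"
    by (auto simp: fun_eq_iff vec_eq_iff flip_def)
  then show ?thesis using near_gen_flip2(1)[of k j c] False assms by (simp add: near_gen_pm_def)
qed

lemma near_gen_pm_flip:
  assumes "c > 0"
  shows "near_gen_pm k c (flip I :: real^'n \<Rightarrow> real^'n)"
proof (induction I rule: infinite_finite_induct)
  case empty
  have "flip {} = (\<lambda>x::real^'n. x)" by (simp add: flip_def fun_eq_iff)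
  then show ?case by (simp add: near_gen_pm_def near_gen_id)
next
  case (insert j I)
  then have "flip (insert j I) = (\<lambda>x::real^'n. flip {j} (flip I x))"
    by (auto simp: fun_eq_iff vec_eq_iff flip_def)
  then show ?case using near_gen_pm_comp[OF near_gen_pm_flip1[OF assms] insert.IH] by simp
qed simp

lemma linear_comp_bijD:
  fixes f g :: "'a::euclidean_space \<Rightarrow> 'a"
  assumes "linear f" "linear g" "bij (f \<circ> g)"
  shows "bij f" "bij g"
proof -
  have "inj g" using inj_on_imageI2[of f g UNIV] assms(3) by (simp add: bij_def)
  then show "bij g" using assms(2) linear_injective_imp_surjective by (auto simp: bij_def)
  have "surj f" using assms(3) unfolding bij_def surj_def comp_def by blast
  then show "bij f" using assms(1) linear_surjective_imp_injective by (auto simp: bij_def)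
qed

text \<open>Elementary factorisation: bijectivity passes to the factors and excludes those with a
  vanishing coordinate; a diagonal factor is a positive diagonal one followed by flips; a
  transposition is a quarter turn followed by a flip; the remaining factors are shears.\<close>

lemma near_gen_pm_linear:
  fixes f :: "real^'n \<Rightarrow> real^'n"
  assumes "linear f" "bij f" "c > 0"
  shows "near_gen_pm k c f"
proof -
  have "bij f \<longrightarrow> near_gen_pm k c f"
  proof (induction rule: induct_linear_elementary[OF assms(1)])
    case (1 f g)
    then show ?case using linear_comp_bijD[of f g] near_gen_pm_comp[of k c f g] by (auto simp: o_def)
  next
    case (2 f i)
    have "\<not> surj f"
    proof
      assume "surj f"
      then obtain x where "f x = axis i 1" by (metis surj_def)
      then have "f x $ i = 1" by simp
      then show False using 2 by simp
    qed
    then show ?case by (simp add: bij_def)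
  next
    case (3 d)
    show ?case
    proof
      assume b: "bij (\<lambda>x::real^'n. \<chi> i. d i * x $ i)"
      have d: "d i \<noteq> 0" for i
      proof
        assume "d i = 0"
        obtain x where "(axis i 1 :: real^'n) = (\<chi> i. d i * x $ i)"
          using surjD[OF bij_is_surj[OF b], of "axis i 1"] by blast
        then have "d i * x $ i = 1" by (metis axis_nth vec_lambda_beta)
        then show False using \<open>d i = 0\<close> by simp
      qed
      have "(\<lambda>x::real^'n. \<chi> i. d i * x $ i) = (\<lambda>x. flip {i. d i < 0} (\<chi> i. \<bar>d i\<bar> * x $ i))"
        by (auto simp: fun_eq_iff vec_eq_iff flip_def)
      moreover have "near_gen_pm k c (\<lambda>x. \<chi> i. \<bar>d i\<bar> * x $ i)"
        using near_gen_diag_pos[of "\<lambda>i. \<bar>d i\<bar>" c] d assms(3) by (simp add: near_gen_pm_def)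
      ultimately show "near_gen_pm k c (\<lambda>x. \<chi> i. d i * x $ i)"
        using near_gen_pm_comp[OF near_gen_pm_flip[OF assms(3)]] by simp
    qed
  next
    case (4 m n)
    have "(\<lambda>x::real^'n. \<chi> i. x $ Transposition.transpose m n i)
        = (\<lambda>x. flip {n} (\<chi> l. if l = m then x $ n else if l = n then - x $ m else x $ l))"
      using 4 by (auto simp: fun_eq_iff vec_eq_iff flip_def Transposition.transpose_def)
    then show ?case
      using near_gen_pm_comp[OF near_gen_pm_flip1[OF assms(3)], of k]
        near_gen_flip2(2)[OF 4 assms(3)] by (simp add: near_gen_pm_def)
  next
    case (5 m n)
    have "(\<lambda>x::real^'n. \<chi> i. if i = m then x $ m + x $ n else x $ i) = shear m n 1"
      by (simp add: shear_def fun_eq_iff)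
    then show ?case using near_gen_shear[OF 5 assms(3), of 1] by (simp add: near_gen_pm_def)
  qed
  then show ?thesis using assms by simp
qed

text \<open>The set \<open>I\<close> must be the same for all \<open>c\<close>. For each
  \<open>c\<close> one of the two products, with or without a flip, is generated; if the one without
  fails for some \<open>c0\<close>, then by monotonicity it fails for all smaller constants, so the
  flipped one works for arbitrarily small constants and therefore for all.\<close>

lemma near_gen_between:
  fixes P Q :: "real^'n \<Rightarrow> real^'n"
  assumes "linear P" "bij P" "linear Q" "bij Q"
  obtains I where "\<And>c. c > 0 \<Longrightarrow> near_gen c (\<lambda>x. Q (flip I (P x)))"
proof -
  obtain k :: 'n where True by simp
  have *: "near_gen c (\<lambda>x. Q (P x)) \<or> near_gen c (\<lambda>x. Q (flip {k} (P x)))" if c: "c > 0" for c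
  proof -
    have 1: "near_gen_pm k c P" "near_gen_pm k c Q" using assms c near_gen_pm_linear by auto
    have a: "near_gen c (\<lambda>x. Q (flip {k} (P x)))" if "near_gen c (\<lambda>x. flip {k} (Q x))" "near_gen c P"
      using near_gen_comp[OF near_gen_conj[OF that(1), of "{k}"] that(2)] by simp
    have b: "near_gen c (\<lambda>x. Q (P x))" if "near_gen c (\<lambda>x. flip {k} (Q x))" "near_gen c (\<lambda>x. flip {k} (P x))"
      using near_gen_comp[OF near_gen_conj[OF that(1), of "{k}"] that(2)] by simp
    show ?thesis using 1 a b near_gen_comp[of c Q P] near_gen_comp[of c Q "\<lambda>x. flip {k} (P x)"]
      unfolding near_gen_pm_def by blast
  qed
  show thesis
  proof (cases "\<forall>c>0. near_gen c (\<lambda>x. Q (P x))")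
    case True
    moreover have "flip {} = (\<lambda>x::real^'n. x)" by (simp add: flip_def fun_eq_iff)
    ultimately show ?thesis using that[of "{}"] by simp
  next
    case False
    then obtain c0 where c0: "c0 > 0" "\<not> near_gen c0 (\<lambda>x. Q (P x))" by auto
    have "near_gen c (\<lambda>x. Q (flip {k} (P x)))" if "c > 0" for c
      using *[of "min c c0"] near_gen_mono[of "min c c0" _ c0] near_gen_mono[of "min c c0" _ c] c0 that by auto
    then show ?thesis using that by blast
  qed
qed

text \<open>Each factor of \<open>L\<close> is realised by a bump perturbation of the identity, but
  their composite agrees with \<open>L\<close> only on a possibly much smaller ball of radius
  \<open>e\<close>, because partial products may leave the ball on which the next factor is
  realised. Contracting the ball of radius \<open>s\<close> into that of radius \<open>e\<close>
  beforehand costs no more than the factor \<delta>.\<close>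

lemma rdiffeo_scaled_linear:
  fixes L :: "real^'n \<Rightarrow> real^'n"
  assumes "0 < s" "s < r" and L: "\<And>c. c > 0 \<Longrightarrow> near_gen c L"
  obtains \<delta> T T' where "\<delta> > 0" "rdiffeo T T'" "\<And>x. x \<in> cball a s \<Longrightarrow> T x = a + \<delta> *\<^sub>R L (x - a)"
    "\<And>x. x \<notin> ball a r \<Longrightarrow> T x = x"
proof -
  obtain \<theta> where \<theta>: "smooth_on UNIV \<theta>" "\<And>x. x \<in> cball a s \<Longrightarrow> \<theta> x = (1::real)"
      "\<And>x. x \<notin> ball a r \<Longrightarrow> \<theta> x = 0"
    using smooth_bump[OF assms(1,2), of a] by metis
  obtain c where c: "c > 0" "\<And>M. linear M \<Longrightarrow> (\<And>v. norm (M v) \<le> c * norm v) \<Longrightarrow>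
    \<exists>T'. rdiffeo (\<lambda>x. x + \<theta> x *\<^sub>R M (x - a)) T'"
    using rdiffeo_bump[OF \<theta>(1,3)] by blast
  have step: "\<exists>T T'. rdiffeo T T' \<and> (\<forall>x\<in>cball a s. T x = a + f (x - a)) \<and> (\<forall>x. x \<notin> ball a r \<longrightarrow> T x = x)"
    if f: "linear f" "\<And>x. norm (f x - x) \<le> c * norm x" for f
  proof -
    have "linear (\<lambda>x. f x - x)" by (intro linear_compose_sub f linear_ident)
    then obtain T' where T': "rdiffeo (\<lambda>x. x + \<theta> x *\<^sub>R (f (x - a) - (x - a))) T'"
      using c(2) f(2) by meson
    show ?thesis
      by (rule exI, rule exI, rule conjI[OF T']) (use \<theta> in auto)
  qed
  have "\<exists>e>0. \<exists>T T'. rdiffeo T T' \<and> (\<forall>x\<in>cball a e. T x = a + L (x - a)) \<and> (\<forall>x. x \<notin> ball a r \<longrightarrow> T x = x)"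
    using L[OF c(1)]
  proof (induction rule: near_gen.induct)
    case near_gen_id
    then show ?case using rdiffeo_id assms by (intro exI[of _ s] conjI exI) auto
  next
    case (near_gen_step f g)
    from near_gen_step.IH obtain e T T' where 1: "e > 0" "rdiffeo T T'" "\<And>x. x\<in>cball a e \<Longrightarrow> T x = a + g (x - a)"
        "\<And>x. x \<notin> ball a r \<Longrightarrow> T x = x" by blast
    from step[OF near_gen_step(1,2)] obtain S S' where 2: "rdiffeo S S'" "\<And>x. x\<in>cball a s \<Longrightarrow> S x = a + f (x - a)"
        "\<And>x. x \<notin> ball a r \<Longrightarrow> S x = x" by blast
    have "bounded_linear g" using near_gen_linear[OF near_gen_step(3)] by (simp add: linear_conv_bounded_linear)
    then obtain K where K: "K > 0" "\<And>x. norm (g x) \<le> norm x * K" using bounded_linear.pos_bounded by blast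
    show ?case
    proof (intro exI conjI ballI allI impI)
      \<comment> \<open>Within \<open>s / K\<close> of the centre, \<open>g\<close> does not leave
        the ball of radius \<open>s\<close>, where \<open>S\<close> acts as
        \<open>f\<close>.\<close>
      show "min e (s / K) > 0" using 1 assms K by simp
      show "rdiffeo (\<lambda>x. S (T x)) (\<lambda>x. T' (S' x))" by (rule rdiffeo_comp[OF 2(1) 1(2)])
      show "S (T x) = a + f (g (x - a))" if "x \<in> cball a (min e (s / K))" for x
      proof -
        have "norm (g (x - a)) \<le> s"
          using that K(1) K(2)[of "x - a"] by (auto simp: dist_norm norm_minus_commute field_simps)
        then show ?thesis using 1(3)[of x] 2(2)[of "a + g (x - a)"] that by (auto simp: dist_norm)
      qed
      show "S (T x) = x" if "x \<notin> ball a r" for x using that 1 2 by simp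
    qed
  qed
  then obtain e T T' where 1: "e > 0" "rdiffeo T T'" "\<And>x. x\<in>cball a e \<Longrightarrow> T x = a + L (x - a)"
        "\<And>x. x \<notin> ball a r \<Longrightarrow> T x = x" by blast
  \<comment> \<open>Multiplication by \<open>q\<close> differs from the identity by
    \<open>min c (1/2)\<close> in norm, so it is itself an admissible factor; the minimum with 1/2
    keeps \<open>q\<close> positive.\<close>
  define q where "q = 1 - min c (1/2)"
  have q: "0 < q" "q < 1" using c by (auto simp: q_def)
  have "\<exists>S S'. rdiffeo S S' \<and> (\<forall>x\<in>cball a s. S x = a + q *\<^sub>R (x - a)) \<and> (\<forall>x. x \<notin> ball a r \<longrightarrow> S x = x)"
  proof (rule step)
    show "norm (q *\<^sub>R x - x) \<le> c * norm x" for x :: "real^'n"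
    proof -
      have "q *\<^sub>R x - x = - (min c (1/2)) *\<^sub>R x" by (simp add: q_def algebra_simps)
      then show ?thesis using c by (simp add: mult_right_mono)
    qed
  qed (rule linear_scaleR)
  then obtain S S' where 2: "rdiffeo S S'" "\<And>x. x\<in>cball a s \<Longrightarrow> S x = a + q *\<^sub>R (x - a)"
      "\<And>x. x \<notin> ball a r \<Longrightarrow> S x = x" by blast
  \<comment> \<open>Unlike the factors of \<open>L\<close>, a contraction maps the ball of radius
    \<open>s\<close> into itself, so all its powers are realised on this whole ball.\<close>
  have 3: "\<exists>S S'. rdiffeo S S' \<and> (\<forall>x\<in>cball a s. S x = a + q ^ N *\<^sub>R (x - a)) \<and> (\<forall>x. x \<notin> ball a r \<longrightarrow> S x = x)" for N
  proof (induction N)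
    case 0
    then show ?case by (intro exI[of _ "\<lambda>x. x"]) (simp add: rdiffeo_id)
  next
    case (Suc N)
    then obtain R R' where R: "rdiffeo R R'" "\<And>x. x\<in>cball a s \<Longrightarrow> R x = a + q ^ N *\<^sub>R (x - a)"
      "\<And>x. x \<notin> ball a r \<Longrightarrow> R x = x" by blast
    show ?case
    proof (intro exI conjI ballI allI impI)
      show "rdiffeo (\<lambda>x. S (R x)) (\<lambda>x. R' (S' x))" by (rule rdiffeo_comp[OF 2(1) R(1)])
      show "S (R x) = a + q ^ Suc N *\<^sub>R (x - a)" if "x \<in> cball a s" for x
      proof -
        have "q ^ N * norm (x - a) \<le> 1 * s"
          using that q by (intro mult_mono) (auto simp: dist_norm norm_minus_commute power_le_one)
        then show ?thesis
          using R(2)[OF that] 2(2)[of "a + q ^ N *\<^sub>R (x - a)"] q by (simp add: dist_norm)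
      qed
      show "S (R x) = x" if "x \<notin> ball a r" for x using that R 2 by simp
    qed
  qed
  obtain N where N: "q ^ N < e / s" using real_arch_pow_inv[of "e / s" q] q 1 assms by auto
  obtain R R' where R: "rdiffeo R R'" "\<And>x. x\<in>cball a s \<Longrightarrow> R x = a + q ^ N *\<^sub>R (x - a)"
      "\<And>x. x \<notin> ball a r \<Longrightarrow> R x = x" using 3[of N] by blast
  show thesis
  proof (rule that[of "q ^ N" "\<lambda>x. T (R x)" "\<lambda>x. R' (T' x)"])
    show "q ^ N > 0" using q by simp
    show "rdiffeo (\<lambda>x. T (R x)) (\<lambda>x. R' (T' x))" by (rule rdiffeo_comp[OF 1(2) R(1)])
    show "T (R x) = x" if "x \<notin> ball a r" for x using that R 1 by simp
    show "T (R x) = a + q ^ N *\<^sub>R L (x - a)" if "x \<in> cball a s" for x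
    proof -
      have "q ^ N * norm (x - a) \<le> (e / s) * s"
        using that q N 1(1) assms(1) by (intro mult_mono) (auto simp: dist_norm norm_minus_commute)
      then have "R x \<in> cball a e" using R(2)[OF that] q assms by (simp add: dist_norm)
      moreover have "L (q ^ N *\<^sub>R (x - a)) = q ^ N *\<^sub>R L (x - a)"
        using near_gen_linear[OF L[OF c(1)]] by (rule linear_cmul)
      ultimately show ?thesis using 1(3)[of "R x"] R(2)[OF that] by simp
    qed
  qed
qed

subsection \<open>Sylvester's law of inertia\<close>

lemma bilinear_form_onD:
  assumes "bilinear_form_on V b" "u \<in> V" "v \<in> V" "w \<in> V"
  shows "b (u + v) w = b u w + b v w" "b w (u + v) = b w u + b w v"
    "b (r *\<^sub>R u) w = r * b u w" "b w (r *\<^sub>R u) = r * b w u"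
  using assms unfolding bilinear_form_on_def by blast+

lemma bilinear_form_UNIV_sum:
  fixes b :: "'a::real_vector \<Rightarrow> 'a \<Rightarrow> real"
  assumes "bilinear_form_on UNIV b"
  shows "b (\<Sum>i\<in>I. x i *\<^sub>R e i) (\<Sum>j\<in>J. y j *\<^sub>R f j) = (\<Sum>i\<in>I. \<Sum>j\<in>J. x i * y j * b (e i) (f j))"
proof -
  have l1: "linear (\<lambda>u. b u w)" and l2: "linear (b w)" for w
    using bilinear_form_onD[OF assms] by (auto intro!: linearI)
  have 1: "b (\<Sum>i\<in>I. x i *\<^sub>R e i) w = (\<Sum>i\<in>I. x i * b (e i) w)" for w
    by (simp add: linear_sum[OF l1] linear_cmul[OF l1])
  have 2: "b w (\<Sum>j\<in>J. y j *\<^sub>R f j) = (\<Sum>j\<in>J. y j * b w (f j))" for w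
    by (simp add: linear_sum[OF l2] linear_cmul[OF l2])
  show ?thesis by (simp only: 1) (simp only: 2 sum_distrib_left mult.assoc)
qed

text \<open>If \<open>b v v\<close> vanishes for all \<open>v\<close> in \<open>S\<close>, then
  \<open>b\<close> vanishes on \<open>S\<close> by polarisation and any basis will do. Otherwise
  some \<open>v\<close> with \<open>b v v \<noteq> 0\<close> splits \<open>S\<close> into its line
  and its orthogonal complement for \<open>b\<close>, a subspace of smaller dimension.\<close>

lemma orthogonal_basis_of_form:
  fixes b :: "'a::euclidean_space \<Rightarrow> 'a \<Rightarrow> real"
  assumes b: "bilinear_form_on UNIV b" and sym: "symmetric_on UNIV b" and S: "subspace S"
  shows "\<exists>B. B \<subseteq> S \<and> independent B \<and> span B = S \<and> (\<forall>u\<in>B. \<forall>v\<in>B. u \<noteq> v \<longrightarrow> b u v = 0)"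
  using S
proof (induction "dim S" arbitrary: S rule: less_induct)
  case less
  have B1: "b (u + v) w = b u w + b v w" "b w (u + v) = b w u + b w v"
    "b (r *\<^sub>R u) w = r * b u w" "b w (r *\<^sub>R u) = r * b w u" "b u v = b v u" for u v w r
    using bilinear_form_onD[OF b] sym by (auto simp: symmetric_on_def)
  show ?case
  proof (cases "\<forall>v\<in>S. b v v = 0")
    case True
    have "b u v = 0" if "u \<in> S" "v \<in> S" for u v
    proof -
      have "b (u + v) (u + v) = 0" using True that less.prems by (simp add: subspace_add)
      then show ?thesis using True that B1(5)[of u v] by (simp add: B1(1,2))
    qed
    moreover obtain B where "B \<subseteq> S" "independent B" "S \<subseteq> span B" by (rule basis_exists)
    moreover have "span B = S"
      using calculation less.prems by (metis span_minimal subset_antisym)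
    ultimately show ?thesis by blast
  next
    case False
    then obtain v where v: "v \<in> S" "b v v \<noteq> 0" by auto
    define S' where "S' = {u \<in> S. b u v = 0}"
    have b0: "b 0 v = 0" using B1(3)[of 0 0 v] by simp
    have sub: "subspace S'"
      using less.prems b0 unfolding S'_def subspace_def by (auto simp: B1)
    have "S' \<subset> S" using v by (auto simp: S'_def)
    then have "dim S' < dim S"
      using dim_psubset[of S' S] span_eq_iff sub less.prems by metis
    then obtain B where B: "B \<subseteq> S'" "independent B" "span B = S'" "\<forall>u\<in>B. \<forall>v\<in>B. u \<noteq> v \<longrightarrow> b u v = 0"
      using less.hyps[OF _ sub] by blast
    have "v \<notin> S'" using v by (simp add: S'_def)
    show ?thesis
    proof (intro exI conjI)
      show "insert v B \<subseteq> S" using v B by (auto simp: S'_def)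
      show "independent (insert v B)" using B \<open>v \<notin> S'\<close> by (simp add: independent_insertI)
      show "span (insert v B) = S"
      proof
        show "span (insert v B) \<subseteq> S"
          using span_minimal[OF \<open>insert v B \<subseteq> S\<close> less.prems] .
        show "S \<subseteq> span (insert v B)"
        proof
          fix u assume u: "u \<in> S"
          define k where "k = b u v / b v v"
          have "u - k *\<^sub>R v \<in> S" using u v less.prems by (simp add: subspace_diff subspace_scale)
          moreover have "b (u - k *\<^sub>R v) v = 0"
          proof -
            have "b u v = b ((u - k *\<^sub>R v) + k *\<^sub>R v) v" by simp
            then have "b u v = b (u - k *\<^sub>R v) v + k * b v v" by (simp only: B1)
            then show ?thesis using v by (simp add: k_def)
          qed
          ultimately have "u - k *\<^sub>R v \<in> span B" using B by (simp add: S'_def)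
          then show "u \<in> span (insert v B)" by (auto simp: span_insert)
        qed
      qed
      show "\<forall>u\<in>insert v B. \<forall>w\<in>insert v B. u \<noteq> w \<longrightarrow> b u w = 0"
        using B B1(5) by (fastforce simp: S'_def)
    qed
  qed
qed

lemma diagonalize_form:
  fixes b :: "real^'n \<Rightarrow> real^'n \<Rightarrow> real"
  assumes b: "bilinear_form_on UNIV b" and sym: "symmetric_on UNIV b"
  shows "\<exists>(E :: real^'n \<Rightarrow> real^'n) d. linear E \<and> bij E \<and>
    (\<forall>x y. b (E x) (E y) = (\<Sum>i\<in>UNIV. d i * x $ i * y $ i)) \<and> (\<forall>i. d i \<in> {1, 0, -1})"
proof -
  obtain B where B: "independent B" "span B = (UNIV :: (real^'n) set)"
      "\<And>u v. u \<in> B \<Longrightarrow> v \<in> B \<Longrightarrow> u \<noteq> v \<Longrightarrow> b u v = 0"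
    using orthogonal_basis_of_form[OF b sym subspace_UNIV] by blast
  have "card B = CARD('n)" using B dim_eq_card[of B UNIV] by simp
  then obtain \<beta> where \<beta>: "bij_betw \<beta> (UNIV :: 'n set) B"
    using finite_same_card_bij[of "UNIV :: 'n set" B] finiteI_independent[OF B(1)] by auto
  \<comment> \<open>The scaling turns the diagonal entries into their signs; null vectors are left
    unscaled, so that \<open>E\<close> remains bijective.\<close>
  define k where "k i = (if b (\<beta> i) (\<beta> i) = 0 then 1 else 1 / sqrt \<bar>b (\<beta> i) (\<beta> i)\<bar>)" for i
  define d where "d i = sgn (b (\<beta> i) (\<beta> i))" for i
  define E where "E x = (\<Sum>i\<in>UNIV. (x $ i) *\<^sub>R (k i *\<^sub>R \<beta> i))" for x :: "real^'n"
  have lE: "linear E"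
    unfolding E_def by (rule linearI) (simp_all add: sum.distrib algebra_simps scaleR_sum_right)
  have "k i \<noteq> 0" for i by (auto simp: k_def)
  have "\<beta> i \<in> range E" for i
  proof -
    have "E (axis i (1 / k i)) = \<beta> i"
      unfolding E_def using \<open>k i \<noteq> 0\<close>
      by (simp add: axis_def if_distrib[where f="\<lambda>c. c *\<^sub>R _"] if_distrib[where f="\<lambda>c. c * _"] if_distrib[where f="\<lambda>c. c / _"] cong: if_cong)
    then show ?thesis by (metis rangeI)
  qed
  then have "B \<subseteq> range E" using \<beta> by (auto simp: bij_betw_def)
  then have "span B \<subseteq> range E"
    by (rule span_minimal) (rule linear_subspace_image[OF lE subspace_UNIV])
  then have "surj E" using B by auto
  then have bE: "bij E" using linear_surjective_imp_injective[OF lE] by (simp add: bij_def)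
  have kb: "b (k i *\<^sub>R \<beta> i) (k j *\<^sub>R \<beta> j) = (if i = j then d i else 0)" for i j
  proof (cases "i = j")
    case True
    have "k i * (k i * b (\<beta> i) (\<beta> i)) = d i"
      by (simp add: k_def d_def sgn_if abs_if real_sqrt_mult[symmetric])
    then show ?thesis using True by (simp add: bilinear_form_onD[OF b])
  next
    case False
    then have "b (\<beta> i) (\<beta> j) = 0" using \<beta> B(3) by (auto simp: bij_betw_def inj_on_def)
    then show ?thesis using False by (simp add: bilinear_form_onD[OF b])
  qed
  show ?thesis
  proof (intro exI conjI allI)
    show "linear E" "bij E" by (rule lE, rule bE)
    show "b (E x) (E y) = (\<Sum>i\<in>UNIV. d i * x $ i * y $ i)" for x y
      unfolding E_def bilinear_form_UNIV_sum[OF b] kb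
      by (simp add: if_distrib[where f="\<lambda>c. _ * c"] mult.commute mult.left_commute cong: if_cong)
    show "d i \<in> {1, 0, -1}" for i by (simp add: d_def sgn_if)
  qed
qed

lemma dim_coordinate_subspace: "dim {x::real^'n. \<forall>i. i \<notin> I \<longrightarrow> x $ i = 0} = card I"
  using dim_substandard_cart[where 'a=real and 'n='n, of I] by (simp add: dim_vec_eq)

lemma subspace_coordinate: "subspace {x::real^'n. \<forall>i. i \<notin> I \<longrightarrow> x $ i = 0}"
  by (auto simp: subspace_def)

text \<open>A positive definite subspace meets the image of the axes with \<open>d i \<le> 0\<close>
  only in 0, which bounds its dimension; the image of the other axes attains the bound.\<close>

lemma positive_index_diagonal:
  fixes b :: "real^'n \<Rightarrow> real^'n \<Rightarrow> real" and d :: "'n \<Rightarrow> real"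
  assumes E: "linear E" "bij E" and bE: "\<And>x y. b (E x) (E y) = (\<Sum>i\<in>UNIV. d i * x $ i * y $ i)"
  shows "positive_index UNIV b = card {i. d i > 0}"
proof -
  let ?P = "{x::real^'n. \<forall>i. i \<notin> {i. d i > 0} \<longrightarrow> x $ i = 0}"
  let ?N = "{x::real^'n. \<forall>i. i \<notin> - {i. d i > 0} \<longrightarrow> x $ i = 0}"
  have dE: "dim (E ` S) = dim S" for S
    by (rule dim_image_eq[OF E(1)]) (use E(2) in \<open>simp add: bij_def inj_on_def\<close>)
  have ub: "dim S \<le> card {i. d i > 0}" if S: "subspace S" "positive_definite_on S b" for S
  proof -
    have N: "subspace (E ` ?N)" by (rule linear_subspace_image[OF E(1) subspace_coordinate])
    have "S \<inter> E ` ?N \<subseteq> {0}"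
    proof
      fix u assume "u \<in> S \<inter> E ` ?N"
      then obtain x where x: "u = E x" "x \<in> ?N" "u \<in> S" by auto
      have "b u u \<le> 0"
        unfolding x(1) bE
      proof (rule sum_nonpos)
        show "d i * x $ i * x $ i \<le> 0" for i
          using x(2) by (cases "d i > 0") (auto simp: mult.assoc mult_le_0_iff)
      qed
      then show "u \<in> {0}" using S x(3) unfolding positive_definite_on_def by force
    qed
    then have "dim (S \<inter> E ` ?N) = 0" by simp
    then have "dim {x + y |x y. x \<in> S \<and> y \<in> E ` ?N} = dim S + dim (E ` ?N)"
      using dim_sums_Int[OF S(1) N] by linarith
    then have "dim S + dim (E ` ?N) \<le> CARD('n)"
      using dim_subset_UNIV[of "{x + y |x y. x \<in> S \<and> y \<in> E ` ?N}"] by simp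
    moreover have "dim (E ` ?N) = CARD('n) - card {i. d i > 0}"
      unfolding dE dim_coordinate_subspace by (simp add: Compl_eq_Diff_UNIV card_Diff_subset)
    moreover have "card {i. d i > 0} \<le> CARD('n)" by (simp add: card_mono)
    ultimately show ?thesis by simp
  qed
  have ex: "\<exists>S. subspace S \<and> positive_definite_on S b \<and> dim S = card {i. d i > 0}"
  proof (intro exI conjI)
    show "subspace (E ` ?P)" by (rule linear_subspace_image[OF E(1) subspace_coordinate])
    show "dim (E ` ?P) = card {i. d i > 0}" unfolding dE dim_coordinate_subspace ..
    show "positive_definite_on (E ` ?P) b"
      unfolding positive_definite_on_def
    proof (intro ballI impI)
      fix v assume "v \<in> E ` ?P" "v \<noteq> 0"
      then obtain x where x: "v = E x" "x \<in> ?P" "x \<noteq> 0" using linear_0[OF E(1)] by auto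
      then obtain i where i: "x $ i \<noteq> 0" by (auto simp: vec_eq_iff)
      show "0 < b v v" unfolding x(1) bE
      proof (rule sum_pos2)
        show "0 < d i * x $ i * x $ i"
          using i x(2) by (auto simp: mult.assoc intro!: mult_pos_pos simp: zero_less_mult_iff linorder_neq_iff)
        show "0 \<le> d i * x $ i * x $ i" for i
          using x(2) by (cases "d i > 0") (auto simp: mult.assoc)
      qed auto
    qed
  qed
  let ?D = "dim ` {S. subspace S \<and> S \<subseteq> UNIV \<and> positive_definite_on S b}"
  have sub: "?D \<subseteq> {..card {i. d i > 0}}" using ub by blast
  have "card {i. d i > 0} \<in> ?D" using ex by (metis (mono_tags, lifting) imageI mem_Collect_eq subset_UNIV)
  then show ?thesis
    unfolding positive_index_def using sub finite_subset[OF sub] by (intro Max_eqI) auto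
qed

text \<open>Once both forms are diagonal with entries 1, 0, -1, equal signatures give equal
  multiplicities (the zeros are the remaining entries), so a permutation \<open>R\<close> of the
  coordinates matches them. A flip inserted between the two frames preserves the diagonal form and
  is therefore available for correcting the sign of the determinant.\<close>

lemma isometry_in_near_gen:
  fixes b1 b2 :: "real^'n \<Rightarrow> real^'n \<Rightarrow> real"
  assumes b1: "bilinear_form_on UNIV b1" "symmetric_on UNIV b1"
    and b2: "bilinear_form_on UNIV b2" "symmetric_on UNIV b2"
    and sig: "signature UNIV b1 = signature UNIV b2"
  obtains L where "\<And>c. c > 0 \<Longrightarrow> near_gen c L" "\<And>u v. b2 (L u) (L v) = b1 u v"
proof -
  obtain E1 :: "real^'n \<Rightarrow> real^'n" and d1 where ED1: "linear E1 \<and> bij E1 \<and>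
      (\<forall>x y. b1 (E1 x) (E1 y) = (\<Sum>i\<in>UNIV. d1 i * x $ i * y $ i)) \<and> (\<forall>i. d1 i \<in> {1, 0, -1})"
    using diagonalize_form[OF b1] by blast
  then have E1: "linear E1" "bij E1" "b1 (E1 x) (E1 y) = (\<Sum>i\<in>UNIV. d1 i * x $ i * y $ i)"
    and d1: "d1 i \<in> {1, 0, -1}" for x y i by blast+
  obtain E2 :: "real^'n \<Rightarrow> real^'n" and d2 where ED2: "linear E2 \<and> bij E2 \<and>
      (\<forall>x y. b2 (E2 x) (E2 y) = (\<Sum>i\<in>UNIV. d2 i * x $ i * y $ i)) \<and> (\<forall>i. d2 i \<in> {1, 0, -1})"
    using diagonalize_form[OF b2] by blast
  then have E2: "linear E2" "bij E2" "b2 (E2 x) (E2 y) = (\<Sum>i\<in>UNIV. d2 i * x $ i * y $ i)"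
    and d2: "d2 i \<in> {1, 0, -1}" for x y i by blast+
  have pos: "card {i. d1 i > 0} = card {i. d2 i > 0}"
    using sig positive_index_diagonal[OF E1] positive_index_diagonal[OF E2] by (simp add: signature_def)
  have "positive_index UNIV (\<lambda>u v. - b1 u v) = card {i. - d1 i > 0}"
    by (rule positive_index_diagonal[OF E1(1,2)]) (simp add: E1(3) sum_negf)
  moreover have "positive_index UNIV (\<lambda>u v. - b2 u v) = card {i. - d2 i > 0}"
    by (rule positive_index_diagonal[OF E2(1,2)]) (simp add: E2(3) sum_negf)
  ultimately have neg: "card {i. d1 i < 0} = card {i. d2 i < 0}"
    using sig by (simp add: signature_def)
  have cnt: "card {i. d i > 0} = card {i. d i = 1}" "card {i. d i < 0} = card {i. d i = -1}"
    "card {i. d i = 0} = CARD('n) - card {i. d i > 0} - card {i. d i < 0}"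
    if "\<And>i. d i \<in> {1, 0, -1}" for d :: "'n \<Rightarrow> real"
  proof -
    show "card {i. d i > 0} = card {i. d i = 1}"
      by (rule arg_cong[of _ _ card]) (use that in force)
    show "card {i. d i < 0} = card {i. d i = -1}"
      by (rule arg_cong[of _ _ card]) (use that in force)
    have "{i. d i = 0} = UNIV - {i. d i > 0} - {i. d i < 0}" by auto
    then show "card {i. d i = 0} = CARD('n) - card {i. d i > 0} - card {i. d i < 0}"
      by (simp add: card_Diff_subset subset_iff)
  qed
  have "card {i. d1 i = v} = card {i. d2 i = v}" for v
  proof (cases "v \<in> {1, 0, -1}")
    case True
    then show ?thesis using cnt[OF d1] cnt[OF d2] pos neg by auto
  next
    case False
    then have "{i. d1 i = v} = {}" "{i. d2 i = v} = {}" using d1 d2 by blast+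
    then show ?thesis by simp
  qed
  then have "image_mset d1 (mset_set UNIV) = image_mset d2 (mset_set UNIV)"
    by (intro multiset_eqI) (simp add: count_image_mset vimage_def)
  then obtain p where p: "p permutes UNIV" "\<And>i. d1 i = d2 (p i)"
    using image_mset_eq_implies_permutes[of UNIV d1 d2] by auto
  define R where "R x = (\<chi> j. x $ inv p j)" for x :: "real^'n"
  have R: "linear R" by (auto intro!: linearI simp: R_def vec_eq_iff)
  have bp: "bij p" using p permutes_bij by blast
  have "inj R"
  proof (rule injI)
    fix x y assume "R x = R y"
    then have "x $ inv p (p i) = y $ inv p (p i)" for i by (simp add: R_def vec_eq_iff)
    then show "x = y" using bp by (simp add: vec_eq_iff bij_is_inj)
  qed
  then have bR: "bij R" using linear_injective_imp_surjective[OF R] by (simp add: bij_def)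
  have bR2: "b2 (E2 (R x)) (E2 (R y)) = (\<Sum>i\<in>UNIV. d1 i * x $ i * y $ i)" for x y
  proof -
    have "b2 (E2 (R x)) (E2 (R y)) = (\<Sum>j\<in>UNIV. d2 j * x $ inv p j * y $ inv p j)"
      by (simp add: E2(3) R_def)
    also have "\<dots> = (\<Sum>i\<in>UNIV. d2 (p i) * x $ inv p (p i) * y $ inv p (p i))"
      by (rule sum.reindex_bij_betw[symmetric]) (use bp in simp)
    finally show ?thesis using bp p(2) by (simp add: bij_is_inj)
  qed
  have liE: "linear (inv E1)" "bij (inv E1)"
    using E1 inj_linear_imp_inv_linear bij_is_inj bij_imp_bij_inv by blast+
  have lQ: "linear (\<lambda>x. E2 (R x))" "bij (\<lambda>x. E2 (R x))"
    using linear_compose[OF R E2(1)] bij_comp[OF bR E2(2)] by (auto simp: o_def)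
  obtain I where I: "\<And>c. c > 0 \<Longrightarrow> near_gen c (\<lambda>x. E2 (R (flip I (inv E1 x))))"
    by (rule near_gen_between[OF liE lQ]) (rule that)
  show thesis
  proof (rule that[OF I])
    fix u v
    have "b2 (E2 (R (flip I (inv E1 u)))) (E2 (R (flip I (inv E1 v)))) = b1 (E1 (inv E1 u)) (E1 (inv E1 v))"
      unfolding bR2 E1(3) by (rule sum.cong) (auto simp: flip_def)
    also have "\<dots> = b1 u v" using E1(2) by (simp add: bij_is_surj surj_f_inv_f)
    finally show "b2 (E2 (R (flip I (inv E1 u)))) (E2 (R (flip I (inv E1 v)))) = b1 u v" .
  qed
qed

text \<open>The codomain is an arbitrary real vector space because tangent spaces sit in a function
  space that may have infinite dimension. Transporting a basis needs no finite-dimensional ambient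
  space.\<close>

lemma dim_linear_inj_image:
  fixes \<phi> :: "real^'n \<Rightarrow> 'v::real_vector"
  assumes "linear \<phi>" "inj \<phi>"
  shows "dim (\<phi> ` S) = dim S"
proof -
  obtain B where B: "B \<subseteq> S" "independent B" "S \<subseteq> span B" by (rule basis_exists)
  have "independent (\<phi> ` B)"
    using linear_independent_injective_image[OF assms(1) B(2)] assms(2) by (simp add: inj_on_def)
  moreover have "span (\<phi> ` S) = span (\<phi> ` B)"
    unfolding linear_span_image[OF assms(1)] using B by (metis span_eq span_superset subset_trans)
  ultimately have "dim (\<phi> ` S) = card (\<phi> ` B)" using dim_eq_card by metis
  also have "\<dots> = card B" using assms(2) by (simp add: card_image inj_on_def)
  also have "\<dots> = dim S" using B by (metis dim_eq_card span_eq span_superset subset_trans)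
  finally show ?thesis .
qed

lemma positive_index_linear_iso:
  fixes \<phi> :: "real^'n \<Rightarrow> 'v::real_vector"
  assumes \<phi>: "linear \<phi>" "inj \<phi>" and V: "range \<phi> = V"
  shows "positive_index V b = positive_index UNIV (\<lambda>x y. b (\<phi> x) (\<phi> y))"
proof -
  have "dim ` {S. subspace S \<and> S \<subseteq> V \<and> positive_definite_on S b}
     = dim ` {S. subspace S \<and> S \<subseteq> UNIV \<and> positive_definite_on S (\<lambda>x y. b (\<phi> x) (\<phi> y))}" (is "?L = ?R")
  proof
    show "?L \<subseteq> ?R"
    proof
      fix k assume "k \<in> ?L"
      then obtain S where S: "k = dim S" "subspace S" "S \<subseteq> V" "positive_definite_on S b" by auto
      have S': "S = \<phi> ` (\<phi> -` S)" using S V by auto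
      have "subspace (\<phi> -` S)" by (rule linear_subspace_vimage[OF \<phi>(1) S(2)])
      moreover have "positive_definite_on (\<phi> -` S) (\<lambda>x y. b (\<phi> x) (\<phi> y))"
        using S(4) linear_injective_0[OF \<phi>(1)] \<phi>(2) by (auto simp: positive_definite_on_def)
      moreover have "k = dim (\<phi> -` S)" using S(1) S' dim_linear_inj_image[OF \<phi>] by metis
      ultimately show "k \<in> ?R" by blast
    qed
    show "?R \<subseteq> ?L"
    proof
      fix k assume "k \<in> ?R"
      then obtain S where S: "k = dim S" "subspace S" "positive_definite_on S (\<lambda>x y. b (\<phi> x) (\<phi> y))" by auto
      have "subspace (\<phi> ` S)" by (rule linear_subspace_image[OF \<phi>(1) S(2)])
      moreover have "positive_definite_on (\<phi> ` S) b"
        using S(3) linear_0[OF \<phi>(1)] by (auto simp: positive_definite_on_def)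
      moreover have "\<phi> ` S \<subseteq> V" using V by auto
      moreover have "k = dim (\<phi> ` S)" using S(1) dim_linear_inj_image[OF \<phi>] by metis
      ultimately show "k \<in> ?L" by blast
    qed
  qed
  then show ?thesis by (simp add: positive_index_def)
qed

lemma signature_linear_iso:
  fixes \<phi> :: "real^'n \<Rightarrow> 'v::real_vector"
  assumes "linear \<phi>" "inj \<phi>" "range \<phi> = V"
  shows "signature V b = signature UNIV (\<lambda>x y. b (\<phi> x) (\<phi> y))"
  using positive_index_linear_iso[OF assms, of b] positive_index_linear_iso[OF assms, of "\<lambda>u v. - b u v"]
  by (simp add: signature_def)

subsection \<open>Charts and tangent spaces\<close>

locale smooth_manifold =
  fixes A :: "('m::{t2_space,second_countable_topology}, 'n::{finite,wellorder}) chart set"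
  assumes atlas: "smooth_atlas A"
begin

definition dtr where "dtr c d x = frechet_derivative (cmap d \<circ> cinv c) (at (cmap c x))"

text \<open>Continuity in the base point needs forms on one fixed space, whereas tangent spaces vary
  with the point. Through this expression on \<open>real^'n\<close> the linear algebra above also
  becomes applicable.\<close>

definition cform where "cform h c x u w = h x (tangent_vec A c x u) (tangent_vec A c x w)"

lemma open_cdom: "c \<in> A \<Longrightarrow> open (cdom c)"
  using atlas by (simp add: smooth_atlas_def)

lemma open_crange: "c \<in> A \<Longrightarrow> open (cmap c ` cdom c)"
  using atlas by (simp add: smooth_atlas_def)

lemma chart_homeo: "c \<in> A \<Longrightarrow> homeomorphism (cdom c) (cmap c ` cdom c) (cmap c) (cinv c)"
  using atlas by (simp add: smooth_atlas_def)

lemma cinv_cmap: "c \<in> A \<Longrightarrow> x \<in> cdom c \<Longrightarrow> cinv c (cmap c x) = x"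
  using chart_homeo homeomorphism_apply1 by metis

lemma cmap_cinv: "c \<in> A \<Longrightarrow> y \<in> cmap c ` cdom c \<Longrightarrow> cmap c (cinv c y) = y"
  using chart_homeo homeomorphism_apply2 by metis

lemma cinv_in: "c \<in> A \<Longrightarrow> y \<in> cmap c ` cdom c \<Longrightarrow> cinv c y \<in> cdom c"
  by (auto simp: cinv_cmap)

lemma continuous_cmap: "c \<in> A \<Longrightarrow> continuous_on (cdom c) (cmap c)"
  using chart_homeo homeomorphism_def by metis

lemma continuous_cinv: "c \<in> A \<Longrightarrow> continuous_on (cmap c ` cdom c) (cinv c)"
  using chart_homeo homeomorphism_def by metis

lemma inj_on_cmap: "c \<in> A \<Longrightarrow> inj_on (cmap c) (cdom c)"
  by (metis cinv_cmap inj_on_inverseI)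

lemma ex_chart: "\<exists>c\<in>A. x \<in> cdom c"
  using atlas by (auto simp: smooth_atlas_def)

lemma cmap_image_eq:
  "c \<in> A \<Longrightarrow> W \<subseteq> cdom c \<Longrightarrow> cmap c ` W = cmap c ` cdom c \<inter> cinv c -` W"
  by (auto simp: cinv_cmap image_iff subset_iff)

lemma cinv_image_eq:
  assumes "c \<in> A" "Y \<subseteq> cmap c ` cdom c"
  shows "cinv c ` Y = cdom c \<inter> cmap c -` Y"
proof
  show "cinv c ` Y \<subseteq> cdom c \<inter> cmap c -` Y"
  proof
    fix x assume "x \<in> cinv c ` Y"
    then obtain y where y: "x = cinv c y" "y \<in> Y" by blast
    then have "y \<in> cmap c ` cdom c" using assms by blast
    then show "x \<in> cdom c \<inter> cmap c -` Y" using y cinv_in[OF assms(1)] cmap_cinv[OF assms(1)] by simp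
  qed
  show "cdom c \<inter> cmap c -` Y \<subseteq> cinv c ` Y"
  proof
    fix x assume x: "x \<in> cdom c \<inter> cmap c -` Y"
    then have "x = cinv c (cmap c x)" using cinv_cmap[OF assms(1)] by simp
    then show "x \<in> cinv c ` Y" using x by blast
  qed
qed

lemma open_cmap_image: "c \<in> A \<Longrightarrow> open W \<Longrightarrow> W \<subseteq> cdom c \<Longrightarrow> open (cmap c ` W)"
  by (subst cmap_image_eq) (auto intro!: continuous_open_preimage continuous_cinv open_crange)

lemma open_cinv_image: "c \<in> A \<Longrightarrow> open Y \<Longrightarrow> Y \<subseteq> cmap c ` cdom c \<Longrightarrow> open (cinv c ` Y)"
  by (subst cinv_image_eq) (auto intro!: continuous_open_preimage continuous_cmap open_cdom)

lemma cmap_cinv_image: "c \<in> A \<Longrightarrow> Y \<subseteq> cmap c ` cdom c \<Longrightarrow> cmap c ` cinv c ` Y = Y"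
  by (simp add: image_image cmap_cinv subset_iff cong: image_cong)

lemma smooth_transition:
  "c \<in> A \<Longrightarrow> d \<in> A \<Longrightarrow> smooth_on (cmap c ` (cdom c \<inter> cdom d)) (cmap d \<circ> cinv c)"
  using atlas by (simp add: smooth_atlas_def)

lemma has_derivative_transition:
  assumes "c \<in> A" "d \<in> A" "x \<in> cdom c" "x \<in> cdom d"
  shows "((cmap d \<circ> cinv c) has_derivative dtr c d x) (at (cmap c x))"
  unfolding dtr_def using assms by (intro smooth_on_has_derivative[OF smooth_transition]) auto

lemma linear_dtr: "c \<in> A \<Longrightarrow> d \<in> A \<Longrightarrow> x \<in> cdom c \<Longrightarrow> x \<in> cdom d \<Longrightarrow> linear (dtr c d x)"
  using has_derivative_transition has_derivative_linear by blast

lemma dtr_refl: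
  assumes "c \<in> A" "x \<in> cdom c"
  shows "dtr c c x u = u"
proof -
  have "((cmap c \<circ> cinv c) has_derivative (\<lambda>u. u)) (at (cmap c x))"
    by (rule has_derivative_transform_within_open[OF has_derivative_ident open_crange[OF assms(1)]])
      (use assms cmap_cinv in auto)
  then show ?thesis using has_derivative_transition[OF assms(1,1) assms(2,2)] has_derivative_unique by metis
qed

text \<open>The chain rule for transition maps: the cocycle identity behind the consistency of
  \<open>tangent_vec\<close> across charts.\<close>

lemma dtr_trans:
  assumes "c \<in> A" "d \<in> A" "e \<in> A" "x \<in> cdom c" "x \<in> cdom d" "x \<in> cdom e"
  shows "dtr d e x (dtr c d x u) = dtr c e x u"
proof -
  have 1: "((cmap d \<circ> cinv c) has_derivative dtr c d x) (at (cmap c x))"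
    by (rule has_derivative_transition) (use assms in auto)
  have 2: "((cmap e \<circ> cinv d) has_derivative dtr d e x) (at ((cmap d \<circ> cinv c) (cmap c x)))"
    using has_derivative_transition[of d e x] assms by (simp add: cinv_cmap)
  have "((\<lambda>y. (cmap e \<circ> cinv d) ((cmap d \<circ> cinv c) y)) has_derivative (\<lambda>u. dtr d e x (dtr c d x u))) (at (cmap c x))"
    by (rule has_derivative_compose[OF 1 2])
  then have "((cmap e \<circ> cinv c) has_derivative (\<lambda>u. dtr d e x (dtr c d x u))) (at (cmap c x))"
    by (rule has_derivative_transform_within_open[OF _ open_cmap_image[OF assms(1), of "cdom c \<inter> cdom d"]])
      (use assms in \<open>auto simp: cinv_cmap open_cdom open_Int\<close>)
  then show ?thesis using has_derivative_transition[OF assms(1,3,4,6)] has_derivative_unique by metis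
qed

lemma tangent_vec_eq: "tangent_vec A c x u = (\<lambda>d. if d \<in> A \<and> x \<in> cdom d then dtr c d x u else 0)"
  unfolding tangent_vec_def dtr_def ..

lemma tangent_vec_self: "c \<in> A \<Longrightarrow> x \<in> cdom c \<Longrightarrow> tangent_vec A c x u c = u"
  by (simp add: tangent_vec_eq dtr_refl)

lemma tangent_vec_change:
  assumes "c \<in> A" "d \<in> A" "x \<in> cdom c" "x \<in> cdom d"
  shows "tangent_vec A c x u = tangent_vec A d x (dtr c d x u)"
  using assms dtr_trans[OF assms(1,2)] unfolding tangent_vec_eq fun_eq_iff by simp

lemma linear_tangent_vec:
  assumes "c \<in> A" "x \<in> cdom c"
  shows "linear (tangent_vec A c x)"
proof (rule linearI)
  fix u w r
  show "tangent_vec A c x (u + w) = tangent_vec A c x u + tangent_vec A c x w"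
    unfolding tangent_vec_eq fun_eq_iff by (simp add: linear_add[OF linear_dtr] assms)
  show "tangent_vec A c x (r *\<^sub>R u) = r *\<^sub>R tangent_vec A c x u"
    unfolding tangent_vec_eq fun_eq_iff scaleR_fun_def by (simp add: linear_cmul[OF linear_dtr] assms)
qed

lemma tangent_space_iff:
  "v \<in> tangent_space A x \<longleftrightarrow> (\<forall>c. \<not> (c \<in> A \<and> x \<in> cdom c) \<longrightarrow> v c = 0) \<and>
    (\<forall>c\<in>A. \<forall>d\<in>A. x \<in> cdom c \<inter> cdom d \<longrightarrow> v d = dtr c d x (v c))"
  unfolding tangent_space_def dtr_def mem_Collect_eq ..

lemma tangent_vec_in:
  assumes "c \<in> A" "x \<in> cdom c"
  shows "tangent_vec A c x u \<in> tangent_space A x"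
  unfolding tangent_space_iff
proof (intro conjI allI ballI impI)
  fix d e assume "d \<in> A" "e \<in> A" "x \<in> cdom d \<inter> cdom e"
  then show "tangent_vec A c x u e = dtr d e x (tangent_vec A c x u d)"
    using dtr_trans[of c d e x u] assms by (simp add: tangent_vec_eq)
qed (auto simp: tangent_vec_eq)

lemma tangent_vec_of_tangent:
  assumes "c \<in> A" "x \<in> cdom c" "v \<in> tangent_space A x"
  shows "tangent_vec A c x (v c) = v"
proof
  fix d
  show "tangent_vec A c x (v c) d = v d"
  proof (cases "d \<in> A \<and> x \<in> cdom d")
    case True
    then have "v d = dtr c d x (v c)" using assms unfolding tangent_space_iff by blast
    then show ?thesis using True by (simp only: tangent_vec_eq if_True simp_thms)
  next
    case False
    then have "v d = 0" using assms unfolding tangent_space_iff by blast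
    then show ?thesis using False by (auto simp: tangent_vec_eq)
  qed
qed

lemma range_tangent_vec:
  assumes "c \<in> A" "x \<in> cdom c"
  shows "range (tangent_vec A c x) = tangent_space A x"
proof
  show "range (tangent_vec A c x) \<subseteq> tangent_space A x" using tangent_vec_in[OF assms] by blast
  show "tangent_space A x \<subseteq> range (tangent_vec A c x)"
  proof
    fix v assume "v \<in> tangent_space A x"
    then have "v = tangent_vec A c x (v c)" by (rule tangent_vec_of_tangent[OF assms, symmetric])
    then show "v \<in> range (tangent_vec A c x)" by (rule range_eqI)
  qed
qed

lemma inj_tangent_vec: "c \<in> A \<Longrightarrow> x \<in> cdom c \<Longrightarrow> inj (tangent_vec A c x)"
  by (metis injI tangent_vec_self)

lemma tensor_eq_cform:
  assumes "c \<in> A" "x \<in> cdom c" "v \<in> tangent_space A x" "w \<in> tangent_space A x"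
  shows "h x v w = cform h c x (v c) (w c)"
  by (simp add: cform_def tangent_vec_of_tangent assms)

lemma cform_bilinear:
  assumes "c \<in> A" "x \<in> cdom c" "bilinear_form_on (tangent_space A x) (h x)"
  shows "bilinear_form_on UNIV (cform h c x)"
  unfolding bilinear_form_on_def cform_def
    linear_add[OF linear_tangent_vec[OF assms(1,2)]] linear_cmul[OF linear_tangent_vec[OF assms(1,2)]]
  using bilinear_form_onD[OF assms(3)] tangent_vec_in[OF assms(1,2)] by blast

lemma components_cform: "components A h c x $ i $ j = cform h c x (axis i 1) (axis j 1)"
  by (simp add: components_def cform_def)

lemma cform_components:
  assumes "c \<in> A" "x \<in> cdom c" "bilinear_form_on (tangent_space A x) (h x)"
  shows "cform h c x u w = (\<Sum>i\<in>UNIV. \<Sum>j\<in>UNIV. u $ i * w $ j * components A h c x $ i $ j)"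
proof -
  have "cform h c x (\<Sum>i\<in>UNIV. (u $ i) *\<^sub>R axis i 1) (\<Sum>j\<in>UNIV. (w $ j) *\<^sub>R axis j 1)
      = (\<Sum>i\<in>UNIV. \<Sum>j\<in>UNIV. u $ i * w $ j * cform h c x (axis i 1) (axis j 1))"
    by (rule bilinear_form_UNIV_sum[OF cform_bilinear[where h=h, OF assms]])
  then show ?thesis
    using basis_expansion[of u] basis_expansion[of w] by (simp add: components_cform scalar_mult_eq_scaleR)
qed

lemma cform_change:
  assumes "c \<in> A" "d \<in> A" "x \<in> cdom c" "x \<in> cdom d"
  shows "cform h c x u w = cform h d x (dtr c d x u) (dtr c d x w)"
  using tangent_vec_change[OF assms] by (simp add: cform_def)

lemma cform_signature:
  assumes "c \<in> A" "x \<in> cdom c"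
  shows "signature UNIV (cform h c x) = signature (tangent_space A x) (h x)"
  unfolding cform_def
  using signature_linear_iso[OF linear_tangent_vec[OF assms] inj_tangent_vec[OF assms] range_tangent_vec[OF assms], of "h x"]
  by simp

end

subsection \<open>The pointwise norm in coordinates\<close>

text \<open>Cramer's formula makes the continuity of matrix inversion visible.\<close>

definition cramer_inv :: "real^'n^'n \<Rightarrow> real^'n^'n" where
  "cramer_inv P = (\<chi> k j. det (\<chi> i l. if l = k then axis j 1 $ i else P $ i $ l) / det P)"

lemma cramer_inv_right:
  assumes "det P \<noteq> 0"
  shows "P ** cramer_inv P = mat 1"
proof -
  have c: "column j (cramer_inv P) = (\<chi> k. det (\<chi> i l. if l = k then axis j 1 $ i else P $ i $ l) / det P)" for j
    by (simp add: column_def cramer_inv_def vec_eq_iff)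
  have "P *v column j (cramer_inv P) = axis j 1" for j
    using cramer[OF assms, of "column j (cramer_inv P)" "axis j 1"] c by blast
  then show ?thesis
    by (simp add: vec_eq_iff matrix_matrix_mult_def matrix_vector_mult_def column_def mat_def axis_def)
qed

text \<open>The index formula for the norm, with \<open>P\<close> for the matrix of \<open>g\<close>
  and \<open>cramer_inv P\<close> for the inverse metric. It is visibly continuous, whereas
  \<open>pointwise_norm\<close> selects an orthonormal basis at each point without any
  regularity.\<close>

definition tnorm :: "real^'n^'n \<Rightarrow> real^'n^'n \<Rightarrow> real" where
  "tnorm P H = sqrt (\<Sum>j\<in>UNIV. \<Sum>l\<in>UNIV. cramer_inv P $ j $ l *
     (\<Sum>i\<in>UNIV. \<Sum>k\<in>UNIV. cramer_inv P $ i $ k * H $ i $ j * H $ k $ l))"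

lemma tnorm_zero: "tnorm P 0 = 0"
  by (simp add: tnorm_def)

lemma continuous_on_det [continuous_intros]:
  fixes M :: "'a::topological_space \<Rightarrow> real^'n^'n"
  assumes "\<And>i j. continuous_on S (\<lambda>x. M x $ i $ j)"
  shows "continuous_on S (\<lambda>x. det (M x))"
  unfolding det_def by (intro continuous_intros assms)

lemma continuous_on_cramer_inv:
  fixes P :: "'a::topological_space \<Rightarrow> real^'n^'n"
  assumes "\<And>i j. continuous_on S (\<lambda>x. P x $ i $ j)" "\<And>x. x \<in> S \<Longrightarrow> det (P x) \<noteq> 0"
  shows "continuous_on S (\<lambda>x. cramer_inv (P x) $ k $ l)"
proof -
  have "continuous_on S (\<lambda>x. (if j = k then axis l 1 $ i else P x $ i $ j))" for i j
    using assms(1) by (cases "j = k") auto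
  then show ?thesis
    unfolding cramer_inv_def vec_lambda_beta
    by (intro continuous_on_divide continuous_on_det) (auto simp: assms)
qed

lemma continuous_on_tnorm:
  fixes P H :: "'a::topological_space \<Rightarrow> real^'n^'n"
  assumes "\<And>i j. continuous_on S (\<lambda>x. P x $ i $ j)" "\<And>x. x \<in> S \<Longrightarrow> det (P x) \<noteq> 0"
    "\<And>i j. continuous_on S (\<lambda>x. H x $ i $ j)"
  shows "continuous_on S (\<lambda>x. tnorm (P x) (H x))"
  unfolding tnorm_def by (intro continuous_intros continuous_on_cramer_inv assms)

lemma form_orthonormal_independent:
  fixes b :: "'a::real_vector \<Rightarrow> 'a \<Rightarrow> real"
  assumes b: "bilinear_form_on UNIV b" and U: "\<And>u v. u \<in> U \<Longrightarrow> v \<in> U \<Longrightarrow> b u v = (if u = v then 1 else 0)"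
  shows "independent U"
  unfolding dependent_def
proof safe
  fix u assume u: "u \<in> U" "u \<in> span (U - {u})"
  have "b 0 u = 0" by (metis bilinear_form_onD(3)[OF b] UNIV_I mult_zero_left scaleR_zero_left)
  then have "subspace {w. b w u = 0}"
    by (auto simp: subspace_def bilinear_form_onD[OF b])
  moreover have "U - {u} \<subseteq> {w. b w u = 0}" using U u by auto
  ultimately have "span (U - {u}) \<subseteq> {w. b w u = 0}" using span_minimal by blast
  then show False using u U by fastforce
qed

text \<open>The sum \<open>K\<close> of the products u u^T over an orthonormal basis is the inverse
  of the Gram matrix \<open>P\<close>, because \<open>K ** P\<close> sends a vector to its expansion
  in that basis. Contracting \<open>H\<close> with \<open>K\<close> in both of its indices gives the
  index formula.\<close>

lemma sum_form_eq_tnorm: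
  fixes P H :: "real^'n^'n" and U :: "(real^'n) set"
  defines "b \<equiv> \<lambda>u w. \<Sum>i\<in>UNIV. \<Sum>j\<in>UNIV. u $ i * w $ j * P $ i $ j"
  assumes b: "bilinear_form_on UNIV b" and "det P \<noteq> 0" and fin: "finite U" and sp: "span U = UNIV"
    and U: "\<And>u v. u \<in> U \<Longrightarrow> v \<in> U \<Longrightarrow> b u v = (if u = v then 1 else 0)"
  shows "sqrt (\<Sum>u\<in>U. \<Sum>w\<in>U. (\<Sum>i\<in>UNIV. \<Sum>j\<in>UNIV. u $ i * w $ j * H $ i $ j)\<^sup>2) = tnorm P H"
proof -
  define K :: "real^'n^'n" where "K = (\<chi> i k. \<Sum>u\<in>U. u $ i * u $ k)"
  have KP: "(K ** P) *v w = (\<Sum>u\<in>U. b u w *\<^sub>R u)" for w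
  proof -
    have "((K ** P) *v w) $ i = (\<Sum>u\<in>U. b u w * u $ i)" for i
    proof -
      have "((K ** P) *v w) $ i = (\<Sum>k\<in>UNIV. (\<Sum>u\<in>U. u $ i * u $ k) * (\<Sum>j\<in>UNIV. P $ k $ j * w $ j))"
        unfolding matrix_vector_mul_assoc[symmetric] by (simp add: matrix_vector_mult_def K_def)
      also have "\<dots> = (\<Sum>k\<in>UNIV. \<Sum>u\<in>U. \<Sum>j\<in>UNIV. u $ i * u $ k * (P $ k $ j * w $ j))"
        by (simp only: sum_product)
      also have "\<dots> = (\<Sum>u\<in>U. \<Sum>k\<in>UNIV. \<Sum>j\<in>UNIV. u $ i * u $ k * (P $ k $ j * w $ j))"
        by (rule sum.swap)
      also have "\<dots> = (\<Sum>u\<in>U. b u w * u $ i)"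
        unfolding b_def by (simp add: sum_distrib_right sum_distrib_left mult_ac)
      finally show ?thesis .
    qed
    then show ?thesis by (simp add: vec_eq_iff sum_component)
  qed
  have "(K ** P) *v w = w" if "w \<in> U" for w
  proof -
    have "(\<Sum>u\<in>U. b u w *\<^sub>R u) = (\<Sum>u\<in>U. if u = w then w else 0)"
      by (rule sum.cong) (use U that in auto)
    then show ?thesis using KP fin that by simp
  qed
  moreover have "subspace {w. (K ** P) *v w = w}"
    by (auto simp: subspace_def matrix_vector_right_distrib matrix_vector_mult_scaleR)
  ultimately have "span U \<subseteq> {w. (K ** P) *v w = w}" by (intro span_minimal) auto
  then have "K ** P = mat 1" using sp by (simp add: matrix_eq subset_iff)
  then have "K = K ** (P ** cramer_inv P)" using cramer_inv_right[OF assms(3)] by simp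
  also have "\<dots> = cramer_inv P" using \<open>K ** P = mat 1\<close> by (simp add: matrix_mul_assoc)
  finally have "K = cramer_inv P" .
  then have K: "cramer_inv P $ i $ k = (\<Sum>u\<in>U. u $ i * u $ k)" for i k
  proof -
    have "cramer_inv P $ i $ k = K $ i $ k" unfolding \<open>K = cramer_inv P\<close> ..
    then show ?thesis by (simp add: K_def)
  qed
  let ?I = "UNIV :: 'n set"
  have quad: "(\<Sum>u\<in>U. (\<Sum>i\<in>?I. u $ i * a i) * (\<Sum>k\<in>?I. u $ k * b k)) =
      (\<Sum>i\<in>?I. \<Sum>k\<in>?I. cramer_inv P $ i $ k * a i * b k)" for a b :: "'n \<Rightarrow> real"
  proof -
    have "(\<Sum>u\<in>U. (\<Sum>i\<in>?I. u $ i * a i) * (\<Sum>k\<in>?I. u $ k * b k)) =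
        (\<Sum>u\<in>U. \<Sum>i\<in>?I. \<Sum>k\<in>?I. (u $ i * a i) * (u $ k * b k))"
      by (simp only: sum_product)
    also have "\<dots> = (\<Sum>i\<in>?I. \<Sum>u\<in>U. \<Sum>k\<in>?I. (u $ i * a i) * (u $ k * b k))"
      by (rule sum.swap)
    also have "\<dots> = (\<Sum>i\<in>?I. \<Sum>k\<in>?I. \<Sum>u\<in>U. (u $ i * a i) * (u $ k * b k))"
      by (intro sum.cong refl sum.swap)
    also have "\<dots> = (\<Sum>i\<in>?I. \<Sum>k\<in>?I. cramer_inv P $ i $ k * a i * b k)"
      unfolding K sum_distrib_right by (intro sum.cong refl) (simp add: mult_ac)
    finally show ?thesis .
  qed
  have row: "(\<Sum>i\<in>?I. \<Sum>j\<in>?I. u $ i * w $ j * H $ i $ j) = (\<Sum>j\<in>?I. w $ j * (\<Sum>i\<in>?I. u $ i * H $ i $ j))" for u w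
    by (subst sum.swap) (simp add: sum_distrib_left mult_ac)
  \<comment> \<open>\<open>quad\<close> is used once for each index of \<open>H\<close>: here for
    the sum over \<open>w\<close>, at the end for the sum over \<open>u\<close>.\<close>
  have "(\<Sum>u\<in>U. \<Sum>w\<in>U. (\<Sum>i\<in>?I. \<Sum>j\<in>?I. u $ i * w $ j * H $ i $ j)\<^sup>2)
     = (\<Sum>u\<in>U. \<Sum>j\<in>?I. \<Sum>l\<in>?I. cramer_inv P $ j $ l * (\<Sum>i\<in>?I. u $ i * H $ i $ j) * (\<Sum>k\<in>?I. u $ k * H $ k $ l))"
    unfolding row power2_eq_square by (simp only: quad)
  also have "\<dots> = (\<Sum>j\<in>?I. \<Sum>u\<in>U. \<Sum>l\<in>?I. cramer_inv P $ j $ l * (\<Sum>i\<in>?I. u $ i * H $ i $ j) * (\<Sum>k\<in>?I. u $ k * H $ k $ l))"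
    by (rule sum.swap)
  also have "\<dots> = (\<Sum>j\<in>?I. \<Sum>l\<in>?I. \<Sum>u\<in>U. cramer_inv P $ j $ l * (\<Sum>i\<in>?I. u $ i * H $ i $ j) * (\<Sum>k\<in>?I. u $ k * H $ k $ l))"
    by (intro sum.cong refl sum.swap)
  also have "\<dots> = (\<Sum>j\<in>?I. \<Sum>l\<in>?I. cramer_inv P $ j $ l *
     (\<Sum>i\<in>?I. \<Sum>k\<in>?I. cramer_inv P $ i $ k * H $ i $ j * H $ k $ l))"
    by (simp only: mult.assoc sum_distrib_left[symmetric] quad[unfolded mult.assoc])
  finally show ?thesis by (simp add: tnorm_def)
qed

definition onb :: "('m, 'n::finite) chart set \<Rightarrow> ('m, 'n) tensor2 \<Rightarrow> 'm \<Rightarrow> ('m, 'n) tvec set" where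
  "onb A g x = (SOME E. orthonormal_basis_of (tangent_space A x) (g x) E)"

text \<open>The selected basis depends on the metric and the point but not on the tensor, so the
  norm is a Euclidean norm of a family of values over a fixed index set. The triangle inequality and
  homogeneity follow for arbitrary fields, bilinear or not.\<close>

lemma pointwise_norm_L2_set:
  "pointwise_norm A g h x = L2_set (\<lambda>(e, e'). h x e e') (onb A g x \<times> onb A g x)"
  by (simp add: pointwise_norm_def onb_def[symmetric] L2_set_def sum.cartesian_product case_prod_unfold Let_def)

lemma pointwise_norm_nonneg: "0 \<le> pointwise_norm A g h x"
  by (simp add: pointwise_norm_L2_set L2_set_nonneg)

lemma pointwise_norm_triangle: "pointwise_norm A g (h + k) x \<le> pointwise_norm A g h x + pointwise_norm A g k x"
  using L2_set_triangle_ineq[of "\<lambda>(e, e'). h x e e'" "\<lambda>(e, e'). k x e e'"]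
  by (simp add: pointwise_norm_L2_set case_prod_unfold)

lemma pointwise_norm_scale:
  "pointwise_norm A g (\<lambda>x u v. k x * h x u v) x = \<bar>k x\<bar> * pointwise_norm A g h x"
  by (simp add: pointwise_norm_L2_set L2_set_def case_prod_unfold power_mult_distrib
      sum_distrib_left[symmetric] real_sqrt_mult)

lemma pointwise_norm_cong_point:
  "(\<And>u v. h x u v = k x u v) \<Longrightarrow> pointwise_norm A g h x = pointwise_norm A g k x"
  by (simp add: pointwise_norm_L2_set)

locale riemannian_manifold = smooth_manifold A
  for A :: "('m::{t2_space,second_countable_topology}, 'n::{finite,wellorder}) chart set" +
  fixes g :: "('m, 'n) tensor2"
  assumes riem: "riemannian_metric A g"
begin

lemma g_bilinear: "bilinear_form_on (tangent_space A x) (g x)"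
  using riem by (simp add: riemannian_metric_def smooth_tensor2_def)

lemma g_cform:
  assumes "c \<in> A" "x \<in> cdom c"
  shows "bilinear_form_on UNIV (cform g c x)" "symmetric_on UNIV (cform g c x)"
    "u \<noteq> 0 \<Longrightarrow> cform g c x u u > 0"
proof -
  show "bilinear_form_on UNIV (cform g c x)" by (rule cform_bilinear[where h=g, OF assms g_bilinear])
  show "symmetric_on UNIV (cform g c x)"
    using riem tangent_vec_in[OF assms] unfolding riemannian_metric_def symmetric_on_def cform_def by blast
  show "cform g c x u u > 0" if "u \<noteq> 0"
  proof -
    have "tangent_vec A c x u \<noteq> 0" using that tangent_vec_self[OF assms, of u] by auto
    then show ?thesis
      using riem tangent_vec_in[OF assms] unfolding riemannian_metric_def positive_definite_on_def cform_def by blast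
  qed
qed

lemma det_g_nonzero:
  assumes "c \<in> A" "x \<in> cdom c"
  shows "det (components A g c x) \<noteq> 0"
proof -
  let ?P = "components A g c x"
  have "u = 0" if "?P *v u = 0" for u
  proof (rule ccontr)
    assume "u \<noteq> 0"
    have "cform g c x u u = (\<Sum>i\<in>UNIV. u $ i * (?P *v u) $ i)"
      unfolding cform_components[where h=g, OF assms g_bilinear] matrix_vector_mult_def
      by (simp add: sum_distrib_left mult_ac)
    then show False using that g_cform(3)[OF assms \<open>u \<noteq> 0\<close>] by simp
  qed
  then have "inj ((*v) ?P)" by (simp add: linear_injective_0)
  then show ?thesis using det_nz_iff_inj[of "(*v) ?P"] by simp
qed

text \<open>Positive definiteness rules out the entries 0 and -1 in the diagonalisation of the
  form.\<close>

lemma g_orthonormal_frame: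
  assumes c: "c \<in> A" "x \<in> cdom c"
  shows "\<exists>E :: (real, 'n) vec \<Rightarrow> (real, 'n) vec. linear E \<and> bij E \<and>
    (\<forall>i j. cform g c x (E (axis i 1)) (E (axis j 1)) = (if i = j then 1 else 0))"
proof -
  let ?b = "cform g c x"
  obtain E :: "(real, 'n) vec \<Rightarrow> (real, 'n) vec" and d where "linear E \<and> bij E \<and>
      (\<forall>u w. ?b (E u) (E w) = (\<Sum>i\<in>UNIV. d i * u $ i * w $ i)) \<and> (\<forall>i. d i \<in> {1, 0, -1})"
    using diagonalize_form[OF g_cform(1,2)[OF c]] by blast
  then have E: "linear E" "bij E" and bE: "?b (E u) (E w) = (\<Sum>i\<in>UNIV. d i * u $ i * w $ i)"
    and d: "d i \<in> {1, 0, -1}" for u w i by blast+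
  have bax: "?b (E (axis i 1)) (E (axis j 1)) = (if i = j then d i else 0)" for i j
    unfolding bE by (simp add: axis_def if_distrib[where f="\<lambda>c. _ * c"] cong: if_cong)
  have "d i = 1" for i
  proof -
    have "E (axis i 1) \<noteq> 0"
      using linear_injective_0[OF E(1)] E(2) by (metis axis_eq_0_iff bij_is_inj one_neq_zero)
    then have "d i > 0" using g_cform(3)[OF c, of "E (axis i 1)"] bax[of i i] by simp
    then show ?thesis using d[of i] by auto
  qed
  then have orth: "?b (E (axis i 1)) (E (axis j 1)) = (if i = j then 1 else 0)" for i j using bax by simp
  show ?thesis by (rule exI[of _ E]) (intro conjI allI E orth)
qed

lemma ex_orthonormal_basis: "\<exists>E. orthonormal_basis_of (tangent_space A x) (g x) E"
proof -
  obtain c where c: "c \<in> A" "x \<in> cdom c" using ex_chart by blast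
  let ?t = "tangent_vec A c x"
  obtain E :: "(real, 'n) vec \<Rightarrow> (real, 'n) vec" where E: "linear E" "bij E"
    and orth: "\<And>i j. cform g c x (E (axis i 1)) (E (axis j 1)) = (if i = j then 1 else 0)"
    using g_orthonormal_frame[OF c] by blast
  let ?B = "range (\<lambda>i. ?t (E (axis i 1)))"
  have "orthonormal_basis_of (tangent_space A x) (g x) ?B"
    unfolding orthonormal_basis_of_def
  proof (intro conjI ballI)
    show "?B \<subseteq> tangent_space A x" using tangent_vec_in[OF c] by auto
    have "span (range (\<lambda>i. axis i 1)) = (UNIV :: (real, 'n) vec set)"
      using span_Basis[where 'a="(real, 'n) vec"] by (simp add: Basis_vec_def full_SetCompr_eq UNION_singleton_eq_range)
    then have "?t ` E ` span (range (\<lambda>i. axis i 1)) = tangent_space A x"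
      using E(2) range_tangent_vec[OF c] by (simp add: bij_is_surj)
    then show "span ?B = tangent_space A x"
      by (simp add: linear_span_image[OF E(1), symmetric] linear_span_image[OF linear_tangent_vec[OF c], symmetric] image_image)
    show "g x e e' = (if e = e' then 1 else 0)" if "e \<in> ?B" "e' \<in> ?B" for e e'
    proof -
      obtain i where i: "e = ?t (E (axis i 1))" using \<open>e \<in> ?B\<close> by (rule rangeE)
      obtain j where j: "e' = ?t (E (axis j 1))" using \<open>e' \<in> ?B\<close> by (rule rangeE)
      note ij = i j
      have "e = e' \<longleftrightarrow> i = j"
        using ij E(2) inj_tangent_vec[OF c] by (auto simp: inj_eq bij_is_inj axis_eq_axis)
      then show ?thesis using orth[of i j] ij by (simp add: cform_def)
    qed
  qed
  then show ?thesis by blast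
qed

text \<open>Evaluation at the chart \<open>c\<close> carries the selected orthonormal basis to an
  orthonormal basis of \<open>cform g c x\<close>, to which \<open>sum_form_eq_tnorm\<close>
  applies. This replaces the arbitrary basis by an expression in the components.\<close>

lemma pointwise_norm_eq_tnorm:
  assumes c: "c \<in> A" "x \<in> cdom c" and h: "bilinear_form_on (tangent_space A x) (h x)"
  shows "pointwise_norm A g h x = tnorm (components A g c x) (components A h c x)"
proof -
  define E where "E = onb A g x"
  have "orthonormal_basis_of (tangent_space A x) (g x) E"
    unfolding E_def onb_def using ex_orthonormal_basis by (rule someI_ex)
  then have E: "E \<subseteq> tangent_space A x" "span E = tangent_space A x"
    and o: "\<And>e e'. e \<in> E \<Longrightarrow> e' \<in> E \<Longrightarrow> g x e e' = (if e = e' then 1 else 0)"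
    by (auto simp: orthonormal_basis_of_def)
  define ev where "ev v = v c" for v :: "('m, 'n) tvec"
  have lin: "linear ev" by (auto intro!: linearI simp: ev_def scaleR_fun_def)
  have inj: "inj_on ev E"
  proof (rule inj_onI)
    fix e e' assume "e \<in> E" "e' \<in> E" "ev e = ev e'"
    then show "e = e'" using tangent_vec_of_tangent[OF c, of e] tangent_vec_of_tangent[OF c, of e'] E(1)
      by (auto simp: ev_def)
  qed
  define U where "U = ev ` E"
  have spU: "span U = UNIV"
  proof -
    have "u \<in> ev ` tangent_space A x" for u
      by (rule image_eqI[of _ _ "tangent_vec A c x u"]) (simp_all add: ev_def tangent_vec_self[OF c] tangent_vec_in[OF c])
    then show ?thesis unfolding U_def linear_span_image[OF lin] E(2) by auto
  qed
  have U: "cform g c x u w = (if u = w then 1 else 0)" if "u \<in> U" "w \<in> U" for u w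
  proof -
    obtain e where e: "u = ev e" "e \<in> E" using \<open>u \<in> U\<close> unfolding U_def by (rule imageE)
    obtain e' where e': "w = ev e'" "e' \<in> E" using \<open>w \<in> U\<close> unfolding U_def by (rule imageE)
    have "e \<in> tangent_space A x" "e' \<in> tangent_space A x" using e e' E(1) by blast+
    then have "cform g c x u w = g x e e'"
      unfolding e(1) e'(1) ev_def by (rule tensor_eq_cform[OF c, symmetric])
    then show ?thesis using o[OF e(2) e'(2)] inj_on_eq_iff[OF inj e(2) e'(2)] e(1) e'(1) by simp
  qed
  \<comment> \<open>Finiteness is not part of \<open>orthonormal_basis_of\<close>; it follows
    because orthonormal vectors are independent in \<open>real^'n\<close>.\<close>
  have finU: "finite U"
    using form_orthonormal_independent[OF g_cform(1)[OF c] U] finiteI_independent by blast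
  have "pointwise_norm A g h x = sqrt (\<Sum>e\<in>E. \<Sum>e'\<in>E. (cform h c x (ev e) (ev e'))\<^sup>2)"
    unfolding pointwise_norm_def Let_def onb_def[symmetric] E_def[symmetric]
    by (intro arg_cong[where f=sqrt] sum.cong refl arg_cong[where f="\<lambda>x. x\<^sup>2"])
      (use E(1) in \<open>simp add: ev_def subset_iff tensor_eq_cform[OF c]\<close>)
  also have "\<dots> = sqrt (\<Sum>u\<in>U. \<Sum>w\<in>U. (cform h c x u w)\<^sup>2)"
    by (simp add: U_def sum.reindex[OF inj])
  also have "\<dots> = tnorm (components A g c x) (components A h c x)"
    unfolding cform_components[where h=h, OF c h]
  proof (rule sum_form_eq_tnorm[OF _ det_g_nonzero[OF c] finU spU])
    have eq: "(\<lambda>u w. \<Sum>i\<in>UNIV. \<Sum>j\<in>UNIV. u $ i * w $ j * components A g c x $ i $ j) = cform g c x"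
      using cform_components[where h=g, OF c g_bilinear] by (simp add: fun_eq_iff)
    show "bilinear_form_on UNIV (\<lambda>u w. \<Sum>i\<in>UNIV. \<Sum>j\<in>UNIV. u $ i * w $ j * components A g c x $ i $ j)"
      unfolding eq by (rule g_cform(1)[OF c])
    show "(\<Sum>i\<in>UNIV. \<Sum>j\<in>UNIV. u $ i * w $ j * components A g c x $ i $ j) = (if u = w then 1 else 0)"
      if "u \<in> U" "w \<in> U" for u w
      using U[OF that] cform_components[where h=g, OF c g_bilinear] by simp
  qed
  finally show ?thesis .
qed

lemma continuous_components:
  assumes "smooth_tensor2 A h" "c \<in> A"
  shows "continuous_on (cdom c) (\<lambda>x. components A h c x $ i $ j)"
proof -
  have "continuous_on (cmap c ` cdom c) (\<lambda>y. components A h c (cinv c y) $ i $ j)"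
    using assms by (auto simp: smooth_tensor2_def intro: smooth_on_imp_continuous_on)
  then have "continuous_on (cdom c) (\<lambda>x. components A h c (cinv c (cmap c x)) $ i $ j)"
    by (rule continuous_on_compose2[OF _ continuous_cmap[OF assms(2)]]) simp
  then show ?thesis
    by (rule continuous_on_eq) (simp add: cinv_cmap assms)
qed

lemma g_smooth: "smooth_tensor2 A g" using riem by (simp add: riemannian_metric_def)

text \<open>Only continuous components are required, in a chart and a neighbourhood of choice: the
  components of a pullback are examined where \<open>\<Phi>\<close> stays within one chart
  domain.\<close>

lemma continuous_pointwise_norm:
  assumes h: "\<And>x. bilinear_form_on (tangent_space A x) (h x)"
    and loc: "\<And>x. \<exists>c W. c \<in> A \<and> open W \<and> x \<in> W \<and> W \<subseteq> cdom c \<and>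
      (\<forall>i j. continuous_on W (\<lambda>x. components A h c x $ i $ j))"
  shows "continuous_on UNIV (pointwise_norm A g h)"
proof -
  have "isCont (pointwise_norm A g h) x" for x
  proof -
    obtain c W where c: "c \<in> A" "open W" "x \<in> W" "W \<subseteq> cdom c"
      "\<And>i j. continuous_on W (\<lambda>x. components A h c x $ i $ j)" using loc by blast
    have "continuous_on W (\<lambda>x. tnorm (components A g c x) (components A h c x))"
    proof (rule continuous_on_tnorm)
      show "continuous_on W (\<lambda>x. components A g c x $ i $ j)" for i j
        by (rule continuous_on_subset[OF continuous_components[OF g_smooth c(1)] c(4)])
    qed (use c in \<open>auto simp: det_g_nonzero subset_iff\<close>)
    then have "continuous_on W (pointwise_norm A g h)"
      by (rule continuous_on_eq) (use c in \<open>auto simp: pointwise_norm_eq_tnorm h subset_iff\<close>)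
    then show ?thesis using c by (simp add: continuous_on_eq_continuous_at)
  qed
  then show ?thesis by (simp add: continuous_at_imp_continuous_on)
qed

lemma continuous_pointwise_norm_smooth:
  assumes "smooth_tensor2 A h"
  shows "continuous_on UNIV (pointwise_norm A g h)"
proof (rule continuous_pointwise_norm)
  show "bilinear_form_on (tangent_space A x) (h x)" for x using assms by (simp add: smooth_tensor2_def)
  show "\<exists>c W. c \<in> A \<and> open W \<and> x \<in> W \<and> W \<subseteq> cdom c \<and>
      (\<forall>i j. continuous_on W (\<lambda>x. components A h c x $ i $ j))" for x
  proof -
    obtain c where "c \<in> A" "x \<in> cdom c" using ex_chart by blast
    then show ?thesis
      by (intro exI[of _ c] exI[of _ "cdom c"]) (simp add: open_cdom continuous_components[OF assms])
  qed
qed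

end

subsection \<open>The Riemannian measure\<close>

text \<open>A bridge between two integrals: the measure is defined by nonnegative Lebesgue
  integrals, while the change of variables theorem speaks of absolutely integrable
  functions.\<close>

lemma nn_integral_set_absolutely_integrable:
  fixes u :: "'a::euclidean_space \<Rightarrow> real"
  assumes S: "S \<in> sets borel" and m: "(\<lambda>x. indicator S x *\<^sub>R u x) \<in> borel_measurable borel"
    and nn: "\<forall>x\<in>S. 0 \<le> u x"
  shows "u absolutely_integrable_on S \<Longrightarrow> (\<integral>\<^sup>+x\<in>S. ennreal (u x) \<partial>lborel) = ennreal (integral S u)"
    and "(\<integral>\<^sup>+x\<in>S. ennreal (u x) \<partial>lborel) < \<infinity> \<Longrightarrow> u absolutely_integrable_on S"
proof -
  have eq: "(\<integral>\<^sup>+x\<in>S. ennreal (u x) \<partial>lborel) = (\<integral>\<^sup>+x. ennreal (indicator S x *\<^sub>R u x) \<partial>lebesgue)"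
    unfolding nn_integral_completion by (intro nn_integral_cong) (auto simp: indicator_def)
  have nn': "AE x in lebesgue. 0 \<le> indicator S x *\<^sub>R u x" using nn by (auto simp: indicator_def)
  show "(\<integral>\<^sup>+x\<in>S. ennreal (u x) \<partial>lborel) = ennreal (integral S u)" if "u absolutely_integrable_on S"
  proof -
    have "(\<integral>\<^sup>+x. ennreal (indicator S x *\<^sub>R u x) \<partial>lebesgue) = ennreal (LINT x:S|lebesgue. u x)"
      unfolding set_lebesgue_integral_def
      by (rule nn_integral_eq_integral[OF _ nn']) (use that in \<open>simp add: set_integrable_def\<close>)
    then show ?thesis using set_lebesgue_integral_eq_integral(2)[OF that] eq by simp
  qed
  show "u absolutely_integrable_on S" if "(\<integral>\<^sup>+x\<in>S. ennreal (u x) \<partial>lborel) < \<infinity>"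
    unfolding set_integrable_def
    by (rule integrableI_nonneg[OF _ nn']) (use m that eq in \<open>auto intro: measurable_completion\<close>)
qed

lemma det_congruence:
  fixes B C J :: "real^'k^'k"
  assumes "\<And>i j. B $ i $ j = (\<Sum>k\<in>UNIV. \<Sum>l\<in>UNIV. J $ k $ i * J $ l $ j * C $ k $ l)"
  shows "det B = (det J)\<^sup>2 * det C"
proof -
  have "B $ i $ j = (transpose J ** C ** J) $ i $ j" for i j
  proof -
    have "B $ i $ j = (\<Sum>l\<in>UNIV. (\<Sum>k\<in>UNIV. J $ k $ i * C $ k $ l) * J $ l $ j)"
      unfolding assms by (subst sum.swap, intro sum.cong refl) (simp add: sum_distrib_left sum_distrib_right mult_ac)
    then show ?thesis by (simp add: matrix_matrix_mult_def transpose_def)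
  qed
  then have "B = transpose J ** C ** J" by (simp add: vec_eq_iff)
  then show ?thesis by (simp add: det_mul power2_eq_square mult_ac)
qed

context riemannian_manifold
begin

definition vol where "vol c y = sqrt (det (components A g c (cinv c y)))"

text \<open>The indicator secures measurability of the density: \<open>vol c\<close> is continuous
  on the range of the chart, but beyond it \<open>cinv c\<close> has unspecified values.\<close>

definition chart_measure where
  "chart_measure c = density lborel (\<lambda>y. ennreal (indicator (cmap c ` cdom c) y *\<^sub>R vol c y))"

lemma continuous_vol:
  assumes "c \<in> A"
  shows "continuous_on (cmap c ` cdom c) (vol c)"
  unfolding vol_def
proof (intro continuous_on_real_sqrt continuous_on_det)
  show "continuous_on (cmap c ` cdom c) (\<lambda>y. components A g c (cinv c y) $ i $ j)" for i j
    using g_smooth assms by (auto simp: smooth_tensor2_def intro: smooth_on_imp_continuous_on)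
qed

lemma vol_measurable:
  assumes "c \<in> A"
  shows "(\<lambda>y. indicator (cmap c ` cdom c) y *\<^sub>R vol c y) \<in> borel_measurable borel"
  by (rule borel_measurable_continuous_on_indicator[OF borel_open[OF open_crange[OF assms]] continuous_vol[OF assms]])

lemma vol_measurable_subset:
  assumes "c \<in> A" "S \<in> sets borel" "S \<subseteq> cmap c ` cdom c"
  shows "(\<lambda>y. indicator S y *\<^sub>R vol c y) \<in> borel_measurable borel"
proof -
  have "(\<lambda>y. indicator S y *\<^sub>R (indicator (cmap c ` cdom c) y *\<^sub>R vol c y)) \<in> borel_measurable borel"
    using vol_measurable[OF assms(1)] assms(2) by measurable
  moreover have "(\<lambda>y. indicator S y *\<^sub>R (indicator (cmap c ` cdom c) y *\<^sub>R vol c y)) = (\<lambda>y. indicator S y *\<^sub>R vol c y)"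
    using assms(3) by (auto simp: indicator_def fun_eq_iff)
  ultimately show ?thesis by simp
qed

lemma borel_cmap_image:
  assumes c: "c \<in> A" and B: "B \<in> sets borel" "B \<subseteq> cdom c"
  shows "cmap c ` B \<in> sets borel"
proof -
  let ?V = "cmap c ` cdom c"
  have V: "?V \<in> sets borel" using open_crange[OF c] by simp
  have "cinv c \<in> borel_measurable (restrict_space borel ?V)"
    by (rule borel_measurable_continuous_on_restrict[OF continuous_cinv[OF c]])
  from measurable_sets[OF this B(1)] have "cinv c -` B \<inter> ?V \<in> sets (restrict_space borel ?V)"
    by (simp add: space_restrict_space)
  then have "cinv c -` B \<inter> ?V \<in> sets borel"
    using V by (subst (asm) sets_restrict_space_iff) auto
  then show ?thesis by (subst cmap_image_eq[OF c B(2)]) (simp add: Int_commute)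
qed

lemma borel_cinv_image:
  assumes c: "c \<in> A" and B: "B \<in> sets borel" "B \<subseteq> cmap c ` cdom c"
  shows "cinv c ` B \<in> sets borel"
proof -
  have V: "cdom c \<in> sets borel" using open_cdom[OF c] by simp
  have "cmap c \<in> borel_measurable (restrict_space borel (cdom c))"
    by (rule borel_measurable_continuous_on_restrict[OF continuous_cmap[OF c]])
  from measurable_sets[OF this B(1)] have "cmap c -` B \<inter> cdom c \<in> sets (restrict_space borel (cdom c))"
    by (simp add: space_restrict_space)
  then have "cmap c -` B \<inter> cdom c \<in> sets borel"
    using V by (subst (asm) sets_restrict_space_iff) auto
  then show ?thesis by (subst cinv_image_eq[OF c B(2)]) (simp add: Int_commute)
qed

lemma emeasure_chart_measure:
  assumes c: "c \<in> A" and S: "S \<in> sets borel" "S \<subseteq> cmap c ` cdom c"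
  shows "emeasure (chart_measure c) S = (\<integral>\<^sup>+y\<in>S. ennreal (vol c y) \<partial>lborel)"
proof -
  have "emeasure (chart_measure c) S
      = (\<integral>\<^sup>+y. ennreal (indicator (cmap c ` cdom c) y *\<^sub>R vol c y) * indicator S y \<partial>lborel)"
    unfolding chart_measure_def
    by (rule emeasure_density) (use vol_measurable[OF c] S in auto)
  also have "\<dots> = (\<integral>\<^sup>+y\<in>S. ennreal (vol c y) \<partial>lborel)"
    by (rule nn_integral_cong) (use S(2) in \<open>auto simp: indicator_def\<close>)
  finally show ?thesis .
qed

lemma vol_change:
  assumes "c \<in> A" "d \<in> A" "x \<in> cdom c" "x \<in> cdom d"
  shows "vol c (cmap c x) = \<bar>det (matrix (dtr c d x))\<bar> * vol d (cmap d x)"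
proof -
  have "det (components A g c x) = (det (matrix (dtr c d x)))\<^sup>2 * det (components A g d x)"
  proof (rule det_congruence)
    fix i j
    show "components A g c x $ i $ j = (\<Sum>k\<in>UNIV. \<Sum>l\<in>UNIV. matrix (dtr c d x) $ k $ i *
        matrix (dtr c d x) $ l $ j * components A g d x $ k $ l)"
      unfolding components_cform[of g c] cform_change[OF assms]
        cform_components[where h=g, OF assms(2,4) g_bilinear] by (simp add: matrix_def)
  qed
  then show ?thesis using assms by (simp add: vol_def cinv_cmap real_sqrt_mult)
qed

text \<open>In an orthonormal frame \<open>E\<close> the Gram matrix is the identity, so
  \<open>det_congruence\<close> gives 1 = (det E)^2 det g and the determinant under the root is
  positive.\<close>

lemma vol_nonneg:
  assumes c: "c \<in> A" "x \<in> cdom c"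
  shows "vol c (cmap c x) \<ge> 0"
proof -
  obtain E :: "(real, 'n) vec \<Rightarrow> (real, 'n) vec" where orth: "\<And>i j. cform g c x (E (axis i 1)) (E (axis j 1)) = (if i = j then 1 else 0)"
    using g_orthonormal_frame[OF c] by blast
  have "det (mat 1 :: ((real, 'n) vec, 'n) vec) = (det (matrix E))\<^sup>2 * det (components A g c x)"
  proof (rule det_congruence)
    fix i j
    have "(mat 1 :: ((real, 'n) vec, 'n) vec) $ i $ j = cform g c x (E (axis i 1)) (E (axis j 1))"
      by (simp add: orth mat_def)
    then show "(mat 1 :: ((real, 'n) vec, 'n) vec) $ i $ j = (\<Sum>k\<in>UNIV. \<Sum>l\<in>UNIV. matrix E $ k $ i * matrix E $ l $ j *
        components A g c x $ k $ l)"
      unfolding cform_components[where h=g, OF c g_bilinear] by (simp add: matrix_def)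
  qed
  then have "(det (matrix E))\<^sup>2 * det (components A g c x) > 0" by simp
  then have "det (components A g c x) > 0" by (auto simp: zero_less_mult_iff)
  then show ?thesis using c by (simp add: vol_def cinv_cmap)
qed

text \<open>A transition map changes \<open>vol\<close> by the absolute value of its Jacobian
  determinant, which is exactly the factor in the change of variables theorem. This agreement on
  overlaps is what allows the chart measures to be glued.\<close>

lemma chart_measure_change:
  assumes c: "c \<in> A" and d: "d \<in> A" and B: "B \<in> sets borel" "B \<subseteq> cdom c \<inter> cdom d"
  shows "emeasure (chart_measure c) (cmap c ` B) = emeasure (chart_measure d) (cmap d ` B)"
proof -
  define S where "S = cmap c ` B"
  define \<tau> where "\<tau> = cmap d \<circ> cinv c"
  define J where "J y = dtr c d (cinv c y)" for y
  have Sb: "S \<in> sets borel" and Tb: "cmap d ` B \<in> sets borel"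
    unfolding S_def using borel_cmap_image c d B by auto
  have \<tau>S: "\<tau> ` S = cmap d ` B"
    unfolding S_def \<tau>_def image_image comp_def by (rule image_cong) (use B c in \<open>auto simp: cinv_cmap subset_iff\<close>)
  have der: "(\<tau> has_derivative J y) (at y within S)" if y: "y \<in> S" for y
  proof -
    obtain x where x: "y = cmap c x" "x \<in> B" using y S_def by blast
    have "x \<in> cdom c" "x \<in> cdom d" using x B by auto
    then show ?thesis
      using has_derivative_transition[OF c d, of x] c unfolding J_def \<tau>_def x(1)
      by (auto simp: cinv_cmap intro: has_derivative_at_withinI)
  qed
  have inj: "inj_on \<tau> S"
  proof (rule inj_onI)
    fix y z assume "y \<in> S" "z \<in> S" "\<tau> y = \<tau> z"
    then obtain x x' where x: "y = cmap c x" "z = cmap c x'" "x \<in> B" "x' \<in> B" unfolding S_def by blast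
    have "x \<in> cdom c" "x \<in> cdom d" "x' \<in> cdom c" "x' \<in> cdom d" using x B by auto
    then have "cmap d x = cmap d x'" using \<open>\<tau> y = \<tau> z\<close> x c by (simp add: \<tau>_def cinv_cmap)
    then have "x = x'" using inj_on_cmap[OF d] \<open>x \<in> cdom d\<close> \<open>x' \<in> cdom d\<close> by (simp add: inj_on_eq_iff)
    then show "y = z" using x by simp
  qed
  have volS: "vol c y = \<bar>det (matrix (J y))\<bar> * vol d (\<tau> y)" if y: "y \<in> S" for y
  proof -
    obtain x where x: "y = cmap c x" "x \<in> B" using y S_def by blast
    have "x \<in> cdom c" "x \<in> cdom d" using x B by auto
    then show ?thesis using vol_change[OF c d, of x] x c by (simp add: J_def \<tau>_def cinv_cmap)
  qed
  \<comment> \<open>The change of variables theorem is applied to vector-valued functions, so the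
    density takes a detour through \<open>real^1\<close>.\<close>
  define f :: "(real, 'n) vec \<Rightarrow> real^1" where "f y = vec (vol d y)" for y
  have cov: "(\<lambda>y. \<bar>det (matrix (J y))\<bar> *\<^sub>R f (\<tau> y)) absolutely_integrable_on S \<and>
      integral S (\<lambda>y. \<bar>det (matrix (J y))\<bar> *\<^sub>R f (\<tau> y)) = b
     \<longleftrightarrow> f absolutely_integrable_on (\<tau> ` S) \<and> integral (\<tau> ` S) f = b" for b
    by (rule has_absolute_integral_change_of_variables[OF _ der inj]) (use Sb in auto)
  have int1: "integral X h = vec (integral X (\<lambda>y. h y $ 1))" for X and h :: "(real, 'n) vec \<Rightarrow> real^1"
    by (rule integral_on_1_eq)
  have vinj: "(vec a :: real^1) = vec b \<longleftrightarrow> a = b" for a b :: real by (simp add: vec_eq_iff)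
  have *: "(\<lambda>y. \<bar>det (matrix (J y))\<bar> * vol d (\<tau> y)) absolutely_integrable_on S \<and>
      integral S (\<lambda>y. \<bar>det (matrix (J y))\<bar> * vol d (\<tau> y)) = b
     \<longleftrightarrow> vol d absolutely_integrable_on (\<tau> ` S) \<and> integral (\<tau> ` S) (vol d) = b" for b
    using cov[of "vec b"] unfolding absolutely_integrable_on_1_iff int1 vinj by (simp add: f_def)
  have **: "vol c absolutely_integrable_on S \<and> integral S (vol c) = b
     \<longleftrightarrow> vol d absolutely_integrable_on (\<tau> ` S) \<and> integral (\<tau> ` S) (vol d) = b" for b
  proof -
    have "(\<lambda>y. \<bar>det (matrix (J y))\<bar> * vol d (\<tau> y)) absolutely_integrable_on S \<longleftrightarrow> vol c absolutely_integrable_on S"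
      unfolding set_integrable_def by (intro Bochner_Integration.integrable_cong) (auto simp: indicator_def volS)
    moreover have "integral S (\<lambda>y. \<bar>det (matrix (J y))\<bar> * vol d (\<tau> y)) = integral S (vol c)"
      by (rule Henstock_Kurzweil_Integration.integral_cong) (simp add: volS)
    ultimately show ?thesis using * by simp
  qed
  have Ssub: "S \<subseteq> cmap c ` cdom c" and Tsub: "cmap d ` B \<subseteq> cmap d ` cdom d" using B S_def by auto
  have nnS: "\<forall>y\<in>S. 0 \<le> vol c y" using B(2) by (auto simp: S_def intro!: vol_nonneg[OF c])
  have nnT: "\<forall>y\<in>cmap d ` B. 0 \<le> vol d y" using B(2) by (auto intro!: vol_nonneg[OF d])
  note iS = nn_integral_set_absolutely_integrable[OF Sb vol_measurable_subset[OF c Sb Ssub] nnS]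
  note iT = nn_integral_set_absolutely_integrable[OF Tb vol_measurable_subset[OF d Tb Tsub] nnT]
  have "(\<integral>\<^sup>+y\<in>S. ennreal (vol c y) \<partial>lborel) = (\<integral>\<^sup>+y\<in>cmap d ` B. ennreal (vol d y) \<partial>lborel)"
  proof (cases "vol c absolutely_integrable_on S")
    case True
    then have i: "vol d absolutely_integrable_on (cmap d ` B)" "integral (cmap d ` B) (vol d) = integral S (vol c)"
      using **[of "integral S (vol c)"] unfolding \<tau>S by blast+
    show ?thesis unfolding iS(1)[OF True] iT(1)[OF i(1)] i(2) ..
  next
    case False
    \<comment> \<open>The change of variables concerns integrable densities, but integrability
      passes in both directions; hence both integrals are infinite here.\<close>
    then have "\<not> vol d absolutely_integrable_on (cmap d ` B)"
      using **[of "integral (cmap d ` B) (vol d)"] unfolding \<tau>S by blast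
    then have "\<not> (\<integral>\<^sup>+y\<in>cmap d ` B. ennreal (vol d y) \<partial>lborel) < \<infinity>" using iT(2) by blast
    moreover have "\<not> (\<integral>\<^sup>+y\<in>S. ennreal (vol c y) \<partial>lborel) < \<infinity>" using False iS(2) by blast
    ultimately show ?thesis unfolding infinity_ennreal_def less_top[symmetric] not_not by (rule trans[OF _ sym, rotated])
  qed
  then show ?thesis
    unfolding S_def[symmetric] emeasure_chart_measure[OF c Sb Ssub] emeasure_chart_measure[OF d Tb Tsub] .
qed

definition is_riem_measure where
  "is_riem_measure \<mu> \<longleftrightarrow> sets \<mu> = sets borel \<and> (\<forall>c\<in>A. \<forall>B\<in>sets borel. B \<subseteq> cdom c \<longrightarrow>
     emeasure \<mu> B = emeasure (chart_measure c) (cmap c ` B))"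

lemma is_riem_measureD:
  "is_riem_measure \<mu> \<Longrightarrow> c \<in> A \<Longrightarrow> B \<in> sets borel \<Longrightarrow> B \<subseteq> cdom c \<Longrightarrow>
    emeasure \<mu> B = emeasure (chart_measure c) (cmap c ` B)"
  by (simp add: is_riem_measure_def)

lemma riemannian_measure_eq: "riemannian_measure A g = (THE \<mu>. is_riem_measure \<mu>)"
proof -
  have "emeasure (chart_measure c) (cmap c ` B) =
      (\<integral>\<^sup>+ y \<in> cmap c ` B. ennreal (sqrt (det (components A g c (cinv c y)))) \<partial>lborel)"
    if "c \<in> A" "B \<in> sets borel" "B \<subseteq> cdom c" for c B
    using emeasure_chart_measure[OF that(1) borel_cmap_image[OF that]] that(3) by (simp add: vol_def image_mono)
  then show ?thesis unfolding riemannian_measure_def is_riem_measure_def by (auto intro!: arg_cong[where f=The])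
qed

end

locale compact_riemannian_manifold = riemannian_manifold A g
  for A :: "('m::{t2_space,second_countable_topology}, 'n::{finite,wellorder}) chart set" and g +
  assumes compact_M: "compact (UNIV :: 'm set)"
begin

lemma finite_atlas: "\<exists>D\<subseteq>A. finite D \<and> (\<Union>c\<in>D. cdom c) = UNIV"
proof -
  have "\<exists>D\<subseteq>A. finite D \<and> UNIV \<subseteq> (\<Union>c\<in>D. cdom c)"
    by (rule compactE_image[OF compact_M, of A cdom]) (use open_cdom ex_chart in auto)
  then show ?thesis by auto
qed

text \<open>Finitely many chart domains are cut into disjoint Borel pieces \<open>W i\<close>, and
  on each piece the measure is forced to be that of its chart. This gives uniqueness; the sum over
  the pieces gives existence, since by \<open>chart_measure_change\<close> its values do not depend
  on the charts used. The definite description in \<open>riemannian_measure\<close> thereby denotes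
  a measure with the required property.\<close>

lemma ex1_riem_measure: "\<exists>!\<mu>. is_riem_measure \<mu>"
proof -
  obtain D where D: "D \<subseteq> A" "finite D" "(\<Union>c\<in>D. cdom c) = UNIV" using finite_atlas by blast
  obtain cs where cs: "set cs = D" using finite_list[OF D(2)] by blast
  define N where "N = length cs"
  define c where "c i = cs ! i" for i
  have cA: "c i \<in> A" if "i < N" for i using that cs D by (auto simp: c_def N_def)
  define W where "W i = cdom (c i) - (\<Union>j<i. cdom (c j))" for i
  have Wb: "W i \<in> sets borel" if "i < N" for i
    unfolding W_def using cA that open_cdom by (intro sets.Diff sets.finite_UN) auto
  have Wsub: "W i \<subseteq> cdom (c i)" for i by (auto simp: W_def)
  have Wdisj: "W i \<inter> W j = {}" if "i \<noteq> j" for i j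
    using that by (cases i j rule: linorder_cases) (auto simp: W_def)
  have Wcov: "(\<Union>i<N. W i) = UNIV"
  proof -
    have "\<exists>i<N. x \<in> W i" for x
    proof -
      obtain e where e: "e \<in> set cs" "x \<in> cdom e" using D(3) cs by blast
      obtain i where "i < length cs" "cs ! i = e" using e(1) unfolding in_set_conv_nth by blast
      then have "\<exists>i. i < N \<and> x \<in> cdom (c i)" using e(2) by (auto simp: c_def N_def)
      then have "\<exists>i. (i < N \<and> x \<in> cdom (c i)) \<and> (\<forall>j<i. \<not> (j < N \<and> x \<in> cdom (c j)))"
        by (rule exists_least_iff[THEN iffD1])
      then obtain i where i: "i < N" "x \<in> cdom (c i)" "\<And>j. j < i \<Longrightarrow> \<not> (j < N \<and> x \<in> cdom (c j))" by blast
      then have "x \<in> W i" by (auto simp: W_def)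
      then show ?thesis using i by blast
    qed
    then show ?thesis by blast
  qed
  define \<mu>0 where "\<mu>0 B = (\<Sum>i<N. emeasure (chart_measure (c i)) (cmap (c i) ` (B \<inter> W i)))" for B
  define M where "M = measure_of UNIV (sets borel) \<mu>0"
  have setsM: "sets M = sets borel"
    unfolding M_def using sets.sigma_sets_eq[of "borel :: 'm measure"] by (simp add: sets_measure_of)
  have im: "cmap (c i) ` (B \<inter> W i) \<in> sets (chart_measure (c i))" if "i < N" "B \<in> sets borel" for i B
    using borel_cmap_image[OF cA[OF that(1)], of "B \<inter> W i"] that Wb Wsub[of i]
    by (auto simp: chart_measure_def)
  have ca: "countably_additive (sets M) \<mu>0"
    unfolding countably_additive_def
  proof (intro allI impI)
    fix F :: "nat \<Rightarrow> 'm set" assume F: "range F \<subseteq> sets M" "disjoint_family F"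
    have Fb: "F n \<in> sets borel" for n using F(1) setsM by auto
    have "(\<Sum>n. \<mu>0 (F n)) = (\<Sum>i<N. \<Sum>n. emeasure (chart_measure (c i)) (cmap (c i) ` (F n \<inter> W i)))"
      unfolding \<mu>0_def by (rule suminf_sum) simp
    also have "\<dots> = (\<Sum>i<N. emeasure (chart_measure (c i)) (cmap (c i) ` ((\<Union>n. F n) \<inter> W i)))"
    proof (rule sum.cong[OF refl])
      fix i assume "i \<in> {..<N}"
      then have i: "i < N" by simp
      have "(\<Sum>n. emeasure (chart_measure (c i)) (cmap (c i) ` (F n \<inter> W i)))
         = emeasure (chart_measure (c i)) (\<Union>n. cmap (c i) ` (F n \<inter> W i))"
      proof (rule suminf_emeasure)
        show "range (\<lambda>n. cmap (c i) ` (F n \<inter> W i)) \<subseteq> sets (chart_measure (c i))"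
          using im[OF i Fb] by auto
        show "disjoint_family (\<lambda>n. cmap (c i) ` (F n \<inter> W i))"
          unfolding disjoint_family_on_def
        proof (intro ballI impI)
          fix m n :: nat assume "m \<noteq> n"
          then have "F m \<inter> F n = {}" using F(2) by (auto simp: disjoint_family_on_def)
          moreover have "cmap (c i) ` (F m \<inter> W i) \<inter> cmap (c i) ` (F n \<inter> W i)
              = cmap (c i) ` ((F m \<inter> W i) \<inter> (F n \<inter> W i))"
            by (rule inj_on_image_Int[OF inj_on_cmap[OF cA[OF i]], symmetric]) (use Wsub[of i] in auto)
          ultimately show "cmap (c i) ` (F m \<inter> W i) \<inter> cmap (c i) ` (F n \<inter> W i) = {}" by auto
        qed
      qed
      also have "(\<Union>n. cmap (c i) ` (F n \<inter> W i)) = cmap (c i) ` ((\<Union>n. F n) \<inter> W i)" by auto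
      finally show "(\<Sum>n. emeasure (chart_measure (c i)) (cmap (c i) ` (F n \<inter> W i)))
         = emeasure (chart_measure (c i)) (cmap (c i) ` ((\<Union>n. F n) \<inter> W i))" .
    qed
    finally show "(\<Sum>n. \<mu>0 (F n)) = \<mu>0 (\<Union> (range F))" by (simp add: \<mu>0_def)
  qed
  have emM: "emeasure M B = \<mu>0 B" if "B \<in> sets borel" for B
    by (rule emeasure_measure_of[OF M_def _ _ ca]) (use that setsM in \<open>auto simp: positive_def \<mu>0_def\<close>)
  have split: "(\<Sum>i<N. emeasure K (S i)) = emeasure K (\<Union>i<N. S i)"
    if "\<And>i. i < N \<Longrightarrow> S i \<in> sets K" "\<And>i j. i \<noteq> j \<Longrightarrow> S i \<inter> S j = {}" for K :: "'k measure" and S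
    by (rule sum_emeasure) (use that in \<open>auto simp: disjoint_family_on_def\<close>)
  have exM: "is_riem_measure M"
    unfolding is_riem_measure_def
  proof (intro conjI ballI impI setsM)
    fix d B assume d: "d \<in> A" and B: "B \<in> sets borel" "B \<subseteq> cdom d"
    have "\<mu>0 B = (\<Sum>i<N. emeasure (chart_measure d) (cmap d ` (B \<inter> W i)))"
      unfolding \<mu>0_def
    proof (rule sum.cong[OF refl])
      fix i assume "i \<in> {..<N}"
      then show "emeasure (chart_measure (c i)) (cmap (c i) ` (B \<inter> W i)) = emeasure (chart_measure d) (cmap d ` (B \<inter> W i))"
        using B Wb[of i] Wsub[of i] by (intro chart_measure_change[OF cA d]) auto
    qed
    also have "\<dots> = emeasure (chart_measure d) (\<Union>i<N. cmap d ` (B \<inter> W i))"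
    proof (rule split)
      show "cmap d ` (B \<inter> W i) \<in> sets (chart_measure d)" if "i < N" for i
        using borel_cmap_image[OF d, of "B \<inter> W i"] B Wb[OF that] by (auto simp: chart_measure_def)
      show "cmap d ` (B \<inter> W i) \<inter> cmap d ` (B \<inter> W j) = {}" if "i \<noteq> j" for i j
      proof -
        have "cmap d ` (B \<inter> W i) \<inter> cmap d ` (B \<inter> W j) = cmap d ` ((B \<inter> W i) \<inter> (B \<inter> W j))"
          by (rule inj_on_image_Int[OF inj_on_cmap[OF d], symmetric]) (use B in auto)
        then show ?thesis using Wdisj[OF that] by auto
      qed
    qed
    also have "(\<Union>i<N. cmap d ` (B \<inter> W i)) = cmap d ` B" using Wcov by blast
    finally show "emeasure M B = emeasure (chart_measure d) (cmap d ` B)" using emM[OF B(1)] by simp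
  qed
  have "\<mu>' = M" if "is_riem_measure \<mu>'" for \<mu>'
  proof (rule measure_eqI)
    show "sets \<mu>' = sets M" using that setsM by (simp add: is_riem_measure_def)
    fix B assume "B \<in> sets \<mu>'"
    then have B: "B \<in> sets borel" using that by (simp add: is_riem_measure_def)
    have "(\<Union>i<N. B \<inter> W i) = B" using Wcov by blast
    then have "emeasure \<mu>' B = emeasure \<mu>' (\<Union>i<N. B \<inter> W i)" by simp
    also have "\<dots> = (\<Sum>i<N. emeasure \<mu>' (B \<inter> W i))"
      by (rule split[symmetric]) (use B Wb Wdisj that in \<open>auto simp: is_riem_measure_def\<close>)
    also have "\<dots> = \<mu>0 B"
      unfolding \<mu>0_def
    proof (rule sum.cong[OF refl])
      fix i assume "i \<in> {..<N}"
      then show "emeasure \<mu>' (B \<inter> W i) = emeasure (chart_measure (c i)) (cmap (c i) ` (B \<inter> W i))"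
        using B Wb[of i] Wsub[of i] cA[of i] by (intro is_riem_measureD[OF that]) auto
    qed
    finally show "emeasure \<mu>' B = emeasure M B" using emM[OF B] by simp
  qed
  then show ?thesis using exM by blast
qed

definition \<mu> where "\<mu> = riemannian_measure A g"

lemma is_riem_measure_\<mu>: "is_riem_measure \<mu>"
  unfolding \<mu>_def riemannian_measure_eq by (rule theI'[OF ex1_riem_measure])

lemma sets_\<mu> [simp]: "sets \<mu> = sets borel"
  using is_riem_measure_\<mu> by (simp add: is_riem_measure_def)

lemma space_\<mu> [simp]: "space \<mu> = UNIV"
  using sets_eq_imp_space_eq[OF sets_\<mu>] by simp

lemma emeasure_\<mu>:
  "c \<in> A \<Longrightarrow> B \<in> sets borel \<Longrightarrow> B \<subseteq> cdom c \<Longrightarrow> emeasure \<mu> B = emeasure (chart_measure c) (cmap c ` B)"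
  using is_riem_measure_\<mu> by (simp add: is_riem_measure_def)

lemma emeasure_\<mu>_chart_ball:
  assumes c: "c \<in> A" and K: "compact K" "K \<subseteq> cmap c ` cdom c"
  shows "emeasure \<mu> (cinv c ` K) < \<infinity>"
proof -
  have Kb: "K \<in> sets borel" using K by (simp add: compact_imp_closed)
  have "cinv c ` K \<subseteq> cdom c" using cinv_image_eq[OF c K(2)] by blast
  then have "emeasure \<mu> (cinv c ` K) = emeasure (chart_measure c) K"
    using emeasure_\<mu>[OF c borel_cinv_image[OF c Kb K(2)]] cmap_cinv_image[OF c K(2)] by simp
  also have "\<dots> = (\<integral>\<^sup>+y\<in>K. ennreal (vol c y) \<partial>lborel)" by (rule emeasure_chart_measure[OF c Kb K(2)])
  also have "\<dots> < \<infinity>"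
  proof -
    have "compact (vol c ` K)"
      by (rule compact_continuous_image[OF continuous_on_subset[OF continuous_vol[OF c] K(2)] K(1)])
    then obtain C where C: "\<And>y. y \<in> K \<Longrightarrow> norm (vol c y) \<le> C"
      using compact_imp_bounded bounded_iff by (metis imageI)
    have "(\<integral>\<^sup>+y\<in>K. ennreal (vol c y) \<partial>lborel) \<le> (\<integral>\<^sup>+y\<in>K. ennreal C \<partial>lborel)"
    proof (intro nn_integral_mono)
      fix y
      show "ennreal (vol c y) * indicator K y \<le> ennreal C * indicator K y"
        using C[of y] by (cases "y \<in> K") (auto simp: indicator_def intro!: ennreal_leI)
    qed
    also have "\<dots> = ennreal C * emeasure lborel K"
      by (rule nn_integral_cmult_indicator) (use Kb in simp)
    also have "\<dots> < \<infinity>" using emeasure_compact_finite[OF K(1)] by (simp add: ennreal_mult_less_top)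
    finally show ?thesis .
  qed
  finally show ?thesis .
qed

lemma finite_measure_\<mu>: "finite_measure \<mu>"
proof
  have "\<exists>U. open U \<and> x \<in> U \<and> emeasure \<mu> U < \<infinity>" for x
  proof -
    obtain c where c: "c \<in> A" "x \<in> cdom c" using ex_chart by blast
    obtain r where r: "r > 0" "cball (cmap c x) r \<subseteq> cmap c ` cdom c"
      using open_crange[OF c(1)] c(2) open_contains_cball by (metis imageI)
    have b: "ball (cmap c x) r \<subseteq> cmap c ` cdom c" using r ball_subset_cball by blast
    show ?thesis
    proof (intro exI conjI)
      show "open (cinv c ` ball (cmap c x) r)" by (rule open_cinv_image[OF c(1) open_ball b])
      show "x \<in> cinv c ` ball (cmap c x) r"
        by (rule image_eqI[of _ _ "cmap c x"]) (use r c in \<open>auto simp: cinv_cmap\<close>)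
      have "emeasure \<mu> (cinv c ` ball (cmap c x) r) \<le> emeasure \<mu> (cinv c ` cball (cmap c x) r)"
        by (intro emeasure_mono image_mono ball_subset_cball) (use borel_cinv_image[OF c(1) _ r(2)] in simp)
      then show "emeasure \<mu> (cinv c ` ball (cmap c x) r) < \<infinity>"
        using emeasure_\<mu>_chart_ball[OF c(1) compact_cball r(2)] by (rule le_less_trans)
    qed
  qed
  then obtain U where U: "\<And>x. open (U x)" "\<And>x. x \<in> U x" "\<And>x. emeasure \<mu> (U x) < \<infinity>" by metis
  obtain X where X: "finite X" "UNIV \<subseteq> (\<Union>x\<in>X. U x)"
    by (rule compactE_image[OF compact_M, of UNIV U]) (use U in auto)
  have "emeasure \<mu> UNIV \<le> emeasure \<mu> (\<Union>x\<in>X. U x)"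
    by (rule emeasure_mono[OF X(2)]) (simp add: borel_open U(1) open_UN)
  also have "\<dots> \<le> (\<Sum>x\<in>X. emeasure \<mu> (U x))"
    by (rule emeasure_subadditive_finite[OF X(1)]) (simp add: image_subset_iff borel_open U(1))
  also have "\<dots> < \<infinity>" using X(1) U(3) by simp
  finally show "emeasure \<mu> (space \<mu>) \<noteq> \<infinity>" by simp
qed

lemma emeasure_\<mu>_negligible:
  assumes c: "c \<in> A" and N: "N \<in> sets borel" "N \<subseteq> cdom c" "negligible (cmap c ` N)"
  shows "emeasure \<mu> N = 0"
proof -
  have b: "cmap c ` N \<in> sets borel" by (rule borel_cmap_image[OF c N(1,2)])
  have "cmap c ` N \<in> null_sets lborel"
    using N(3) b by (simp add: negligible_iff_null_sets null_sets_completion_iff)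
  then have "AE y in lborel. y \<notin> cmap c ` N" by (rule AE_not_in)
  moreover have "emeasure \<mu> N = (\<integral>\<^sup>+y\<in>cmap c ` N. ennreal (vol c y) \<partial>lborel)"
    using emeasure_\<mu>[OF c N(1,2)] emeasure_chart_measure[OF c b] N(2) by (simp add: image_mono)
  ultimately show ?thesis by (simp add: nn_integral_null_set[OF \<open>cmap c ` N \<in> null_sets lborel\<close>])
qed

end

subsection \<open>Smooth maps and functions\<close>

context smooth_manifold
begin

text \<open>One pair of charts near each point is enough, because any other pair differs by
  transition maps. Continuity, which \<open>smooth_map\<close> demands separately, is recovered from
  the same local representations.\<close>

lemma smooth_map_localI:
  assumes loc: "\<And>x. \<exists>c d W. c \<in> A \<and> d \<in> A \<and> open W \<and> x \<in> W \<and> W \<subseteq> cdom c \<and> \<Phi> ` W \<subseteq> cdom d \<and>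
    smooth_on (cmap c ` W) (cmap d \<circ> \<Phi> \<circ> cinv c)"
  shows "smooth_map A \<Phi>"
  unfolding smooth_map_def
proof (intro conjI ballI)
  have "isCont \<Phi> x" for x
  proof -
    obtain c d W where w: "c \<in> A" "d \<in> A" "open W" "x \<in> W" "W \<subseteq> cdom c" "\<Phi> ` W \<subseteq> cdom d"
      and sm: "smooth_on (cmap c ` W) (cmap d \<circ> \<Phi> \<circ> cinv c)" using loc[of x] by blast
    have "continuous_on W (\<lambda>x. (cmap d \<circ> \<Phi> \<circ> cinv c) (cmap c x))"
      by (rule continuous_on_compose2[OF smooth_on_imp_continuous_on[OF sm] continuous_on_subset[OF continuous_cmap[OF w(1)] w(5)]]) simp
    then have "continuous_on W (\<lambda>x. cmap d (\<Phi> x))"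
      by (rule continuous_on_eq) (use w in \<open>auto simp: cinv_cmap subset_iff\<close>)
    then have "continuous_on W (\<lambda>x. cinv d (cmap d (\<Phi> x)))"
      by (rule continuous_on_compose2[OF continuous_cinv[OF w(2)]]) (use w in auto)
    then have "continuous_on W \<Phi>"
      by (rule continuous_on_eq) (use w in \<open>auto simp: cinv_cmap image_subset_iff\<close>)
    then show ?thesis using w by (simp add: continuous_on_eq_continuous_at)
  qed
  then show cont: "continuous_on UNIV \<Phi>" by (simp add: continuous_at_imp_continuous_on)
  fix c' d' assume c': "c' \<in> A" and d': "d' \<in> A"
  show "smooth_on (cmap c' ` (cdom c' \<inter> \<Phi> -` cdom d')) (cmap d' \<circ> \<Phi> \<circ> cinv c')"
  proof (rule smooth_on_local)
    fix y assume "y \<in> cmap c' ` (cdom c' \<inter> \<Phi> -` cdom d')"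
    then obtain x where x: "y = cmap c' x" "x \<in> cdom c'" "\<Phi> x \<in> cdom d'" by blast
    obtain c d W where w: "c \<in> A" "d \<in> A" "open W" "x \<in> W" "W \<subseteq> cdom c" "\<Phi> ` W \<subseteq> cdom d"
      and sm: "smooth_on (cmap c ` W) (cmap d \<circ> \<Phi> \<circ> cinv c)" using loc[of x] by blast
    define Z where "Z = W \<inter> cdom c' \<inter> \<Phi> -` cdom d'"
    have oZ: "open Z" unfolding Z_def
      using w c' d' cont open_cdom by (intro open_Int open_vimage) auto
    have Zc: "Z \<subseteq> cdom c'" "Z \<subseteq> cdom c" "Z \<subseteq> W" using w by (auto simp: Z_def)
    have Zd: "\<Phi> ` Z \<subseteq> cdom d \<inter> cdom d'" using w by (auto simp: Z_def)
    have oU: "open (cmap c' ` Z)" by (rule open_cmap_image[OF c' oZ Zc(1)])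
    have oW: "open (cmap c ` W)" by (rule open_cmap_image[OF w(1,3,5)])
    have oD: "open (cmap d ` (cdom d \<inter> cdom d'))"
      using w d' by (intro open_cmap_image) (auto simp: open_cdom open_Int)
    have s1: "smooth_on (cmap c' ` Z) (\<lambda>y. (cmap c \<circ> cinv c') y)"
      by (rule smooth_on_subset[OF smooth_transition[OF c' w(1)]]) (use Zc in auto)
    have s2: "smooth_on (cmap c' ` Z) (\<lambda>y. (cmap d \<circ> \<Phi> \<circ> cinv c) ((cmap c \<circ> cinv c') y))"
      by (rule smooth_on_compose[OF oU oW _ s1 sm]) (use Zc c' in \<open>auto simp: cinv_cmap subset_iff\<close>)
    have s3: "smooth_on (cmap c' ` Z) (\<lambda>y. (cmap d' \<circ> cinv d) ((cmap d \<circ> \<Phi> \<circ> cinv c) ((cmap c \<circ> cinv c') y)))"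
      by (rule smooth_on_compose[OF oU oD _ s2 smooth_transition[OF w(2) d']])
        (use Zc Zd c' w(1) in \<open>auto simp: cinv_cmap image_subset_iff subset_iff\<close>)
    have "smooth_on (cmap c' ` Z) (cmap d' \<circ> \<Phi> \<circ> cinv c')"
      by (rule smooth_on_cong_imp[OF oU _ s3])
        (use Zc Zd c' w(1,2) in \<open>auto simp: cinv_cmap image_subset_iff subset_iff\<close>)
    moreover have "y \<in> cmap c' ` Z" using x w by (auto simp: Z_def)
    ultimately show "\<exists>U. open U \<and> y \<in> U \<and> smooth_on U (cmap d' \<circ> \<Phi> \<circ> cinv c')" using oU by blast
  qed
qed

lemma smooth_map_local:
  assumes \<Phi>: "smooth_map A \<Phi>"
  obtains c d W where "c \<in> A" "d \<in> A" "open W" "x \<in> W" "W \<subseteq> cdom c" "\<Phi> ` W \<subseteq> cdom d"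
    "smooth_on (cmap c ` W) (cmap d \<circ> \<Phi> \<circ> cinv c)"
proof -
  obtain c where c: "c \<in> A" "x \<in> cdom c" using ex_chart by blast
  obtain d where d: "d \<in> A" "\<Phi> x \<in> cdom d" using ex_chart by blast
  show thesis
  proof (rule that[OF c(1) d(1), of "cdom c \<inter> \<Phi> -` cdom d"])
    show "open (cdom c \<inter> \<Phi> -` cdom d)"
      using \<Phi> open_cdom c d by (intro open_Int open_vimage) (auto simp: smooth_map_def)
    show "smooth_on (cmap c ` (cdom c \<inter> \<Phi> -` cdom d)) (cmap d \<circ> \<Phi> \<circ> cinv c)"
      using \<Phi> c d by (simp add: smooth_map_def)
  qed (use c d in auto)
qed

lemma smooth_map_open_preimage:
  assumes \<Phi>: "smooth_map A \<Phi>" and "c \<in> A" "d \<in> A"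
  shows "open (cdom c \<inter> \<Phi> -` cdom d)"
  using \<Phi> open_cdom assms(2,3) by (intro open_Int open_vimage) (auto simp: smooth_map_def)

lemma smooth_mapD:
  "smooth_map A \<Phi> \<Longrightarrow> c \<in> A \<Longrightarrow> d \<in> A \<Longrightarrow> smooth_on (cmap c ` (cdom c \<inter> \<Phi> -` cdom d)) (cmap d \<circ> \<Phi> \<circ> cinv c)"
  by (simp add: smooth_map_def)

lemma smooth_map_id: "smooth_map A (\<lambda>x. x)"
proof (rule smooth_map_localI)
  fix x
  obtain c where c: "c \<in> A" "x \<in> cdom c" using ex_chart by blast
  have "smooth_on (cmap c ` cdom c) (cmap c \<circ> (\<lambda>x. x) \<circ> cinv c)"
    using smooth_transition[OF c(1) c(1)] by (simp add: comp_def)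
  then show "\<exists>c d W. c \<in> A \<and> d \<in> A \<and> open W \<and> x \<in> W \<and> W \<subseteq> cdom c \<and> (\<lambda>x. x) ` W \<subseteq> cdom d \<and>
    smooth_on (cmap c ` W) (cmap d \<circ> (\<lambda>x. x) \<circ> cinv c)"
    using c by (intro exI[of _ c] exI[of _ "cdom c"]) (simp add: open_cdom)
qed

lemma smooth_map_comp:
  assumes \<Phi>: "smooth_map A \<Phi>" and \<Psi>: "smooth_map A \<Psi>"
  shows "smooth_map A (\<Psi> \<circ> \<Phi>)"
proof (rule smooth_map_localI)
  fix x
  obtain c where c: "c \<in> A" "x \<in> cdom c" using ex_chart by blast
  obtain d where d: "d \<in> A" "\<Phi> x \<in> cdom d" using ex_chart by blast
  obtain e where e: "e \<in> A" "\<Psi> (\<Phi> x) \<in> cdom e" using ex_chart by blast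
  define W where "W = (cdom c \<inter> \<Phi> -` cdom d) \<inter> \<Phi> -` (cdom d \<inter> \<Psi> -` cdom e)"
  have oW: "open W" unfolding W_def
    using \<Phi> by (intro open_Int open_vimage smooth_map_open_preimage c d e assms) (auto simp: smooth_map_def open_cdom c)
  have Wc: "W \<subseteq> cdom c" and We: "(\<Psi> \<circ> \<Phi>) ` W \<subseteq> cdom e" by (auto simp: W_def)
  have o1: "open (cmap c ` W)" by (rule open_cmap_image[OF c(1) oW Wc])
  have o2: "open (cmap d ` (cdom d \<inter> \<Psi> -` cdom e))"
    by (rule open_cmap_image[OF d(1) smooth_map_open_preimage[OF \<Psi> d(1) e(1)]]) simp
  have s1: "smooth_on (cmap c ` W) (cmap d \<circ> \<Phi> \<circ> cinv c)"
    by (rule smooth_on_subset[OF smooth_mapD[OF \<Phi> c(1) d(1)]]) (auto simp: W_def)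
  have s2: "smooth_on (cmap c ` W) (\<lambda>y. (cmap e \<circ> \<Psi> \<circ> cinv d) ((cmap d \<circ> \<Phi> \<circ> cinv c) y))"
    by (rule smooth_on_compose[OF o1 o2 _ s1 smooth_mapD[OF \<Psi> d(1) e(1)]])
      (auto simp: W_def cinv_cmap c)
  have "smooth_on (cmap c ` W) (cmap e \<circ> (\<Psi> \<circ> \<Phi>) \<circ> cinv c)"
    by (rule smooth_on_cong_imp[OF o1 _ s2]) (auto simp: W_def cinv_cmap c d)
  then show "\<exists>c d W. c \<in> A \<and> d \<in> A \<and> open W \<and> x \<in> W \<and> W \<subseteq> cdom c \<and> (\<Psi> \<circ> \<Phi>) ` W \<subseteq> cdom d \<and>
    smooth_on (cmap c ` W) (cmap d \<circ> (\<Psi> \<circ> \<Phi>) \<circ> cinv c)"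
    using c d e oW Wc We by (intro exI[of _ c] exI[of _ e] exI[of _ W]) (auto simp: W_def)
qed

lemma smooth_diffeomorphism_id: "smooth_diffeomorphism A (\<lambda>x. x)"
proof -
  have "inv (\<lambda>x::'m. x) = (\<lambda>x. x)" by (rule inv_equality) auto
  then show ?thesis using smooth_map_id by (simp add: smooth_diffeomorphism_def bij_def)
qed

lemma smooth_diffeomorphism_comp:
  "smooth_diffeomorphism A \<Phi> \<Longrightarrow> smooth_diffeomorphism A \<Psi> \<Longrightarrow> smooth_diffeomorphism A (\<Psi> \<circ> \<Phi>)"
  unfolding smooth_diffeomorphism_def by (simp add: bij_comp smooth_map_comp o_inv_distrib)

lemma smooth_function_localI:
  assumes "\<And>x. \<exists>d W. d \<in> A \<and> open W \<and> x \<in> W \<and> W \<subseteq> cdom d \<and> smooth_on (cmap d ` W) (f \<circ> cinv d)"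
  shows "smooth_function A f"
  unfolding smooth_function_def
proof (intro ballI smooth_on_local)
  fix c y assume c: "c \<in> A" and "y \<in> cmap c ` cdom c"
  then obtain x where x: "y = cmap c x" "x \<in> cdom c" by blast
  obtain d W where w: "d \<in> A" "open W" "x \<in> W" "W \<subseteq> cdom d" and sm: "smooth_on (cmap d ` W) (f \<circ> cinv d)"
    using assms by blast
  define Z where "Z = W \<inter> cdom c"
  have o1: "open (cmap c ` Z)"
    unfolding Z_def using w open_cdom[OF c] by (intro open_cmap_image[OF c]) auto
  have o2: "open (cmap d ` W)" by (rule open_cmap_image[OF w(1,2,4)])
  have s1: "smooth_on (cmap c ` Z) (cmap d \<circ> cinv c)"
    by (rule smooth_on_subset[OF smooth_transition[OF c w(1)]]) (use w in \<open>auto simp: Z_def\<close>)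
  have s2: "smooth_on (cmap c ` Z) (\<lambda>y. (f \<circ> cinv d) ((cmap d \<circ> cinv c) y))"
    by (rule smooth_on_compose[OF o1 o2 _ s1 sm]) (auto simp: Z_def cinv_cmap c)
  have "smooth_on (cmap c ` Z) (f \<circ> cinv c)"
    by (rule smooth_on_cong_imp[OF o1 _ s2]) (use w in \<open>auto simp: Z_def cinv_cmap c subset_iff\<close>)
  then show "\<exists>U. open U \<and> y \<in> U \<and> smooth_on U (f \<circ> cinv c)"
    using o1 x w by (intro exI[of _ "cmap c ` Z"]) (auto simp: Z_def)
qed

lemma smooth_function_const: "smooth_function A (\<lambda>x. k)"
  by (simp add: smooth_function_def comp_def smooth_on_const open_crange)

lemma smooth_function_add: "smooth_function A f \<Longrightarrow> smooth_function A h \<Longrightarrow> smooth_function A (\<lambda>x. f x + h x)"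
  by (simp add: smooth_function_def comp_def smooth_on_add open_crange)

lemma smooth_function_cmult:
  assumes "smooth_function A f"
  shows "smooth_function A (\<lambda>x. k * f x)"
  unfolding smooth_function_def comp_def
proof
  fix c assume c: "c \<in> A"
  have "smooth_on (cmap c ` cdom c) (\<lambda>y. k *\<^sub>R f (cinv c y))"
    by (rule smooth_on_scaleR[OF open_crange[OF c] smooth_on_const[OF open_crange[OF c]]])
      (use assms c in \<open>simp add: smooth_function_def comp_def\<close>)
  then show "smooth_on (cmap c ` cdom c) (\<lambda>y. k * f (cinv c y))" by simp
qed

lemma smooth_function_sum:
  "(\<And>i. i \<in> I \<Longrightarrow> smooth_function A (f i)) \<Longrightarrow> smooth_function A (\<lambda>x. \<Sum>i\<in>I. f i x)"
  by (induction I rule: infinite_finite_induct) (auto simp: smooth_function_const smooth_function_add)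

lemma smooth_function_comp:
  assumes f: "smooth_function A f" and \<Phi>: "smooth_map A \<Phi>"
  shows "smooth_function A (\<lambda>x. f (\<Phi> x))"
proof (rule smooth_function_localI)
  fix x
  obtain c d W where w: "c \<in> A" "d \<in> A" "open W" "x \<in> W" "W \<subseteq> cdom c" "\<Phi> ` W \<subseteq> cdom d"
    and sm: "smooth_on (cmap c ` W) (cmap d \<circ> \<Phi> \<circ> cinv c)" by (rule smooth_map_local[OF \<Phi>])
  have o1: "open (cmap c ` W)" by (rule open_cmap_image[OF w(1,3,5)])
  have fd: "smooth_on (cmap d ` cdom d) (f \<circ> cinv d)" using f w by (simp add: smooth_function_def)
  have s2: "smooth_on (cmap c ` W) (\<lambda>y. (f \<circ> cinv d) ((cmap d \<circ> \<Phi> \<circ> cinv c) y))"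
    by (rule smooth_on_compose[OF o1 open_crange[OF w(2)] _ sm fd])
      (use w in \<open>auto simp: cinv_cmap subset_iff image_subset_iff\<close>)
  have "smooth_on (cmap c ` W) ((\<lambda>x. f (\<Phi> x)) \<circ> cinv c)"
    by (rule smooth_on_cong_imp[OF o1 _ s2]) (use w in \<open>auto simp: cinv_cmap subset_iff image_subset_iff\<close>)
  then show "\<exists>d W. d \<in> A \<and> open W \<and> x \<in> W \<and> W \<subseteq> cdom d \<and> smooth_on (cmap d ` W) ((\<lambda>x. f (\<Phi> x)) \<circ> cinv d)"
    using w by blast
qed

subsection \<open>Extending maps and functions supported in a chart\<close>

definition extend_map where "extend_map c T x = (if x \<in> cdom c then cinv c (T (cmap c x)) else x)"

definition extend_fun where "extend_fun c \<theta> x = (if x \<in> cdom c then \<theta> (cmap c x) else (0::real))"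

text \<open>A compact set in a Hausdorff space is closed. Therefore a point outside the chart domain
  has a neighbourhood missing the ball, on which an extended map or function is trivial; this yields
  smoothness of extensions across the boundary of the chart domain.\<close>

lemma closed_chart_cball:
  assumes "c \<in> A" "cball a r \<subseteq> cmap c ` cdom c"
  shows "closed (cinv c ` cball a r)"
  by (intro compact_imp_closed compact_continuous_image compact_cball
      continuous_on_subset[OF continuous_cinv[OF assms(1)] assms(2)])

lemma chart_cball_iff:
  assumes "c \<in> A" "x \<in> cdom c" "Y \<subseteq> cmap c ` cdom c"
  shows "x \<in> cinv c ` Y \<longleftrightarrow> cmap c x \<in> Y"
  using assms by (simp add: cinv_image_eq)

lemma smooth_function_extend_fun:
  assumes c: "c \<in> A" and sub: "cball a r \<subseteq> cmap c ` cdom c" and \<theta>: "smooth_on UNIV \<theta>"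
    and out: "\<forall>y. y \<notin> ball a r \<longrightarrow> \<theta> y = 0"
  shows "smooth_function A (extend_fun c \<theta>)"
proof (rule smooth_function_localI)
  fix x
  show "\<exists>d W. d \<in> A \<and> open W \<and> x \<in> W \<and> W \<subseteq> cdom d \<and> smooth_on (cmap d ` W) (extend_fun c \<theta> \<circ> cinv d)"
  proof (cases "x \<in> cdom c")
    case True
    have "smooth_on (cmap c ` cdom c) (extend_fun c \<theta> \<circ> cinv c)"
      by (rule smooth_on_cong_imp[OF open_crange[OF c] _ smooth_on_subset[OF \<theta>]])
        (auto simp: extend_fun_def cinv_cmap c)
    then show ?thesis using True c open_cdom by blast
  next
    case False
    obtain d where d: "d \<in> A" "x \<in> cdom d" using ex_chart by blast
    define W where "W = cdom d - cinv c ` cball a r"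
    have oW: "open W" unfolding W_def
      by (intro open_Diff open_cdom d closed_chart_cball c sub)
    have xW: "x \<in> W" using d False cinv_image_eq[OF c sub] by (auto simp: W_def)
    have o1: "open (cmap d ` W)" by (rule open_cmap_image[OF d(1) oW]) (auto simp: W_def)
    have z: "extend_fun c \<theta> z = 0" if "z \<in> W" for z
    proof (cases "z \<in> cdom c")
      case True
      then have "cmap c z \<notin> cball a r" using that chart_cball_iff[OF c True sub] by (simp add: W_def)
      then have "cmap c z \<notin> ball a r" using ball_subset_cball by blast
      then show ?thesis by (simp add: extend_fun_def out)
    qed (simp add: extend_fun_def)
    have "smooth_on (cmap d ` W) (extend_fun c \<theta> \<circ> cinv d)"
      by (rule smooth_on_cong_imp[OF o1 _ smooth_on_const[OF o1, of 0]])
        (use z in \<open>auto simp: cinv_cmap d W_def\<close>)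
    then show ?thesis using d oW xW by (intro exI[of _ d] exI[of _ W]) (auto simp: W_def)
  qed
qed

text \<open>If \<open>T y\<close> lay outside the ball, \<open>T\<close> would fix it, and
  injectivity would give \<open>T y = y\<close>.\<close>

lemma rdiffeo_cball:
  assumes T: "rdiffeo T T'" and out: "\<forall>y. y \<notin> ball a r \<longrightarrow> T y = y"
  shows "\<forall>y. y \<notin> ball a r \<longrightarrow> T' y = y" "\<forall>y. y \<in> ball a r \<longrightarrow> T y \<in> ball a r"
proof -
  show "\<forall>y. y \<notin> ball a r \<longrightarrow> T' y = y" using T out unfolding rdiffeo_def by metis
  have "T y \<in> ball a r" if "y \<in> ball a r" for y
  proof (rule ccontr)
    assume "T y \<notin> ball a r"
    then have "T (T y) = T y" using out by blast
    then have "T y = y" using T unfolding rdiffeo_def by metis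
    then show False using \<open>T y \<notin> ball a r\<close> that by simp
  qed
  then show "\<forall>y. y \<in> ball a r \<longrightarrow> T y \<in> ball a r" by blast
qed

text \<open>Stated for a map instead of a diffeomorphism so that it can be applied to
  \<open>T\<close> and to its inverse alike.\<close>

lemma extend_map_smooth:
  assumes c: "c \<in> A" and sub: "cball a r \<subseteq> cmap c ` cdom c" and T: "smooth_on UNIV T"
    and out: "\<forall>y. y \<notin> ball a r \<longrightarrow> T y = y" and into: "\<forall>y. y \<in> ball a r \<longrightarrow> T y \<in> ball a r"
  shows "smooth_map A (extend_map c T)"
proof (rule smooth_map_localI)
  fix x
  have TV: "T y \<in> cmap c ` cdom c" if "y \<in> cmap c ` cdom c" for y
    using that out into sub ball_subset_cball[of a r] by (cases "y \<in> ball a r") blast+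
  show "\<exists>d e W. d \<in> A \<and> e \<in> A \<and> open W \<and> x \<in> W \<and> W \<subseteq> cdom d \<and> extend_map c T ` W \<subseteq> cdom e \<and>
    smooth_on (cmap d ` W) (cmap e \<circ> extend_map c T \<circ> cinv d)"
  proof (cases "x \<in> cdom c")
    case True
    have im: "extend_map c T ` cdom c \<subseteq> cdom c"
      using TV cinv_in[OF c] by (auto simp: extend_map_def)
    have "smooth_on (cmap c ` cdom c) (cmap c \<circ> extend_map c T \<circ> cinv c)"
      by (rule smooth_on_cong_imp[OF open_crange[OF c] _ smooth_on_subset[OF T]])
        (use TV in \<open>auto simp: extend_map_def cinv_cmap cmap_cinv c\<close>)
    then show ?thesis using True c open_cdom[OF c] im by blast
  next
    case False
    obtain d where d: "d \<in> A" "x \<in> cdom d" using ex_chart by blast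
    define W where "W = cdom d - cinv c ` cball a r"
    have oW: "open W" unfolding W_def
      by (intro open_Diff open_cdom d closed_chart_cball c sub)
    have xW: "x \<in> W" using d False cinv_image_eq[OF c sub] by (auto simp: W_def)
    have o1: "open (cmap d ` W)" by (rule open_cmap_image[OF d(1) oW]) (auto simp: W_def)
    have z: "extend_map c T z = z" if "z \<in> W" for z
    proof (cases "z \<in> cdom c")
      case True
      then have "cmap c z \<notin> cball a r" using that chart_cball_iff[OF c True sub] by (simp add: W_def)
      then have "cmap c z \<notin> ball a r" using ball_subset_cball by blast
      then show ?thesis using True by (simp add: extend_map_def out cinv_cmap c)
    qed (simp add: extend_map_def)
    have "smooth_on (cmap d ` W) (cmap d \<circ> extend_map c T \<circ> cinv d)"
      by (rule smooth_on_cong_imp[OF o1 _ smooth_on_id[OF o1]])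
        (use z in \<open>auto simp: cinv_cmap d W_def\<close>)
    moreover have "extend_map c T ` W \<subseteq> cdom d" using z by (auto simp: W_def)
    ultimately show ?thesis using d oW xW by (intro exI[of _ d] exI[of _ W]) (auto simp: W_def)
  qed
qed

lemma extend_map_diffeomorphism:
  assumes c: "c \<in> A" and sub: "cball a r \<subseteq> cmap c ` cdom c" and T: "rdiffeo T T'"
    and out: "\<forall>y. y \<notin> ball a r \<longrightarrow> T y = y"
  shows "smooth_diffeomorphism A (extend_map c T)"
    and "\<And>x. x \<notin> cinv c ` cball a r \<Longrightarrow> extend_map c T x = x"
    and "\<And>x. x \<in> cinv c ` cball a r \<Longrightarrow> extend_map c T x \<in> cinv c ` cball a r"
proof -
  have T': "rdiffeo T' T" using T by (auto simp: rdiffeo_def)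
  note o = rdiffeo_cball[OF T out]
  note o' = rdiffeo_cball[OF T' o(1)]
  have TV: "T y \<in> cmap c ` cdom c" if "y \<in> cmap c ` cdom c" for y
    using that out o(2) sub ball_subset_cball[of a r] by (cases "y \<in> ball a r") fastforce+
  have TV': "T' y \<in> cmap c ` cdom c" if "y \<in> cmap c ` cdom c" for y
    using that o(1) o'(2) sub ball_subset_cball[of a r] by (cases "y \<in> ball a r") fastforce+
  have 1: "extend_map c T' (extend_map c T x) = x" for x
    using TV c T by (auto simp: extend_map_def cinv_in cmap_cinv cinv_cmap rdiffeo_def)
  have 2: "extend_map c T (extend_map c T' x) = x" for x
    using TV' c T by (auto simp: extend_map_def cinv_in cmap_cinv cinv_cmap rdiffeo_def)
  have inv: "inv (extend_map c T) = extend_map c T'" by (rule inv_equality[OF 1 2])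
  have "bij (extend_map c T)" using 1 2 by (metis bijI')
  moreover have "smooth_map A (extend_map c T)"
    by (rule extend_map_smooth[OF c sub _ out o(2)]) (use T in \<open>simp add: rdiffeo_def\<close>)
  moreover have "smooth_map A (extend_map c T')"
    by (rule extend_map_smooth[OF c sub _ o(1) o'(2)]) (use T in \<open>simp add: rdiffeo_def\<close>)
  ultimately show "smooth_diffeomorphism A (extend_map c T)" by (simp add: smooth_diffeomorphism_def inv)
  show "extend_map c T x = x" if "x \<notin> cinv c ` cball a r" for x
  proof (cases "x \<in> cdom c")
    case True
    then have "cmap c x \<notin> cball a r" using that chart_cball_iff[OF c True sub] by simp
    then have "cmap c x \<notin> ball a r" using ball_subset_cball by blast
    then show ?thesis using True by (simp add: extend_map_def out cinv_cmap c)
  qed (simp add: extend_map_def)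
  show "extend_map c T x \<in> cinv c ` cball a r" if x: "x \<in> cinv c ` cball a r" for x
  proof -
    have xc: "x \<in> cdom c" "cmap c x \<in> cball a r" using x cinv_image_eq[OF c sub] by auto
    have "T (cmap c x) \<in> cball a r"
    proof (cases "cmap c x \<in> ball a r")
      case True
      then show ?thesis using o(2) ball_subset_cball by blast
    next
      case False
      then show ?thesis using out xc(2) by simp
    qed
    then show ?thesis using xc by (simp add: extend_map_def)
  qed
qed

text \<open>The extended maps are composed one by one. Each preserves its closed ball and is the
  identity elsewhere, so disjointness lets at most one factor move a given point.\<close>

lemma glue_diffeomorphisms:
  assumes "finite F"
    and "\<And>i. i \<in> F \<Longrightarrow> c i \<in> A \<and> cball (a i) (r i) \<subseteq> cmap (c i) ` cdom (c i) \<and> rdiffeo (T i) (T' i) \<and>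
      (\<forall>y. y \<notin> ball (a i) (r i) \<longrightarrow> T i y = y)"
    and "\<And>i j. i \<in> F \<Longrightarrow> j \<in> F \<Longrightarrow> i \<noteq> j \<Longrightarrow>
      cinv (c i) ` cball (a i) (r i) \<inter> cinv (c j) ` cball (a j) (r j) = {}"
  shows "\<exists>\<Phi>. smooth_diffeomorphism A \<Phi> \<and>
    (\<forall>i\<in>F. \<forall>x\<in>cinv (c i) ` cball (a i) (r i). \<Phi> x = extend_map (c i) (T i) x) \<and>
    (\<forall>x. x \<notin> (\<Union>i\<in>F. cinv (c i) ` cball (a i) (r i)) \<longrightarrow> \<Phi> x = x)"
  using assms
proof (induction F rule: finite_induct)
  case empty
  then show ?case using smooth_diffeomorphism_id by auto
next
  case (insert j F)
  obtain \<Phi> where \<Phi>: "smooth_diffeomorphism A \<Phi>"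
    "\<And>i x. i \<in> F \<Longrightarrow> x \<in> cinv (c i) ` cball (a i) (r i) \<Longrightarrow> \<Phi> x = extend_map (c i) (T i) x"
    "\<And>x. x \<notin> (\<Union>i\<in>F. cinv (c i) ` cball (a i) (r i)) \<Longrightarrow> \<Phi> x = x"
    using insert.IH insert.prems by (metis (no_types, lifting) insertCI)
  have j: "c j \<in> A" "cball (a j) (r j) \<subseteq> cmap (c j) ` cdom (c j)" "rdiffeo (T j) (T' j)"
    "\<forall>y. y \<notin> ball (a j) (r j) \<longrightarrow> T j y = y" using insert.prems(1)[of j] by auto
  note e = extend_map_diffeomorphism[OF j]
  have dj: "cinv (c i) ` cball (a i) (r i) \<inter> cinv (c j) ` cball (a j) (r j) = {}" if "i \<in> F" for i
    using insert.prems(2)[of i j] insert.hyps(2) that by auto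
  show ?case
  proof (intro exI conjI ballI allI impI)
    show "smooth_diffeomorphism A (\<Phi> \<circ> extend_map (c j) (T j))"
      by (rule smooth_diffeomorphism_comp[OF e(1) \<Phi>(1)])
    show "(\<Phi> \<circ> extend_map (c j) (T j)) x = extend_map (c i) (T i) x"
      if i: "i \<in> insert j F" and x: "x \<in> cinv (c i) ` cball (a i) (r i)" for i x
    proof (cases "i = j")
      case True
      then have "extend_map (c j) (T j) x \<in> cinv (c j) ` cball (a j) (r j)" using e(3) x by simp
      then have "extend_map (c j) (T j) x \<notin> (\<Union>i\<in>F. cinv (c i) ` cball (a i) (r i))" using dj by fastforce
      then show ?thesis using \<Phi>(3) True by simp
    next
      case False
      then have "i \<in> F" using i by simp
      then have "x \<notin> cinv (c j) ` cball (a j) (r j)" using x dj by blast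
      then show ?thesis using e(2) \<Phi>(2)[OF \<open>i \<in> F\<close> x] by simp
    qed
    show "(\<Phi> \<circ> extend_map (c j) (T j)) x = x"
      if x: "x \<notin> (\<Union>i\<in>insert j F. cinv (c i) ` cball (a i) (r i))" for x
      using x e(2)[of x] \<Phi>(3)[of x] by simp
  qed
qed

end

subsection \<open>Packing by chart balls\<close>

context compact_riemannian_manifold
begin

text \<open>
  The open balls of the Vitali covering are shrunk to pairs of concentric closed balls of radii
  \<open>s < r\<close>, so that the balls of radius \<open>r\<close> stay disjoint while those of radius \<open>s\<close> still fill
  the open set up to small measure.
\<close>

lemma chart_packing:
  assumes c: "c \<in> A" and Q: "open Q" "Q \<subseteq> cdom c" and \<epsilon>: "\<epsilon> > 0"
    and R: "\<And>a. a \<in> cmap c ` cdom c \<Longrightarrow> 0 < R a"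
  shows "\<exists>F. finite F \<and> (\<forall>(a, s, r)\<in>F. 0 < s \<and> s < r \<and> r < R a \<and> cball a r \<subseteq> cmap c ` Q) \<and>
    (\<forall>(a, s, r)\<in>F. \<forall>(a', s', r')\<in>F. (a, s, r) \<noteq> (a', s', r') \<longrightarrow> cball a r \<inter> cball a' r' = {}) \<and>
    measure \<mu> (Q - (\<Union>(a, s, r)\<in>F. cinv c ` cball a s)) < \<epsilon>"
proof -
  interpret finite_measure \<mu> by (rule finite_measure_\<mu>)
  define Y where "Y = cmap c ` Q"
  have oY: "open Y" unfolding Y_def by (rule open_cmap_image[OF c Q])
  have YV: "Y \<subseteq> cmap c ` cdom c" unfolding Y_def using Q(2) by blast
  define K where "K = {(a, r). 0 < r \<and> r < R a \<and> cball a r \<subseteq> Y}"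
  have "\<exists>i. i \<in> K \<and> x \<in> ball (fst i) (snd i) \<and> snd i < d" if x: "x \<in> Y" "0 < d" for x d
  proof -
    obtain e where e: "e > 0" "cball x e \<subseteq> Y" using oY x open_contains_cball by blast
    define r where "r = min e (min (R x) d) / 2"
    have r: "0 < r" "r < R x" "r < d" "r \<le> e"
      using e(1) x R[of x] YV by (auto simp: r_def min_def)
    have "cball x r \<subseteq> Y" using e(2) r(4) subset_cball[of r e x] by blast
    then show ?thesis using r by (intro exI[of _ "(x, r)"]) (simp add: K_def)
  qed
  then obtain C where C: "countable C" "C \<subseteq> K"
    "pairwise (\<lambda>i j. disjnt (ball (fst i) (snd i)) (ball (fst j) (snd j))) C"
    "negligible (Y - (\<Union>i\<in>C. ball (fst i) (snd i)))"
    by (rule Vitali_covering_theorem_balls[of Y K fst snd]) blast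
  have CK: "0 < snd i" "snd i < R (fst i)" "cball (fst i) (snd i) \<subseteq> Y" if "i \<in> C" for i
    using subsetD[OF C(2) that] by (simp_all add: K_def split_beta)
  define idx where "idx = to_nat_on C"
  have idx: "inj_on idx C" unfolding idx_def by (rule inj_on_to_nat_on[OF C(1)])
  define Cn where "Cn n = {i \<in> C. idx i < n}" for n
  have finC: "finite (Cn n)" for n
  proof (rule finite_imageD)
    show "finite (idx ` Cn n)" by (rule finite_subset[of _ "{..<n}"]) (auto simp: Cn_def)
    show "inj_on idx (Cn n)" by (rule inj_on_subset[OF idx]) (auto simp: Cn_def)
  qed
  \<comment> \<open>A single n governs both the number of balls kept in \<open>Cn n\<close> and
    their shrinking, so that the sets \<open>B n\<close> exhaust the union of the Vitali balls. The
    offset 2 makes \<open>q 0\<close> positive.\<close>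
  define q where "q n = 1 - 1 / (real n + 2)" for n
  have q: "0 < q n" "q n < 1" "q n < q (Suc n)" for n by (auto simp: q_def field_simps)
  have qlim: "q \<longlonglongrightarrow> 1 - 0"
  proof -
    have "q = (\<lambda>n. 1 - inverse (real (Suc (Suc n))))" by (simp add: q_def fun_eq_iff divide_inverse add_ac)
    then show ?thesis
      by (simp only:) (intro tendsto_diff tendsto_const LIMSEQ_Suc[OF LIMSEQ_inverse_real_of_nat])
  qed
  have qmono: "q m \<le> q n" if "m \<le> n" for m n using that by (simp add: q_def frac_le)
  define B where "B n = (\<Union>i\<in>Cn n. cball (fst i) (q n * snd i))" for n
  have qr: "0 < q n * snd i" "q n * snd i < q (Suc n) * snd i" "q (Suc n) * snd i < snd i" if "i \<in> C" for i n
    using q[of n] q(2)[of "Suc n"] CK(1)[OF that] by simp_all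
  have cbY: "cball (fst i) (q n * snd i) \<subseteq> Y" if "i \<in> C" for i n
  proof -
    have "q n * snd i \<le> snd i" using qr[OF that, of n] by linarith
    then show ?thesis using CK(3)[OF that] subset_cball by blast
  qed
  have BY: "B n \<subseteq> Y" for n unfolding B_def using cbY by (auto simp: Cn_def)
  have Bb: "B n \<in> sets borel" for n unfolding B_def using finC by auto
  have incB: "incseq B"
  proof (rule monoI)
    fix m n :: nat assume mn: "m \<le> n"
    show "B m \<subseteq> B n"
    proof
      fix y assume "y \<in> B m"
      then obtain i where i: "i \<in> C" "idx i < m" "y \<in> cball (fst i) (q m * snd i)" by (auto simp: B_def Cn_def)
      have "q m * snd i \<le> q n * snd i" using qmono[OF mn] CK(1)[OF i(1)] by simp
      then have "y \<in> cball (fst i) (q n * snd i)" using i(3) by (meson in_mono subset_cball)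
      moreover have "i \<in> Cn n" using i mn by (simp add: Cn_def)
      ultimately show "y \<in> B n" unfolding B_def by blast
    qed
  qed
  have UB: "(\<Union>n. B n) = (\<Union>i\<in>C. ball (fst i) (snd i))"
  proof
    show "(\<Union>n. B n) \<subseteq> (\<Union>i\<in>C. ball (fst i) (snd i))"
    proof
      fix y assume "y \<in> (\<Union>n. B n)"
      then obtain n i where i: "i \<in> C" "y \<in> cball (fst i) (q n * snd i)" by (auto simp: B_def Cn_def)
      then have "y \<in> ball (fst i) (snd i)" using qr[OF i(1), of n] by simp
      then show "y \<in> (\<Union>i\<in>C. ball (fst i) (snd i))" using i(1) by blast
    qed
    show "(\<Union>i\<in>C. ball (fst i) (snd i)) \<subseteq> (\<Union>n. B n)"
    proof
      fix y assume "y \<in> (\<Union>i\<in>C. ball (fst i) (snd i))"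
      then obtain i where i: "i \<in> C" "dist (fst i) y < snd i" by auto
      have "(\<lambda>n. q n * snd i) \<longlonglongrightarrow> (1 - 0) * snd i"
        by (intro tendsto_mult tendsto_const qlim)
      then have "\<forall>\<^sub>F n in sequentially. dist (fst i) y < q n * snd i"
        using i(2) by (intro order_tendstoD(1)) auto
      then have "\<forall>\<^sub>F n in sequentially. dist (fst i) y < q n * snd i \<and> idx i < n"
        using eventually_gt_at_top by (rule eventually_conj)
      then obtain n where "dist (fst i) y < q n * snd i" "idx i < n"
        unfolding eventually_sequentially by blast
      then have "i \<in> Cn n" "y \<in> cball (fst i) (q n * snd i)" using i(1) by (simp_all add: Cn_def)
      then show "y \<in> (\<Union>n. B n)" unfolding B_def by blast
    qed
  qed
  have Ob: "Q \<in> sets borel" using Q by simp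
  have cB: "cinv c ` B n \<in> sets borel" for n
    by (rule borel_cinv_image[OF c Bb]) (use BY YV in blast)
  define D where "D n = Q - cinv c ` B n" for n
  \<comment> \<open>What all \<open>B n\<close> miss is negligible in the chart and hence null for
    \<mu>; since \<mu> is finite, continuity from above makes the leftover measures tend to
    0.\<close>
  have "(\<lambda>n. measure \<mu> (D n)) \<longlonglongrightarrow> measure \<mu> (\<Inter>n. D n)"
  proof (rule finite_Lim_measure_decseq)
    show "range D \<subseteq> sets \<mu>" using Ob cB by (auto simp: D_def)
    show "decseq D" using incB unfolding D_def decseq_def incseq_def by blast
  qed
  moreover have "measure \<mu> (\<Inter>n. D n) = 0"
  proof -
    have Db: "(\<Inter>n. D n) \<in> sets borel" unfolding D_def using Ob cB by (intro sets.countable_INT) auto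
    have DO: "(\<Inter>n. D n) \<subseteq> cdom c" using Q(2) by (auto simp: D_def)
    have "cmap c ` (\<Inter>n. D n) \<subseteq> Y - (\<Union>n. B n)"
    proof
      fix y assume "y \<in> cmap c ` (\<Inter>n. D n)"
      then obtain x where x: "y = cmap c x" "\<And>n. x \<in> D n" by blast
      have xO: "x \<in> Q" using x(2)[of 0] by (simp add: D_def)
      have "y \<notin> B n" for n
      proof
        assume "y \<in> B n"
        then have "cinv c y \<in> cinv c ` B n" by (rule imageI)
        moreover have "cinv c y = x" using x(1) xO Q(2) cinv_cmap[OF c] by blast
        ultimately show False using x(2)[of n] by (simp add: D_def)
      qed
      then show "y \<in> Y - (\<Union>n. B n)" using x(1) xO by (simp add: Y_def)
    qed
    then have "negligible (cmap c ` (\<Inter>n. D n))" using C(4) UB negligible_subset by metis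
    then have "emeasure \<mu> (\<Inter>n. D n) = 0" by (rule emeasure_\<mu>_negligible[OF c Db DO])
    then show ?thesis by (simp add: measure_def)
  qed
  ultimately have "\<forall>\<^sub>F n in sequentially. measure \<mu> (D n) < \<epsilon>" using \<epsilon> by (intro order_tendstoD(2)) auto
  then obtain n where n: "measure \<mu> (D n) < \<epsilon>"
    unfolding eventually_sequentially by blast
  \<comment> \<open>Consecutive factors \<open>q n < q (Suc n) < 1\<close> provide the inner and the
    outer radius.\<close>
  define h where "h i = (fst i, q n * snd i, q (Suc n) * snd i)" for i :: "(real, 'n) vec \<times> real"
  show ?thesis
  proof (intro exI[of _ "h ` Cn n"] conjI)
    show "finite (h ` Cn n)" using finC by simp
    have "0 < q n * snd i \<and> q n * snd i < q (Suc n) * snd i \<and> q (Suc n) * snd i < R (fst i) \<and>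
        cball (fst i) (q (Suc n) * snd i) \<subseteq> cmap c ` Q" if "i \<in> Cn n" for i
    proof -
      have i: "i \<in> C" using that by (simp add: Cn_def)
      show ?thesis using qr[OF i, of n] CK(2)[OF i] cbY[OF i, of "Suc n"] by (simp add: Y_def)
    qed
    then show "\<forall>(a, s, r)\<in>h ` Cn n. 0 < s \<and> s < r \<and> r < R a \<and> cball a r \<subseteq> cmap c ` Q"
      by (auto simp: h_def)
    have disj: "cball (fst i) (q (Suc n) * snd i) \<inter> cball (fst j) (q (Suc n) * snd j) = {}"
      if "i \<in> Cn n" "j \<in> Cn n" "h i \<noteq> h j" for i j
    proof -
      have ij: "i \<in> C" "j \<in> C" "i \<noteq> j" using that by (auto simp: Cn_def)
      then have "disjnt (ball (fst i) (snd i)) (ball (fst j) (snd j))" using C(3) by (simp add: pairwise_def)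
      moreover have "cball (fst i) (q (Suc n) * snd i) \<subseteq> ball (fst i) (snd i)"
        "cball (fst j) (q (Suc n) * snd j) \<subseteq> ball (fst j) (snd j)"
        using qr(3)[OF ij(1), of n] qr(3)[OF ij(2), of n] by auto
      ultimately show ?thesis unfolding disjnt_def by blast
    qed
    then show "\<forall>(a, s, r)\<in>h ` Cn n. \<forall>(a', s', r')\<in>h ` Cn n.
        (a, s, r) \<noteq> (a', s', r') \<longrightarrow> cball a r \<inter> cball a' r' = {}"
      unfolding ball_simps(9) h_def split_conv by blast
    have "(\<Union>(a, s, r)\<in>h ` Cn n. cinv c ` cball a s) = cinv c ` B n"
      by (auto simp: h_def B_def)
    then show "measure \<mu> (Q - (\<Union>(a, s, r)\<in>h ` Cn n. cinv c ` cball a s)) < \<epsilon>"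
      using n by (simp add: D_def)
  qed
qed

text \<open>The entries of a tuple are chart, centre, inner and outer radius. Disjointness is stated
  on the manifold because the balls come from different charts; \<open>R\<close> prescribes how
  small they have to be.\<close>

definition packing where
  "packing R F \<longleftrightarrow> finite F \<and>
    (\<forall>(c, a, s, r)\<in>F. c \<in> A \<and> 0 < s \<and> s < r \<and> r < R c a \<and> cball a r \<subseteq> cmap c ` cdom c) \<and>
    (\<forall>(c, a, s, r)\<in>F. \<forall>(c', a', s', r')\<in>F. (c, a, s, r) \<noteq> (c', a', s', r') \<longrightarrow>
      cinv c ` cball a r \<inter> cinv c' ` cball a' r' = {})"

text \<open>Charts are added one at a time. A new chart is packed only off the closed set
  \<open>out\<close> of outer balls already placed, which keeps all outer balls disjoint; the old
  and the new leftover each receive half of the permitted measure.\<close>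

lemma packing_charts:
  assumes R: "\<And>c a. c \<in> A \<Longrightarrow> a \<in> cmap c ` cdom c \<Longrightarrow> 0 < R c a"
    and D: "finite D" "D \<subseteq> A" and \<epsilon>: "\<epsilon> > 0"
  shows "\<exists>F. packing R F \<and> fst ` F \<subseteq> D \<and>
    measure \<mu> ((\<Union>c\<in>D. cdom c) - (\<Union>(c, a, s, r)\<in>F. cinv c ` cball a s)) < \<epsilon>"
  using D \<epsilon>
proof (induction D arbitrary: \<epsilon> rule: finite_induct)
  case empty
  then show ?case by (intro exI[of _ "{}"]) (simp add: packing_def)
next
  case (insert c D)
  interpret finite_measure \<mu> by (rule finite_measure_\<mu>)
  have c: "c \<in> A" "D \<subseteq> A" using insert.prems by auto
  obtain F where F: "packing R F" "fst ` F \<subseteq> D"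
    "measure \<mu> ((\<Union>c\<in>D. cdom c) - (\<Union>(c, a, s, r)\<in>F. cinv c ` cball a s)) < \<epsilon> / 2"
    using insert.IH[OF c(2), of "\<epsilon> / 2"] insert.prems(2) by auto
  have Fi: "d \<in> A" "0 < s" "s < r" "cball a r \<subseteq> cmap d ` cdom d" "d \<in> D"
    if i: "(d, a, s, r) \<in> F" for d a s r
  proof -
    have "\<forall>(c, a, s, r)\<in>F. c \<in> A \<and> 0 < s \<and> s < r \<and> r < R c a \<and> cball a r \<subseteq> cmap c ` cdom c"
      using F(1) by (simp add: packing_def)
    from bspec[OF this i] show "d \<in> A" "0 < s" "s < r" "cball a r \<subseteq> cmap d ` cdom d" by simp_all
    show "d \<in> D" using imageI[OF i, of fst] F(2) by auto
  qed
  define out where "out = (\<Union>(d, a, s, r)\<in>F. cinv d ` cball a r)"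
  define inn where "inn = (\<Union>(d, a, s, r)\<in>F. cinv d ` cball a s)"
  define U where "U = (\<Union>c\<in>D. cdom c)"
  have finF: "finite F" using F(1) by (simp add: packing_def)
  have clout: "closed out"
    unfolding out_def using finF by (intro closed_UN) (auto intro!: closed_chart_cball Fi)
  have clinn: "closed inn"
    unfolding inn_def
  proof (intro closed_UN finF ballI)
    fix i assume i: "i \<in> F"
    obtain d a s r where e: "i = (d, a, s, r)" by (cases i)
    have "cball a s \<subseteq> cmap d ` cdom d" using Fi[OF i[unfolded e]] subset_cball[of s r a] by auto
    then show "closed (case i of (d, a, s, r) \<Rightarrow> cinv d ` cball a s)"
      using Fi(1)[OF i[unfolded e]] by (simp add: e closed_chart_cball)
  qed
  have outU: "out \<subseteq> U"
  proof
    fix x assume "x \<in> out"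
    then obtain d a s r where e: "(d, a, s, r) \<in> F" "x \<in> cinv d ` cball a r" by (auto simp: out_def)
    then have "x \<in> cdom d" using cinv_image_eq[OF Fi(1)[OF e(1)] Fi(4)[OF e(1)]] by blast
    then show "x \<in> U" using Fi(5)[OF e(1)] by (auto simp: U_def)
  qed
  define Q where "Q = cdom c - out"
  have Q: "open Q" "Q \<subseteq> cdom c" using clout open_cdom[OF c(1)] by (auto simp: Q_def)
  have "\<exists>F'. finite F' \<and> (\<forall>(a, s, r)\<in>F'. 0 < s \<and> s < r \<and> r < R c a \<and> cball a r \<subseteq> cmap c ` Q) \<and>
    (\<forall>(a, s, r)\<in>F'. \<forall>(a', s', r')\<in>F'. (a, s, r) \<noteq> (a', s', r') \<longrightarrow> cball a r \<inter> cball a' r' = {}) \<and>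
    measure \<mu> (Q - (\<Union>(a, s, r)\<in>F'. cinv c ` cball a s)) < \<epsilon> / 2"
    using insert.prems(2) R[OF c(1)] by (intro chart_packing[OF c(1) Q]) auto
  then obtain F' where raw: "finite F'"
    "\<forall>(a, s, r)\<in>F'. 0 < s \<and> s < r \<and> r < R c a \<and> cball a r \<subseteq> cmap c ` Q"
    "\<forall>(a, s, r)\<in>F'. \<forall>(a', s', r')\<in>F'. (a, s, r) \<noteq> (a', s', r') \<longrightarrow> cball a r \<inter> cball a' r' = {}"
    "measure \<mu> (Q - (\<Union>(a, s, r)\<in>F'. cinv c ` cball a s)) < \<epsilon> / 2"
    by (elim exE conjE) (rule that)
  have F'1: "0 < s \<and> s < r \<and> r < R c a \<and> cball a r \<subseteq> cmap c ` Q" if "(a, s, r) \<in> F'" for a s r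
    using bspec[OF raw(2) that] by simp
  have F'2: "cball a r \<inter> cball a' r' = {}"
    if "(a, s, r) \<in> F'" "(a', s', r') \<in> F'" "(a, s, r) \<noteq> (a', s', r')" for a s r a' s' r'
    using bspec[OF raw(3) that(1), unfolded split_conv, THEN bspec, OF that(2), unfolded split_conv] that(3) by blast
  note F' = raw(1) F'1 F'2 raw(4)
  define inn' where "inn' = (\<Union>(a, s, r)\<in>F'. cinv c ` cball a s)"
  have sub': "cball a r \<subseteq> cmap c ` cdom c" if "(a, s, r) \<in> F'" for a s r
    using F'(2)[OF that] Q(2) by blast
  have inO: "cinv c ` cball a r \<subseteq> Q" if i: "(a, s, r) \<in> F'" for a s r
  proof -
    have "cinv c ` cball a r \<subseteq> cinv c ` cmap c ` Q" using F'(2)[OF i] by (intro image_mono) simp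
    also have "\<dots> = Q" using Q(2) by (auto simp: image_image cinv_cmap c subset_iff cong: image_cong)
    finally show ?thesis .
  qed
  have clinn': "closed inn'"
    unfolding inn'_def
  proof (intro closed_UN F'(1) ballI)
    fix i assume i: "i \<in> F'"
    obtain a s r where e: "i = (a, s, r)" by (cases i)
    have "cball a s \<subseteq> cmap c ` cdom c" using F'(2)[OF i[unfolded e]] sub'[OF i[unfolded e]] subset_cball[of s r a] by auto
    then show "closed (case i of (a, s, r) \<Rightarrow> cinv c ` cball a s)"
      using c(1) by (simp add: e closed_chart_cball)
  qed
  define G where "G = F \<union> Pair c ` F'"
  have "packing R G"
    unfolding packing_def
  proof (intro conjI)
    show "finite G" using finF F'(1) by (simp add: G_def)
    show "\<forall>(c, a, s, r)\<in>G. c \<in> A \<and> 0 < s \<and> s < r \<and> r < R c a \<and> cball a r \<subseteq> cmap c ` cdom c"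
      using F(1) F'(2) sub' c(1) unfolding G_def packing_def by fastforce
    have d1: "cinv d ` cball a r \<inter> cinv d' ` cball a' r' = {}"
      if "(d, a, s, r) \<in> F" "(d', a', s', r') \<in> F" "(d, a, s, r) \<noteq> (d', a', s', r')" for d a s r d' a' s' r'
      using F(1) that unfolding packing_def by fast
    have d2: "cinv d ` cball a r \<inter> cinv c ` cball a' r' = {}"
      if "(d, a, s, r) \<in> F" "(a', s', r') \<in> F'" for d a s r a' s' r'
      using inO[OF that(2)] that(1) unfolding Q_def out_def by fast
    have d3: "cinv c ` cball a r \<inter> cinv c ` cball a' r' = {}"
      if t: "(a, s, r) \<in> F'" "(a', s', r') \<in> F'" "(a, s, r) \<noteq> (a', s', r')" for a s r a' s' r'
    proof -
      have "x \<in> cball a r \<inter> cball a' r'" if "cinv c x = cinv c y" "x \<in> cball a r" "y \<in> cball a' r'" for x y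
      proof -
        have "x \<in> cmap c ` cdom c" "y \<in> cmap c ` cdom c" using sub' t that by blast+
        then have "x = y" using that(1) cmap_cinv[OF c(1)] by metis
        then show ?thesis using that by simp
      qed
      then show ?thesis using F'(3)[OF t] by fast
    qed
    show "\<forall>(c, a, s, r)\<in>G. \<forall>(c', a', s', r')\<in>G. (c, a, s, r) \<noteq> (c', a', s', r') \<longrightarrow>
      cinv c ` cball a r \<inter> cinv c' ` cball a' r' = {}"
    proof
      fix i assume i: "i \<in> G"
      obtain d a s r where ie: "i = (d, a, s, r)" by (cases i)
      show "case i of (c, a, s, r) \<Rightarrow> \<forall>(c', a', s', r')\<in>G. (c, a, s, r) \<noteq> (c', a', s', r') \<longrightarrow>
          cinv c ` cball a r \<inter> cinv c' ` cball a' r' = {}"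
        unfolding ie split_conv
      proof
        fix j assume j: "j \<in> G"
        obtain d' a' s' r' where je: "j = (d', a', s', r')" by (cases j)
        have gi: "(d, a, s, r) \<in> F \<or> d = c \<and> (a, s, r) \<in> F'" using i unfolding ie G_def by blast
        have gj: "(d', a', s', r') \<in> F \<or> d' = c \<and> (a', s', r') \<in> F'" using j unfolding je G_def by blast
        have "cinv d ` cball a r \<inter> cinv d' ` cball a' r' = {}" if ne: "(d, a, s, r) \<noteq> (d', a', s', r')"
          using gi gj
        proof (elim disjE conjE)
          assume "(d, a, s, r) \<in> F" "(d', a', s', r') \<in> F"
          then show ?thesis using ne by (rule d1)
        next
          assume "(d, a, s, r) \<in> F" "d' = c" "(a', s', r') \<in> F'"
          then show ?thesis using d2[of d a s r a' s' r'] by (simp only:)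
        next
          assume "d = c" "(a, s, r) \<in> F'" "(d', a', s', r') \<in> F"
          then show ?thesis using d2[of d' a' s' r' a s r] by (simp only: Int_commute)
        next
          assume t: "d = c" "(a, s, r) \<in> F'" "d' = c" "(a', s', r') \<in> F'"
          then have "(a, s, r) \<noteq> (a', s', r')" using ne by simp
          then show ?thesis unfolding t(1,3) by (rule d3[OF t(2,4)])
        qed
        then show "case j of (c', a', s', r') \<Rightarrow> (d, a, s, r) \<noteq> (c', a', s', r') \<longrightarrow>
            cinv d ` cball a r \<inter> cinv c' ` cball a' r' = {}"
          unfolding je split_conv by (rule impI)
      qed
    qed
  qed
  moreover have "fst ` G \<subseteq> insert c D" using F(2) by (auto simp: G_def)
  moreover have "measure \<mu> ((\<Union>c\<in>insert c D. cdom c) - (\<Union>(c, a, s, r)\<in>G. cinv c ` cball a s)) < \<epsilon>"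
  proof -
    have GG: "(\<Union>(c, a, s, r)\<in>G. cinv c ` cball a s) = inn \<union> inn'"
      by (auto simp: G_def inn_def inn'_def)
    have bU: "U \<in> sets borel" unfolding U_def using open_cdom c by (intro borel_open open_UN) auto
    \<comment> \<open>Points of the new chart inside \<open>out\<close> receive no new ball, but
      \<open>out \<subseteq> U\<close>, so those missed by the inner balls are already counted in
      \<open>U - inn\<close>.\<close>
    have "measure \<mu> ((\<Union>c\<in>insert c D. cdom c) - (inn \<union> inn')) \<le> measure \<mu> ((U - inn) \<union> (Q - inn'))"
      by (rule finite_measure_mono)
        (use outU bU clinn clinn' Q in \<open>auto simp: U_def Q_def intro!: borel_closed\<close>)
    also have "\<dots> \<le> measure \<mu> (U - inn) + measure \<mu> (Q - inn')"
      by (rule measure_Un_le) (use bU clinn clinn' Q in auto)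
    also have "\<dots> < \<epsilon>" using F(3) F'(4) by (simp add: U_def inn_def inn'_def)
    finally show ?thesis by (simp add: GG)
  qed
  ultimately show ?case by blast
qed

lemma packing_exists:
  assumes "\<And>c a. c \<in> A \<Longrightarrow> a \<in> cmap c ` cdom c \<Longrightarrow> 0 < R c a" "\<epsilon> > 0"
  shows "\<exists>F. packing R F \<and> measure \<mu> (UNIV - (\<Union>(c, a, s, r)\<in>F. cinv c ` cball a s)) < \<epsilon>"
proof -
  obtain D where D: "D \<subseteq> A" "finite D" "(\<Union>c\<in>D. cdom c) = UNIV" using finite_atlas by blast
  have "\<exists>F. packing R F \<and> fst ` F \<subseteq> D \<and>
      measure \<mu> ((\<Union>c\<in>D. cdom c) - (\<Union>(c, a, s, r)\<in>F. cinv c ` cball a s)) < \<epsilon>"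
    by (rule packing_charts[OF _ D(2,1) assms(2)]) (rule assms(1))
  then show ?thesis unfolding D(3) by blast
qed

end

subsection \<open>Pullbacks in coordinates\<close>

context smooth_manifold
begin

definition dmap where "dmap \<Phi> c d x = frechet_derivative (cmap d \<circ> \<Phi> \<circ> cinv c) (at (cmap c x))"

lemma has_derivative_dmap:
  assumes "smooth_map A \<Phi>" "c \<in> A" "d \<in> A" "x \<in> cdom c" "\<Phi> x \<in> cdom d"
  shows "((cmap d \<circ> \<Phi> \<circ> cinv c) has_derivative dmap \<Phi> c d x) (at (cmap c x))"
  unfolding dmap_def using assms by (intro smooth_on_has_derivative[OF smooth_mapD]) auto

lemma dmap_change_target:
  assumes \<Phi>: "smooth_map A \<Phi>" and c: "c \<in> A" "x \<in> cdom c" and d: "d \<in> A" "\<Phi> x \<in> cdom d"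
    and e: "e \<in> A" "\<Phi> x \<in> cdom e"
  shows "dtr d e (\<Phi> x) (dmap \<Phi> c d x u) = dmap \<Phi> c e x u"
proof -
  have 1: "((cmap d \<circ> \<Phi> \<circ> cinv c) has_derivative dmap \<Phi> c d x) (at (cmap c x))"
    by (rule has_derivative_dmap[OF \<Phi> c(1) d(1) c(2) d(2)])
  have 2: "((cmap e \<circ> cinv d) has_derivative dtr d e (\<Phi> x)) (at ((cmap d \<circ> \<Phi> \<circ> cinv c) (cmap c x)))"
    using has_derivative_transition[OF d(1) e(1) d(2) e(2)] by (simp add: cinv_cmap c)
  have 3: "((\<lambda>y. (cmap e \<circ> cinv d) ((cmap d \<circ> \<Phi> \<circ> cinv c) y)) has_derivative
      (\<lambda>u. dtr d e (\<Phi> x) (dmap \<Phi> c d x u))) (at (cmap c x))"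
    by (rule has_derivative_compose[OF 1 2])
  let ?W = "cdom c \<inter> \<Phi> -` cdom d"
  have "((cmap e \<circ> \<Phi> \<circ> cinv c) has_derivative (\<lambda>u. dtr d e (\<Phi> x) (dmap \<Phi> c d x u))) (at (cmap c x))"
    by (rule has_derivative_transform_within_open[OF 3 open_cmap_image[OF c(1) smooth_map_open_preimage[OF \<Phi> c(1) d(1)]]])
      (use c d in \<open>auto simp: cinv_cmap\<close>)
  then show ?thesis using has_derivative_dmap[OF \<Phi> c(1) e(1) c(2) e(2)] has_derivative_unique by metis
qed

lemma dmap_change_source:
  assumes \<Phi>: "smooth_map A \<Phi>" and c: "c \<in> A" "x \<in> cdom c" and c': "c' \<in> A" "x \<in> cdom c'"
    and e: "e \<in> A" "\<Phi> x \<in> cdom e"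
  shows "dmap \<Phi> c' e x (dtr c c' x u) = dmap \<Phi> c e x u"
proof -
  have 1: "((cmap c' \<circ> cinv c) has_derivative dtr c c' x) (at (cmap c x))"
    by (rule has_derivative_transition[OF c(1) c'(1) c(2) c'(2)])
  have 2: "((cmap e \<circ> \<Phi> \<circ> cinv c') has_derivative dmap \<Phi> c' e x) (at ((cmap c' \<circ> cinv c) (cmap c x)))"
    using has_derivative_dmap[OF \<Phi> c'(1) e(1) c'(2) e(2)] by (simp add: cinv_cmap c)
  have 3: "((\<lambda>y. (cmap e \<circ> \<Phi> \<circ> cinv c') ((cmap c' \<circ> cinv c) y)) has_derivative
      (\<lambda>u. dmap \<Phi> c' e x (dtr c c' x u))) (at (cmap c x))"
    by (rule has_derivative_compose[OF 1 2])
  have o: "open (cmap c ` (cdom c \<inter> cdom c'))"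
    by (rule open_cmap_image[OF c(1) open_Int[OF open_cdom[OF c(1)] open_cdom[OF c'(1)]]]) simp
  have "((cmap e \<circ> \<Phi> \<circ> cinv c) has_derivative (\<lambda>u. dmap \<Phi> c' e x (dtr c c' x u))) (at (cmap c x))"
    by (rule has_derivative_transform_within_open[OF 3 o]) (use c c' in \<open>auto simp: cinv_cmap\<close>)
  then show ?thesis using has_derivative_dmap[OF \<Phi> c(1) e(1) c(2) e(2)] has_derivative_unique by metis
qed

text \<open>\<open>differential\<close> reads the vector in a chart picked by \<open>SOME\<close>;
  the two chain rules for changing source and target charts turn this into an identity for any
  charts.\<close>

lemma differential_tangent_vec:
  assumes \<Phi>: "smooth_map A \<Phi>" and c: "c \<in> A" "x \<in> cdom c" and d: "d \<in> A" "\<Phi> x \<in> cdom d"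
  shows "differential A \<Phi> x (tangent_vec A c x u) = tangent_vec A d (\<Phi> x) (dmap \<Phi> c d x u)"
proof
  fix e
  define c' where "c' = (SOME c. c \<in> A \<and> x \<in> cdom c)"
  have c': "c' \<in> A" "x \<in> cdom c'" using someI[of "\<lambda>c. c \<in> A \<and> x \<in> cdom c" c] c by (auto simp: c'_def)
  have L: "differential A \<Phi> x (tangent_vec A c x u) e
      = (if e \<in> A \<and> \<Phi> x \<in> cdom e then dmap \<Phi> c' e x (tangent_vec A c x u c') else 0)"
    unfolding differential_def dmap_def c'_def[symmetric] Let_def ..
  have t: "tangent_vec A c x u c' = dtr c c' x u" using c' by (simp add: tangent_vec_eq)
  show "differential A \<Phi> x (tangent_vec A c x u) e = tangent_vec A d (\<Phi> x) (dmap \<Phi> c d x u) e"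
  proof (cases "e \<in> A \<and> \<Phi> x \<in> cdom e")
    case True
    then have "differential A \<Phi> x (tangent_vec A c x u) e = dmap \<Phi> c' e x (dtr c c' x u)"
      unfolding L t by simp
    moreover have "tangent_vec A d (\<Phi> x) (dmap \<Phi> c d x u) e = dtr d e (\<Phi> x) (dmap \<Phi> c d x u)"
      using True by (simp add: tangent_vec_eq)
    ultimately show ?thesis
      using True dmap_change_source[OF \<Phi> c c', of e u] dmap_change_target[OF \<Phi> c d, of e u] by simp
  next
    case False
    then have "differential A \<Phi> x (tangent_vec A c x u) e = 0" unfolding L by (simp only: if_False)
    moreover have "tangent_vec A d (\<Phi> x) (dmap \<Phi> c d x u) e = 0"
      unfolding tangent_vec_eq using False by (simp only: if_False)
    ultimately show ?thesis by simp
  qed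
qed

lemma cform_pullback:
  assumes "smooth_map A \<Phi>" "c \<in> A" "x \<in> cdom c" "d \<in> A" "\<Phi> x \<in> cdom d"
  shows "cform (pullback A \<Phi> h) c x u w = cform h d (\<Phi> x) (dmap \<Phi> c d x u) (dmap \<Phi> c d x w)"
  by (simp add: cform_def pullback_def differential_tangent_vec[OF assms])

lemma bilinear_form_on_of_cform:
  assumes c: "c \<in> A" "x \<in> cdom c" and b: "bilinear_form_on UNIV (cform h c x)"
  shows "bilinear_form_on (tangent_space A x) (h x)"
proof -
  have "subspace (tangent_space A x)"
    unfolding range_tangent_vec[OF c, symmetric] by (rule linear_subspace_image[OF linear_tangent_vec[OF c] subspace_UNIV])
  moreover have "(r *\<^sub>R u) c = r *\<^sub>R u c" for r and u :: "('m, 'n) tvec"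
    by (simp add: scaleR_fun_def)
  ultimately show ?thesis
    unfolding bilinear_form_on_def
    by (intro ballI allI) (simp add: tensor_eq_cform[OF c] subspace_add subspace_scale bilinear_form_onD[OF b])
qed

lemma bilinear_pullback:
  assumes \<Phi>: "smooth_map A \<Phi>" and h: "\<And>x. bilinear_form_on (tangent_space A x) (h x)"
  shows "bilinear_form_on (tangent_space A x) (pullback A \<Phi> h x)"
proof -
  obtain c where c: "c \<in> A" "x \<in> cdom c" using ex_chart by blast
  obtain d where d: "d \<in> A" "\<Phi> x \<in> cdom d" using ex_chart by blast
  have l: "linear (dmap \<Phi> c d x)"
    using has_derivative_dmap[OF \<Phi> c(1) d(1) c(2) d(2)] has_derivative_linear by blast
  note b = cform_bilinear[where h=h, OF d h]
  have "bilinear_form_on UNIV (cform (pullback A \<Phi> h) c x)"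
    unfolding bilinear_form_on_def cform_pullback[OF \<Phi> c d] linear_add[OF l] linear_cmul[OF l]
    by (simp add: bilinear_form_onD[OF b])
  then show ?thesis by (rule bilinear_form_on_of_cform[OF c])
qed

lemma continuous_smooth_function:
  assumes "smooth_function A f" "c \<in> A"
  shows "continuous_on (cdom c) f"
proof -
  have "continuous_on (cmap c ` cdom c) (f \<circ> cinv c)"
    by (rule smooth_on_imp_continuous_on) (use assms in \<open>simp add: smooth_function_def\<close>)
  then have "continuous_on (cdom c) (\<lambda>x. (f \<circ> cinv c) (cmap c x))"
    by (rule continuous_on_compose2[OF _ continuous_cmap[OF assms(2)]]) simp
  then show ?thesis by (rule continuous_on_eq) (simp add: cinv_cmap assms)
qed

end

context riemannian_manifold
begin

lemma continuous_components_pullback: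
  assumes \<Phi>: "smooth_map A \<Phi>" and h: "smooth_tensor2 A h" and c: "c \<in> A" and d: "d \<in> A"
  shows "continuous_on (cdom c \<inter> \<Phi> -` cdom d) (\<lambda>x. components A (pullback A \<Phi> h) c x $ i $ j)"
proof -
  let ?W = "cdom c \<inter> \<Phi> -` cdom d"
  have hb: "bilinear_form_on (tangent_space A x) (h x)" for x using h by (simp add: smooth_tensor2_def)
  have D: "continuous_on ?W (\<lambda>x. dmap \<Phi> c d x u $ k)" for u k
  proof -
    have "continuous_on (cmap c ` ?W) (\<lambda>y. frechet_derivative (cmap d \<circ> \<Phi> \<circ> cinv c) (at y) u)"
      by (rule smooth_on_imp_continuous_on[OF smooth_on_frechet_derivative[OF smooth_mapD[OF \<Phi> c d]]])
    then have "continuous_on ?W (\<lambda>x. frechet_derivative (cmap d \<circ> \<Phi> \<circ> cinv c) (at (cmap c x)) u)"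
      by (rule continuous_on_compose2[OF _ continuous_on_subset[OF continuous_cmap[OF c]]]) auto
    then show ?thesis unfolding dmap_def by (rule continuous_on_component)
  qed
  have H: "continuous_on ?W (\<lambda>x. components A h d (\<Phi> x) $ k $ l)" for k l
    by (rule continuous_on_compose2[OF continuous_components[OF h d]])
      (use \<Phi> in \<open>auto simp: smooth_map_def intro: continuous_on_subset\<close>)
  have "continuous_on ?W (\<lambda>x. \<Sum>k\<in>UNIV. \<Sum>l\<in>UNIV. dmap \<Phi> c d x (axis i 1) $ k * dmap \<Phi> c d x (axis j 1) $ l
      * components A h d (\<Phi> x) $ k $ l)"
    by (intro continuous_on_sum continuous_on_mult D H)
  then show ?thesis
  proof (rule continuous_on_eq)
    fix x assume "x \<in> ?W"
    then have x: "x \<in> cdom c" "\<Phi> x \<in> cdom d" by auto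
    show "(\<Sum>k\<in>UNIV. \<Sum>l\<in>UNIV. dmap \<Phi> c d x (axis i 1) $ k * dmap \<Phi> c d x (axis j 1) $ l
      * components A h d (\<Phi> x) $ k $ l) = components A (pullback A \<Phi> h) c x $ i $ j"
      unfolding components_cform[of "pullback A \<Phi> h"] cform_pullback[OF \<Phi> c x(1) d x(2)]
        cform_components[where h=h, OF d x(2) hb] ..
  qed
qed

text \<open>The points \<open>y\<close> and \<open>z\<close> vary independently: \<open>h\<close>
  and \<open>g\<close> are evaluated at \<open>y\<close>, while \<open>z\<close> stands for its
  image under the diffeomorphism, of which only membership in the same small ball will be used. The
  quantity compared is continuous in the pair and vanishes at \<open>(a, a)\<close> because
  \<open>L\<close> is an isometry there.\<close>

lemma isometry_radius:
  assumes h: "smooth_tensor2 A h" and k: "smooth_tensor2 A k" and c: "c \<in> A" and a: "a \<in> cmap c ` cdom c"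
    and L: "linear L" "\<And>u v. cform k c (cinv c a) (L u) (L v) = cform h c (cinv c a) u v" and e: "e > 0"
  shows "\<exists>\<rho>>0. \<forall>y\<in>ball a \<rho> \<inter> cmap c ` cdom c. \<forall>z\<in>ball a \<rho> \<inter> cmap c ` cdom c.
    tnorm (components A g c (cinv c y))
      (\<chi> i j. cform k c (cinv c z) (L (axis i 1)) (L (axis j 1)) - components A h c (cinv c y) $ i $ j) < e"
proof -
  let ?V = "cmap c ` cdom c"
  have kb: "bilinear_form_on (tangent_space A x) (k x)" for x using k by (simp add: smooth_tensor2_def)
  have comp: "continuous_on ?V (\<lambda>y. components A t c (cinv c y) $ i $ j)" if "smooth_tensor2 A t" for t i j
    using that c by (auto simp: smooth_tensor2_def intro: smooth_on_imp_continuous_on)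
  have c1: "continuous_on (?V \<times> ?V) (\<lambda>p. components A t c (cinv c (fst p)) $ i $ j)" if "smooth_tensor2 A t" for t i j
    by (rule continuous_on_compose2[OF comp[OF that] continuous_on_fst[OF continuous_on_id]]) auto
  have c2: "continuous_on (?V \<times> ?V) (\<lambda>p. components A t c (cinv c (snd p)) $ i $ j)" if "smooth_tensor2 A t" for t i j
    by (rule continuous_on_compose2[OF comp[OF that] continuous_on_snd[OF continuous_on_id]]) auto
  define \<Theta> where "\<Theta> p = tnorm (components A g c (cinv c (fst p)))
      (\<chi> i j. cform k c (cinv c (snd p)) (L (axis i 1)) (L (axis j 1)) - components A h c (cinv c (fst p)) $ i $ j)" for p
  have "continuous_on (?V \<times> ?V) \<Theta>"
    unfolding \<Theta>_def
  proof (rule continuous_on_tnorm[OF c1[OF g_smooth]])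
    show "det (components A g c (cinv c (fst p))) \<noteq> 0" if "p \<in> ?V \<times> ?V" for p
      using that by (intro det_g_nonzero[OF c] cinv_in[OF c]) auto
    fix i j
    have "continuous_on (?V \<times> ?V) (\<lambda>p. (\<Sum>m\<in>UNIV. \<Sum>l\<in>UNIV. L (axis i 1) $ m * L (axis j 1) $ l *
        components A k c (cinv c (snd p)) $ m $ l) - components A h c (cinv c (fst p)) $ i $ j)"
      by (intro continuous_on_diff continuous_on_sum continuous_on_mult continuous_on_const c1[OF h] c2[OF k])
    then show "continuous_on (?V \<times> ?V) (\<lambda>p. (\<chi> i j. cform k c (cinv c (snd p)) (L (axis i 1)) (L (axis j 1))
        - components A h c (cinv c (fst p)) $ i $ j) $ i $ j)"
    proof (rule continuous_on_eq)
      fix p assume "p \<in> ?V \<times> ?V"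
      then have "cinv c (snd p) \<in> cdom c" by (intro cinv_in[OF c]) auto
      then show "(\<Sum>m\<in>UNIV. \<Sum>l\<in>UNIV. L (axis i 1) $ m * L (axis j 1) $ l *
        components A k c (cinv c (snd p)) $ m $ l) - components A h c (cinv c (fst p)) $ i $ j =
        (\<chi> i j. cform k c (cinv c (snd p)) (L (axis i 1)) (L (axis j 1))
        - components A h c (cinv c (fst p)) $ i $ j) $ i $ j"
        by (simp add: cform_components[where h=k, OF c _ kb])
    qed
  qed
  moreover have "\<Theta> (a, a) = 0"
  proof -
    have "(\<chi> i j. cform k c (cinv c a) (L (axis i 1)) (L (axis j 1)) - components A h c (cinv c a) $ i $ j) = 0"
      by (simp add: vec_eq_iff L(2) components_cform)
    then show ?thesis unfolding \<Theta>_def fst_conv snd_conv by (simp only: tnorm_zero)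
  qed
  ultimately obtain \<delta> where \<delta>: "\<delta> > 0" "\<And>p. p \<in> ?V \<times> ?V \<Longrightarrow> dist p (a, a) < \<delta> \<Longrightarrow> dist (\<Theta> p) 0 < e"
    using a e unfolding continuous_on_iff by (metis mem_Sigma_iff)
  show ?thesis
  proof (intro exI[of _ "\<delta> / 2"] conjI ballI)
    fix y z assume y: "y \<in> ball a (\<delta> / 2) \<inter> ?V" and z: "z \<in> ball a (\<delta> / 2) \<inter> ?V"
    have "dist (y, z) (a, a) \<le> dist y a + dist z a"
      by (simp add: dist_Pair_Pair sqrt_sum_squares_le_sum)
    also have "\<dots> < \<delta>" using y z by (simp add: dist_commute)
    finally have "dist (\<Theta> (y, z)) 0 < e" using y z by (intro \<delta>(2)) auto
    then have "\<Theta> (y, z) < e" by simp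
    then show "tnorm (components A g c (cinv c y))
      (\<chi> i j. cform k c (cinv c z) (L (axis i 1)) (L (axis j 1)) - components A h c (cinv c y) $ i $ j) < e"
      by (simp add: \<Theta>_def)
  qed (use \<delta> in simp)
qed

end

subsection \<open>The approximation theorem\<close>

context compact_riemannian_manifold
begin

text \<open>Three radii \<open>s < (s + r) / 2 < r\<close> occur. \<open>T\<close> is affine up to
  the middle one and returns to the identity beyond it; the cutoff is 1 up to \<open>s\<close> and 0
  from the middle one on, so it vanishes wherever nothing is known about \<open>T\<close>.\<close>

definition local_model where
  "local_model L i \<delta> T T' \<theta> \<longleftrightarrow> (case i of (c, a, s, r) \<Rightarrow>
    \<delta> > 0 \<and> rdiffeo T T' \<and> (\<forall>y. y \<notin> ball a r \<longrightarrow> T y = y) \<and>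
    (\<forall>y\<in>cball a ((s + r) / 2). T y = a + \<delta> *\<^sub>R L c a (y - a)) \<and>
    smooth_on UNIV \<theta> \<and> (\<forall>y. 0 \<le> \<theta> y \<and> \<theta> y \<le> (1::real)) \<and> (\<forall>y\<in>cball a s. \<theta> y = 1) \<and>
    (\<forall>y. y \<notin> ball a ((s + r) / 2) \<longrightarrow> \<theta> y = 0))"

lemma local_model_exists:
  assumes "0 < s" "s < r" and L: "\<And>\<kappa>. \<kappa> > 0 \<Longrightarrow> near_gen \<kappa> (L c a)"
  shows "\<exists>\<delta> T T' \<theta>. local_model L (c, a, s, r) \<delta> T T' \<theta>"
proof -
  have m: "0 < (s + r) / 2" "(s + r) / 2 < r" "s < (s + r) / 2" using assms by auto
  obtain \<delta> T T' where T: "\<delta> > 0" "rdiffeo T T'" "\<And>x. x \<in> cball a ((s + r) / 2) \<Longrightarrow> T x = a + \<delta> *\<^sub>R L c a (x - a)"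
    "\<And>x. x \<notin> ball a r \<Longrightarrow> T x = x"
    by (rule rdiffeo_scaled_linear[OF m(1,2) L]) blast+
  obtain \<theta> where "smooth_on UNIV \<theta>" "\<And>x. 0 \<le> \<theta> x" "\<And>x. \<theta> x \<le> (1::real)"
    "\<And>x. x \<in> cball a s \<Longrightarrow> \<theta> x = 1" "\<And>x. x \<notin> ball a ((s + r) / 2) \<Longrightarrow> \<theta> x = 0"
    by (rule smooth_bump[OF assms(1) m(3), of a]) blast
  then have "local_model L (c, a, s, r) \<delta> T T' \<theta>"
    using T by (simp add: local_model_def)
  then show ?thesis by blast
qed

lemma pointwise_norm_bounded:
  assumes "continuous_on UNIV (pointwise_norm A g h)"
  shows "\<exists>C>0. \<forall>x. pointwise_norm A g h x \<le> C"
proof -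
  have "bounded (range (pointwise_norm A g h))"
    by (rule compact_imp_bounded[OF compact_continuous_image[OF assms compact_M]])
  then obtain C where "C > 0" "\<forall>x. norm (pointwise_norm A g h x) \<le> C" by (auto simp: bounded_pos)
  then show ?thesis by (intro exI[of _ C]) (auto simp: abs_le_iff)
qed

text \<open>One \<open>e\<close> pays for \<eta> times the pullback, the other for the failure of
  \<open>L\<close> to be an isometry away from the centre; the norm of \<open>h\<close> enters only
  on the exceptional set \<open>U\<close>, where the cutoff may be below 1. Continuity of the norm
  is included since integrability will be derived from it.\<close>

lemma pointwise_approximation:
  assumes h: "sub_semi_riemannian_metric A h" and k: "sub_semi_riemannian_metric A k"
    and sig: "\<And>x. signature (tangent_space A x) (h x) = signature (tangent_space A x) (k x)"
    and e: "e > 0" and e': "e' > 0"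
  shows "\<exists>\<Phi> f U. smooth_diffeomorphism A \<Phi> \<and> smooth_function A f \<and> (\<forall>x. 0 < f x) \<and>
    U \<in> sets borel \<and> measure \<mu> U < e' \<and>
    continuous_on UNIV (pointwise_norm A g (pullback A \<Phi> (\<lambda>x u v. f x * k x u v) - h)) \<and>
    (\<forall>x. pointwise_norm A g (pullback A \<Phi> (\<lambda>x u v. f x * k x u v) - h) x
      \<le> 2 * e + (if x \<in> U then pointwise_norm A g h x else 0))"
proof -
  have hs: "smooth_tensor2 A h" and ks: "smooth_tensor2 A k"
    using h k by (auto simp: sub_semi_riemannian_metric_def)
  have hb: "bilinear_form_on (tangent_space A x) (h x)" and kb: "bilinear_form_on (tangent_space A x) (k x)" for x
    using hs ks by (auto simp: smooth_tensor2_def)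
  have sym: "symmetric_on UNIV (cform t c x)" if "c \<in> A" "x \<in> cdom c" "sub_semi_riemannian_metric A t" for t c x
    using that(3) tangent_vec_in[OF that(1,2)]
    unfolding sub_semi_riemannian_metric_def symmetric_on_def cform_def by blast

  \<comment> \<open>Isometries at the centres and the radii on which they stay accurate\<close>
  have "\<exists>L. (\<forall>\<kappa>>0. near_gen \<kappa> L) \<and> (\<forall>u v. cform k c (cinv c a) (L u) (L v) = cform h c (cinv c a) u v)"
    if c: "c \<in> A" and a: "a \<in> cmap c ` cdom c" for c a
  proof -
    note x = cinv_in[OF c a]
    have sg: "signature UNIV (cform h c (cinv c a)) = signature UNIV (cform k c (cinv c a))"
      using cform_signature[OF c x, of h] cform_signature[OF c x, of k] sig by simp
    show ?thesis
      by (rule isometry_in_near_gen[OF cform_bilinear[where h=h, OF c x hb] sym[OF c x h]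
            cform_bilinear[where h=k, OF c x kb] sym[OF c x k] sg]) blast
  qed
  then have "\<forall>c a. \<exists>L. c \<in> A \<and> a \<in> cmap c ` cdom c \<longrightarrow> (\<forall>\<kappa>>0. near_gen \<kappa> L) \<and>
      (\<forall>u v. cform k c (cinv c a) (L u) (L v) = cform h c (cinv c a) u v)" by blast
  then obtain L where L0: "\<forall>c a. c \<in> A \<and> a \<in> cmap c ` cdom c \<longrightarrow> (\<forall>\<kappa>>0. near_gen \<kappa> (L c a)) \<and>
      (\<forall>u v. cform k c (cinv c a) (L c a u) (L c a v) = cform h c (cinv c a) u v)" by metis
  have L1: "near_gen \<kappa> (L c a)" if "c \<in> A" "a \<in> cmap c ` cdom c" "\<kappa> > 0" for c a \<kappa>
    using L0 that by blast
  have L2: "cform k c (cinv c a) (L c a u) (L c a v) = cform h c (cinv c a) u v"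
    if "c \<in> A" "a \<in> cmap c ` cdom c" for c a u v
    using L0 that by blast
  have L3: "linear (L c a)" if "c \<in> A" "a \<in> cmap c ` cdom c" for c a
    using near_gen_linear[OF L1[OF that zero_less_one]] .
  define near where "near c a \<rho> \<longleftrightarrow> \<rho> > 0 \<and> (\<forall>y\<in>ball a \<rho> \<inter> cmap c ` cdom c. \<forall>z\<in>ball a \<rho> \<inter> cmap c ` cdom c.
    tnorm (components A g c (cinv c y))
      (\<chi> i j. cform k c (cinv c z) (L c a (axis i 1)) (L c a (axis j 1)) - components A h c (cinv c y) $ i $ j) < e)"
    for c a \<rho>
  \<comment> \<open>A radius for every chart and every possible centre is fixed before any ball is
    selected, so the packing can be required to respect it.\<close>
  define R where "R c a = (SOME \<rho>. near c a \<rho>)" for c a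
  have R: "near c a (R c a)" if "c \<in> A" "a \<in> cmap c ` cdom c" for c a
    unfolding R_def
  proof (rule someI_ex)
    show "\<exists>\<rho>. near c a \<rho>"
      using isometry_radius[OF hs ks that L3[OF that] L2[OF that] e] unfolding near_def by blast
  qed

  \<comment> \<open>The packing and its local models\<close>
  obtain F where F: "packing R F" and Fm: "measure \<mu> (UNIV - (\<Union>(c, a, s, r)\<in>F. cinv c ` cball a s)) < e'"
    using packing_exists[of R e'] R e' unfolding near_def by blast
  define ct where "ct i = fst i" for i :: "('m, 'n) chart \<times> (real, 'n) vec \<times> real \<times> real"
  define ce where "ce i = fst (snd i)" for i :: "('m, 'n) chart \<times> (real, 'n) vec \<times> real \<times> real"
  define rs where "rs i = fst (snd (snd i))" for i :: "('m, 'n) chart \<times> (real, 'n) vec \<times> real \<times> real"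
  define rr where "rr i = snd (snd (snd i))" for i :: "('m, 'n) chart \<times> (real, 'n) vec \<times> real \<times> real"
  have tup: "i = (ct i, ce i, rs i, rr i)" for i by (simp add: ct_def ce_def rs_def rr_def)
  have finF: "finite F" using F by (simp add: packing_def)
  have "\<forall>(c, a, s, r)\<in>F. c \<in> A \<and> 0 < s \<and> s < r \<and> r < R c a \<and> cball a r \<subseteq> cmap c ` cdom c"
    using F by (simp add: packing_def)
  then have "ct i \<in> A \<and> 0 < rs i \<and> rs i < rr i \<and> rr i < R (ct i) (ce i) \<and>
      cball (ce i) (rr i) \<subseteq> cmap (ct i) ` cdom (ct i)" if "i \<in> F" for i
    using that by (subst (asm) tup) fast
  then have Fi: "ct i \<in> A" "0 < rs i" "rs i < rr i" "rr i < R (ct i) (ce i)"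
      "cball (ce i) (rr i) \<subseteq> cmap (ct i) ` cdom (ct i)" if "i \<in> F" for i using that by blast+
  have Fdisj: "cinv (ct i) ` cball (ce i) (rr i) \<inter> cinv (ct j) ` cball (ce j) (rr j) = {}"
    if "i \<in> F" "j \<in> F" "i \<noteq> j" for i j
  proof -
    have d: "\<forall>(c, a, s, r)\<in>F. \<forall>(c', a', s', r')\<in>F. (c, a, s, r) \<noteq> (c', a', s', r') \<longrightarrow>
      cinv c ` cball a r \<inter> cinv c' ` cball a' r' = {}" using F by (simp add: packing_def)
    have "(ct i, ce i, rs i, rr i) \<in> F" "(ct j, ce j, rs j, rr j) \<in> F"
      "(ct i, ce i, rs i, rr i) \<noteq> (ct j, ce j, rs j, rr j)" using that tup by metis+
    then show ?thesis using d by fast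
  qed
  have cein: "ce i \<in> cmap (ct i) ` cdom (ct i)" if "i \<in> F" for i
  proof -
    have "ce i \<in> cball (ce i) (rr i)" using Fi(2,3)[OF that] by simp
    then show ?thesis using Fi(5)[OF that] by blast
  qed
  have "\<forall>i\<in>F. \<exists>\<delta> T T' \<theta>. local_model L i \<delta> T T' \<theta>"
  proof
    fix i assume i: "i \<in> F"
    have "\<exists>\<delta> T T' \<theta>. local_model L (ct i, ce i, rs i, rr i) \<delta> T T' \<theta>"
      by (rule local_model_exists[where L=L, OF Fi(2,3)[OF i]]) (rule L1[OF Fi(1)[OF i] cein[OF i]])
    then show "\<exists>\<delta> T T' \<theta>. local_model L i \<delta> T T' \<theta>" using tup by metis
  qed
  then obtain \<delta> T T' \<theta> where "\<forall>i\<in>F. local_model L i (\<delta> i) (T i) (T' i) (\<theta> i)" by metis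
  then have lm: "local_model L (ct i, ce i, rs i, rr i) (\<delta> i) (T i) (T' i) (\<theta> i)" if "i \<in> F" for i
    using that tup by metis
  define rm where "rm i = (rs i + rr i) / 2" for i
  have M: "\<delta> i > 0" "rdiffeo (T i) (T' i)" "\<forall>y. y \<notin> ball (ce i) (rr i) \<longrightarrow> T i y = y"
    "\<forall>y\<in>cball (ce i) (rm i). T i y = ce i + \<delta> i *\<^sub>R L (ct i) (ce i) (y - ce i)"
    "smooth_on UNIV (\<theta> i)" "\<forall>y. 0 \<le> \<theta> i y \<and> \<theta> i y \<le> 1" "\<forall>y\<in>cball (ce i) (rs i). \<theta> i y = 1"
    "\<forall>y. y \<notin> ball (ce i) (rm i) \<longrightarrow> \<theta> i y = 0" if "i \<in> F" for i
    using lm[OF that] unfolding local_model_def split_conv rm_def by blast+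

  \<comment> \<open>The global diffeomorphism and the pullback\<close>
  define ob where "ob i = cinv (ct i) ` cball (ce i) (rr i)" for i
  have "\<exists>\<Phi>. smooth_diffeomorphism A \<Phi> \<and>
    (\<forall>i\<in>F. \<forall>x\<in>cinv (ct i) ` cball (ce i) (rr i). \<Phi> x = extend_map (ct i) (T i) x) \<and>
    (\<forall>x. x \<notin> (\<Union>i\<in>F. cinv (ct i) ` cball (ce i) (rr i)) \<longrightarrow> \<Phi> x = x)"
  proof (rule glue_diffeomorphisms[OF finF, where T'=T'])
    fix i assume i: "i \<in> F"
    show "ct i \<in> A \<and> cball (ce i) (rr i) \<subseteq> cmap (ct i) ` cdom (ct i) \<and> rdiffeo (T i) (T' i) \<and>
        (\<forall>y. y \<notin> ball (ce i) (rr i) \<longrightarrow> T i y = y)"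
      by (intro conjI Fi(1)[OF i] Fi(5)[OF i] M(2)[OF i] M(3)[OF i])
  qed (rule Fdisj)
  then obtain \<Phi> where \<Phi>: "smooth_diffeomorphism A \<Phi>"
    and \<Phi>e: "\<And>i x. i \<in> F \<Longrightarrow> x \<in> ob i \<Longrightarrow> \<Phi> x = extend_map (ct i) (T i) x" unfolding ob_def by blast
  have \<Phi>s: "smooth_map A \<Phi>" and \<Phi>i: "smooth_map A (inv \<Phi>)" and \<Phi>b: "bij \<Phi>"
    using \<Phi> by (auto simp: smooth_diffeomorphism_def)
  define P where "P = pullback A \<Phi> k"
  have Pb: "bilinear_form_on (tangent_space A x) (P x)" for x
    unfolding P_def by (rule bilinear_pullback[OF \<Phi>s kb])
  have Ploc: "\<exists>c W. c \<in> A \<and> open W \<and> x \<in> W \<and> W \<subseteq> cdom c \<and>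
      (\<forall>i j. continuous_on W (\<lambda>x. components A P c x $ i $ j))" for x
  proof -
    obtain c where c: "c \<in> A" "x \<in> cdom c" using ex_chart by blast
    obtain d where d: "d \<in> A" "\<Phi> x \<in> cdom d" using ex_chart by blast
    show ?thesis
      using c d smooth_map_open_preimage[OF \<Phi>s c(1) d(1)] continuous_components_pullback[OF \<Phi>s ks c(1) d(1)]
      unfolding P_def by (intro exI[of _ c] exI[of _ "cdom c \<inter> \<Phi> -` cdom d"]) simp
  qed
  obtain B where B: "B > 0" "\<And>x. pointwise_norm A g P x \<le> B"
    using pointwise_norm_bounded[OF continuous_pointwise_norm[OF Pb Ploc]] by blast
  define \<eta> where "\<eta> = e / B"
  have \<eta>: "\<eta> > 0" using e B by (simp add: \<eta>_def)

  \<comment> \<open>The conformal factor\<close>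
  define S where "S x = (\<Sum>i\<in>F. inverse (\<delta> i ^ 2) * extend_fun (ct i) (\<theta> i) x)" for x
  define Fn where "Fn x = \<eta> + S x" for x
  define f where "f x = Fn (inv \<Phi> x)" for x
  have \<theta>out: "\<forall>y. y \<notin> ball (ce i) (rr i) \<longrightarrow> \<theta> i y = 0" if "i \<in> F" for i
  proof -
    have "ball (ce i) (rm i) \<subseteq> ball (ce i) (rr i)" using Fi(3)[OF that] by (intro subset_ball) (simp add: rm_def)
    then show ?thesis using M(8)[OF that] by blast
  qed
  have ex0: "extend_fun (ct i) (\<theta> i) x = 0" if i: "i \<in> F" and x: "x \<notin> ob i" for i x
  proof (cases "x \<in> cdom (ct i)")
    case True
    then have "cmap (ct i) x \<notin> cball (ce i) (rr i)"
      using x chart_cball_iff[OF Fi(1)[OF i] True Fi(5)[OF i]] by (simp add: ob_def)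
    then have "cmap (ct i) x \<notin> ball (ce i) (rr i)" using ball_subset_cball by blast
    then show ?thesis using \<theta>out[OF i] by (simp add: extend_fun_def)
  qed (simp add: extend_fun_def)
  have ex_nn: "0 \<le> extend_fun (ct i) (\<theta> i) x" if "i \<in> F" for i x
    using M(6)[OF that] by (simp add: extend_fun_def)
  have S_in: "S x = inverse (\<delta> i ^ 2) * extend_fun (ct i) (\<theta> i) x" if i: "i \<in> F" and x: "x \<in> ob i" for i x
  proof -
    have "extend_fun (ct j) (\<theta> j) x = 0" if "j \<in> F - {i}" for j
      using ex0[of j x] Fdisj[of i j] i x that unfolding ob_def by blast
    then show ?thesis unfolding S_def using finF i by (simp add: sum.remove)
  qed
  have sFn: "smooth_function A Fn"
    unfolding Fn_def S_def
  proof (intro smooth_function_add smooth_function_const smooth_function_sum smooth_function_cmult)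
    fix i assume i: "i \<in> F"
    show "smooth_function A (extend_fun (ct i) (\<theta> i))"
      by (rule smooth_function_extend_fun[OF Fi(1)[OF i] Fi(5)[OF i] M(5)[OF i] \<theta>out[OF i]])
  qed
  have sf: "smooth_function A f" unfolding f_def by (rule smooth_function_comp[OF sFn \<Phi>i])
  have fpos: "f x > 0" for x
    unfolding f_def Fn_def S_def using \<eta> ex_nn M(1) by (intro add_pos_nonneg sum_nonneg mult_nonneg_nonneg) (auto intro: less_imp_le)
  define H where "H = pullback A \<Phi> (\<lambda>x u v. f x * k x u v) - h"
  have Heq: "H x u v = Fn x * P x u v - h x u v" for x u v
    using \<Phi>b by (simp add: H_def P_def pullback_def f_def bij_is_inj)
  have Hb: "bilinear_form_on (tangent_space A x) (H x)" for x
    unfolding bilinear_form_on_def Heq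
    by (intro ballI allI) (simp add: bilinear_form_onD[OF Pb] bilinear_form_onD[OF hb] algebra_simps)
  have Hcont: "continuous_on UNIV (pointwise_norm A g H)"
  proof (rule continuous_pointwise_norm[OF Hb])
    fix x
    obtain c W where c: "c \<in> A" "open W" "x \<in> W" "W \<subseteq> cdom c"
      and PW: "\<And>i j. continuous_on W (\<lambda>x. components A P c x $ i $ j)" using Ploc by blast
    have "continuous_on W (\<lambda>x. components A H c x $ i $ j)" for i j
    proof -
      have "continuous_on W (\<lambda>x. Fn x * components A P c x $ i $ j - components A h c x $ i $ j)"
        by (intro continuous_on_diff continuous_on_mult PW
            continuous_on_subset[OF continuous_smooth_function[OF sFn c(1)] c(4)]
            continuous_on_subset[OF continuous_components[OF hs c(1)] c(4)])
      then show ?thesis by (simp add: components_def Heq)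
    qed
    then show "\<exists>c W. c \<in> A \<and> open W \<and> x \<in> W \<and> W \<subseteq> cdom c \<and>
      (\<forall>i j. continuous_on W (\<lambda>x. components A H c x $ i $ j))" using c by blast
  qed

  \<comment> \<open>The exceptional set\<close>
  define U where "U = UNIV - (\<Union>i\<in>F. cinv (ct i) ` cball (ce i) (rs i))"
  have cl: "closed (cinv (ct i) ` cball (ce i) (rs i))" if i: "i \<in> F" for i
    using Fi(3,5)[OF i] subset_cball[of "rs i" "rr i" "ce i"]
    by (intro closed_chart_cball[OF Fi(1)[OF i]]) auto
  have "closed (\<Union>i\<in>F. cinv (ct i) ` cball (ce i) (rs i))" by (rule closed_UN[OF finF]) (use cl in blast)
  then have Ub: "U \<in> sets borel" unfolding U_def by (simp add: borel_open open_Diff)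
  have Um: "measure \<mu> U < e'"
  proof -
    have "(\<Union>(c, a, s, r)\<in>F. cinv c ` cball a s) = (\<Union>i\<in>F. cinv (ct i) ` cball (ce i) (rs i))"
      by (intro SUP_cong refl) (simp add: split_beta ct_def ce_def rs_def)
    then show ?thesis using Fm by (simp add: U_def)
  qed
  have \<eta>P: "pointwise_norm A g (\<lambda>x u v. \<eta> * P x u v) x \<le> e" for x
    unfolding pointwise_norm_scale[of A g "\<lambda>x. \<eta>"] using B \<eta> e by (simp add: \<eta>_def divide_simps mult.commute)

  \<comment> \<open>The pointwise estimate\<close>
  have est: "pointwise_norm A g H x \<le> 2 * e + (if x \<in> U then pointwise_norm A g h x else 0)" for x
  \<comment> \<open>The middle balls separate the cases. Inside one of them \<open>\<Phi>\<close> is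
    affine in the chart; outside all of them every cutoff vanishes and, because the inner balls are
    smaller, the point lies in \<open>U\<close>.\<close>
  proof (cases "\<exists>i\<in>F. x \<in> cinv (ct i) ` ball (ce i) (rm i)")
    case True
    then obtain i where i: "i \<in> F" and xm: "x \<in> cinv (ct i) ` ball (ce i) (rm i)" by blast
    let ?c = "ct i" and ?a = "ce i"
    note c = Fi(1)[OF i]
    have rms: "ball ?a (rm i) \<subseteq> ball ?a (rr i)" using Fi(3)[OF i] by (intro subset_ball) (simp add: rm_def)
    have rmV: "ball ?a (rm i) \<subseteq> cmap ?c ` cdom ?c" using rms Fi(5)[OF i] ball_subset_cball by blast
    have xc: "x \<in> cdom ?c" "cmap ?c x \<in> ball ?a (rm i)"
      using xm cinv_image_eq[OF c rmV] by auto
    have xob: "x \<in> ob i" unfolding ob_def using xm rms ball_subset_cball by blast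
    define y where "y = cmap ?c x"
    have Ty: "T i y \<in> ball ?a (rr i)"
      using rdiffeo_cball(2)[OF M(2)[OF i] M(3)[OF i]] xc(2) rms unfolding y_def by blast
    have TyV: "T i y \<in> cmap ?c ` cdom ?c" using Ty Fi(5)[OF i] ball_subset_cball by blast
    have \<Phi>x: "\<Phi> x = cinv ?c (T i y)" using \<Phi>e[OF i xob] xc by (simp add: extend_map_def y_def)
    have \<Phi>xc: "\<Phi> x \<in> cdom ?c" unfolding \<Phi>x by (rule cinv_in[OF c TyV])
    let ?L = "L ?c ?a"
    note lL = L3[OF c cein[OF i]]
    have "((\<lambda>z. ?a + \<delta> i *\<^sub>R ?L (z - ?a)) has_derivative (\<lambda>u. \<delta> i *\<^sub>R ?L u)) (at y)"
    proof -
      have bl: "bounded_linear ?L" using lL by (simp add: linear_conv_bounded_linear)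
      have "((\<lambda>z. z - ?a) has_derivative (\<lambda>u. u)) (at y)" by (auto intro!: derivative_eq_intros)
      from bounded_linear.has_derivative[OF bl this] show ?thesis
        by (auto intro!: derivative_eq_intros)
    qed
    then have "((cmap ?c \<circ> \<Phi> \<circ> cinv ?c) has_derivative (\<lambda>u. \<delta> i *\<^sub>R ?L u)) (at y)"
    proof (rule has_derivative_transform_within_open[OF _ open_ball[of ?a "rm i"]])
      show "y \<in> ball ?a (rm i)" using xc by (simp add: y_def)
      fix z assume z: "z \<in> ball ?a (rm i)"
      have zV: "z \<in> cmap ?c ` cdom ?c" using z rmV by blast
      have zob: "cinv ?c z \<in> ob i" unfolding ob_def using z rms ball_subset_cball by blast
      have TzV: "T i z \<in> cmap ?c ` cdom ?c"
        using rdiffeo_cball(2)[OF M(2)[OF i] M(3)[OF i]] z rms Fi(5)[OF i] ball_subset_cball by blast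
      have "(cmap ?c \<circ> \<Phi> \<circ> cinv ?c) z = T i z"
        using \<Phi>e[OF i zob] cinv_in[OF c zV] cmap_cinv[OF c zV] cmap_cinv[OF c TzV] by (simp add: extend_map_def)
      also have "\<dots> = ?a + \<delta> i *\<^sub>R ?L (z - ?a)" using M(4)[OF i] z by simp
      finally show "?a + \<delta> i *\<^sub>R ?L (z - ?a) = (cmap ?c \<circ> \<Phi> \<circ> cinv ?c) z" by simp
    qed
    then have dm: "dmap \<Phi> ?c ?c x = (\<lambda>u. \<delta> i *\<^sub>R ?L u)"
      using has_derivative_dmap[OF \<Phi>s c c xc(1) \<Phi>xc] has_derivative_unique unfolding y_def by blast
    \<comment> \<open>The multiple of the pullback to be compared with \<open>h\<close>: since the
      derivative of \<open>\<Phi>\<close> is \<delta> times \<open>L\<close>, it is \<open>k\<close>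
      at \<open>\<Phi> x\<close> pulled back by \<open>L\<close> alone, which is what the radius
      \<open>R\<close> controls.\<close>
    define K where "K x u v = inverse (\<delta> i ^ 2) * P x u v" for x u v
    have KP: "cform K ?c x u w = cform k ?c (\<Phi> x) (?L u) (?L w)" for u w
    proof -
      have "cform P ?c x u w = \<delta> i * (\<delta> i * cform k ?c (\<Phi> x) (?L u) (?L w))"
        unfolding P_def cform_pullback[OF \<Phi>s c xc(1) c \<Phi>xc] dm
        by (simp add: bilinear_form_onD[OF cform_bilinear[where h=k, OF c \<Phi>xc kb]])
      moreover have "cform K ?c x u w = inverse (\<delta> i ^ 2) * cform P ?c x u w" by (simp add: cform_def K_def)
      ultimately show ?thesis using M(1)[OF i] by (simp add: power2_eq_square field_simps)
    qed
    have Kh: "bilinear_form_on (tangent_space A x) ((K - h) x)"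
      unfolding bilinear_form_on_def K_def fun_diff_def
      by (intro ballI allI) (simp add: bilinear_form_onD[OF Pb] bilinear_form_onD[OF hb] algebra_simps)
    have Khe: "pointwise_norm A g (K - h) x < e"
    proof -
      have "components A (K - h) ?c x = (\<chi> i' j'. cform k ?c (cinv ?c (T i y)) (?L (axis i' 1)) (?L (axis j' 1))
          - components A h ?c (cinv ?c y) $ i' $ j')"
        unfolding vec_eq_iff \<Phi>x[symmetric] KP[symmetric]
        by (simp add: components_def cform_def y_def cinv_cmap c xc)
      moreover have "tnorm (components A g ?c (cinv ?c y)) (\<chi> i' j'. cform k ?c (cinv ?c (T i y)) (?L (axis i' 1)) (?L (axis j' 1))
          - components A h ?c (cinv ?c y) $ i' $ j') < e"
      proof -
        have sub: "ball ?a (rr i) \<subseteq> ball ?a (R ?c ?a)" using Fi(4)[OF i] by (intro subset_ball) simp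
        have "y \<in> ball ?a (R ?c ?a) \<inter> cmap ?c ` cdom ?c" "T i y \<in> ball ?a (R ?c ?a) \<inter> cmap ?c ` cdom ?c"
          using sub Ty TyV xc rms rmV unfolding y_def by blast+
        then show ?thesis using R[OF c cein[OF i]] unfolding near_def by blast
      qed
      ultimately show ?thesis
        using pointwise_norm_eq_tnorm[where h="K - h", OF c xc(1) Kh] by (simp add: y_def cinv_cmap c xc)
    qed
    define t where "t = \<theta> i y"
    have t: "0 \<le> t" "t \<le> 1" using M(6)[OF i] by (auto simp: t_def)
    have Sx: "S x = inverse (\<delta> i ^ 2) * t" using S_in[OF i xob] xc by (simp add: extend_fun_def t_def y_def)
    \<comment> \<open>Splitting \<eta> P + t K - h into \<eta> P, t (K - h) and (t - 1) h: the first
      two are small everywhere in the middle ball, the third vanishes where the cutoff is 1.\<close>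
    have "H x u v = ((\<lambda>x u v. \<eta> * P x u v) + ((\<lambda>x u v. t * (K - h) x u v) + (\<lambda>x u v. (t - 1) * h x u v))) x u v" for u v
      by (simp add: Heq Fn_def Sx K_def algebra_simps)
    then have "pointwise_norm A g H x = pointwise_norm A g ((\<lambda>x u v. \<eta> * P x u v) +
        ((\<lambda>x u v. t * (K - h) x u v) + (\<lambda>x u v. (t - 1) * h x u v))) x"
      by (rule pointwise_norm_cong_point)
    also have "\<dots> \<le> pointwise_norm A g (\<lambda>x u v. \<eta> * P x u v) x + (pointwise_norm A g (\<lambda>x u v. t * (K - h) x u v) x
        + pointwise_norm A g (\<lambda>x u v. (t - 1) * h x u v) x)"
      by (rule order_trans[OF pointwise_norm_triangle add_left_mono[OF pointwise_norm_triangle]])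
    also have "\<dots> = pointwise_norm A g (\<lambda>x u v. \<eta> * P x u v) x + (t * pointwise_norm A g (K - h) x
        + (1 - t) * pointwise_norm A g h x)"
      using pointwise_norm_scale[of A g "\<lambda>x. t" "K - h" x] pointwise_norm_scale[of A g "\<lambda>x. t - 1" h x] t
      by (simp only:) (simp del: minus_apply)
    also have "\<dots> \<le> e + (e + (1 - t) * pointwise_norm A g h x)"
    proof (intro add_mono \<eta>P order_refl)
      have "t * pointwise_norm A g (K - h) x \<le> 1 * e"
        using t Khe e by (intro mult_mono) (auto intro: less_imp_le pointwise_norm_nonneg)
      then show "t * pointwise_norm A g (K - h) x \<le> e" by simp
    qed
    also have "\<dots> \<le> 2 * e + (if x \<in> U then pointwise_norm A g h x else 0)"
    proof (cases "x \<in> U")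
      case True
      have "(1 - t) * pointwise_norm A g h x \<le> 1 * pointwise_norm A g h x"
        using t pointwise_norm_nonneg by (intro mult_right_mono) auto
      then show ?thesis using True by simp
    next
      case False
      \<comment> \<open>A point off \<open>U\<close> lies in some inner ball, and disjointness of
        the outer balls shows that it is the one of index \<open>i\<close>; there the cutoff is
        1.\<close>
      then obtain j where j: "j \<in> F" "x \<in> cinv (ct j) ` cball (ce j) (rs j)" by (auto simp: U_def)
      have sj: "cball (ce j) (rs j) \<subseteq> cball (ce j) (rr j)" using Fi(3)[OF j(1)] by (intro subset_cball) simp
      then have "x \<in> ob j" using j(2) unfolding ob_def by blast
      then have "j = i" using Fdisj[OF j(1) i] xob unfolding ob_def by blast
      have "cball ?a (rs i) \<subseteq> cmap ?c ` cdom ?c" using sj Fi(5)[OF i] \<open>j = i\<close> by blast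
      then have "y \<in> cball ?a (rs i)"
        using chart_cball_iff[OF c xc(1)] j(2) \<open>j = i\<close> unfolding y_def by blast
      then have "t = 1" using M(7)[OF i] by (simp add: t_def)
      then show ?thesis using False by simp
    qed
    finally show ?thesis .
  next
    case False
    have "extend_fun (ct i) (\<theta> i) x = 0" if i: "i \<in> F" for i
    proof (cases "x \<in> cdom (ct i)")
      case True
      have "ball (ce i) (rm i) \<subseteq> cmap (ct i) ` cdom (ct i)"
        using Fi(3,5)[OF i] subset_ball[of "rm i" "rr i" "ce i"] ball_subset_cball[of "ce i" "rr i"] by (auto simp: rm_def)
      then have "cmap (ct i) x \<notin> ball (ce i) (rm i)"
        using False i chart_cball_iff[OF Fi(1)[OF i] True] by blast
      then show ?thesis using M(8)[OF i] by (simp add: extend_fun_def)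
    qed (simp add: extend_fun_def)
    then have Sx: "S x = 0" by (simp add: S_def)
    have xU: "x \<in> U"
    proof -
      have "cinv (ct i) ` cball (ce i) (rs i) \<subseteq> cinv (ct i) ` ball (ce i) (rm i)" if "i \<in> F" for i
        using Fi(3)[OF that] by (intro image_mono) (auto simp: rm_def)
      then show ?thesis using False unfolding U_def by blast
    qed
    have "H x u v = ((\<lambda>x u v. \<eta> * P x u v) + (\<lambda>x u v. (-1) * h x u v)) x u v" for u v
      by (simp add: Heq Fn_def Sx)
    then have "pointwise_norm A g H x = pointwise_norm A g ((\<lambda>x u v. \<eta> * P x u v) + (\<lambda>x u v. (-1) * h x u v)) x"
      by (rule pointwise_norm_cong_point)
    also have "\<dots> \<le> pointwise_norm A g (\<lambda>x u v. \<eta> * P x u v) x + pointwise_norm A g (\<lambda>x u v. (-1) * h x u v) x"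
      by (rule pointwise_norm_triangle)
    also have "\<dots> \<le> e + pointwise_norm A g h x"
      unfolding pointwise_norm_scale[of A g "\<lambda>x. -1"] using \<eta>P by simp
    also have "\<dots> \<le> 2 * e + (if x \<in> U then pointwise_norm A g h x else 0)" using xU e by simp
    finally show ?thesis .
  qed
  show ?thesis
    using \<Phi> sf fpos Ub Um Hcont est unfolding H_def by blast
qed

text \<open>The p-th power of the norm is at most \<open>(2 * e) powr p\<close> off \<open>U\<close>
  and at most \<open>q\<close> on \<open>U\<close>. Each of the two contributions to the integral is
  allowed half of \<open>\<epsilon> powr p\<close>.\<close>

lemma Lp_approximation:
  assumes h: "sub_semi_riemannian_metric A h" and k: "sub_semi_riemannian_metric A k"
    and sig: "\<And>x. signature (tangent_space A x) (h x) = signature (tangent_space A x) (k x)"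
    and p: "1 \<le> p" and \<epsilon>: "0 < \<epsilon>"
  shows "\<exists>\<Phi> f. smooth_diffeomorphism A \<Phi> \<and> smooth_function A f \<and> (\<forall>x. 0 < f x) \<and>
    in_Lp A g p (pullback A \<Phi> (\<lambda>x u v. f x * k x u v) - h) \<and>
    Lp_norm A g p (pullback A \<Phi> (\<lambda>x u v. f x * k x u v) - h) \<le> \<epsilon>"
proof -
  interpret finite_measure \<mu> by (rule finite_measure_\<mu>)
  have hs: "smooth_tensor2 A h" using h by (simp add: sub_semi_riemannian_metric_def)
  obtain C where C: "C > 0" "\<And>x. pointwise_norm A g h x \<le> C"
    using pointwise_norm_bounded[OF continuous_pointwise_norm_smooth[OF hs]] by blast
  \<comment> \<open>The summand 1 makes \<open>m\<close> positive without any knowledge that \<mu>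
    is nonzero.\<close>
  define m where "m = measure \<mu> UNIV + 1"
  have m: "m > 0" "measure \<mu> UNIV \<le> m" by (simp_all add: m_def add_nonneg_pos)
  \<comment> \<open>Solves \<open>(2 * e) powr p * m = \<epsilon> powr p / 2\<close>.\<close>
  define e where "e = \<epsilon> * (1 / (2 * m)) powr (1 / p) / 2"
  have e: "e > 0" using \<epsilon> m by (simp add: e_def)
  have ep: "(2 * e) powr p = \<epsilon> powr p / (2 * m)"
  proof -
    have "(2 * e) powr p = \<epsilon> powr p * ((1 / (2 * m)) powr (1 / p)) powr p"
      using \<epsilon> by (simp add: e_def powr_mult)
    also have "((1 / (2 * m)) powr (1 / p)) powr p = 1 / (2 * m)" using m p by (simp add: powr_powr)
    finally show ?thesis by simp
  qed
  define q where "q = (2 * e + C) powr p"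
  have q: "q > 0" using e C by (simp add: q_def)
  \<comment> \<open>Solves \<open>q * e' = \<epsilon> powr p / 2\<close>; as \<open>q\<close>
    involves \<open>e\<close>, the permitted measure of the exceptional set is fixed after the
    uniform error.\<close>
  define e' where "e' = \<epsilon> powr p / (2 * q)"
  have e': "e' > 0" using \<epsilon> q by (simp add: e'_def)
  obtain \<Phi> f U where \<Phi>: "smooth_diffeomorphism A \<Phi>" and f: "smooth_function A f" "\<forall>x. 0 < f x"
    and U: "U \<in> sets borel" "measure \<mu> U < e'"
    and cont: "continuous_on UNIV (pointwise_norm A g (pullback A \<Phi> (\<lambda>x u v. f x * k x u v) - h))"
    and est: "\<forall>x. pointwise_norm A g (pullback A \<Phi> (\<lambda>x u v. f x * k x u v) - h) x
      \<le> 2 * e + (if x \<in> U then pointwise_norm A g h x else 0)"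
    using pointwise_approximation[OF h k sig e e'] by blast
  define H where "H = pullback A \<Phi> (\<lambda>x u v. f x * k x u v) - h"
  define N where "N x = pointwise_norm A g H x" for x
  have cN: "continuous_on UNIV N" using cont unfolding N_def[abs_def] H_def .
  have N: "0 \<le> N x" "N x \<le> 2 * e + (if x \<in> U then C else 0)" for x
  proof -
    show "0 \<le> N x" unfolding N_def by (rule pointwise_norm_nonneg)
    have "N x \<le> 2 * e + (if x \<in> U then pointwise_norm A g h x else 0)" using est unfolding N_def H_def by blast
    then show "N x \<le> 2 * e + (if x \<in> U then C else 0)" using C(2)[of x] by (cases "x \<in> U") auto
  qed
  have Np: "N x powr p \<le> (2 * e) powr p + q * indicator U x" for x
  proof (cases "x \<in> U")
    case True
    have "N x powr p \<le> q" unfolding q_def using N[of x] True p by (intro powr_mono2) auto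
    then show ?thesis using True powr_ge_zero[of "2 * e" p] by (simp add: add_increasing)
  next
    case False
    have "N x powr p \<le> (2 * e) powr p" using N[of x] False p by (intro powr_mono2) auto
    then show ?thesis using False by simp
  qed
  have mN: "N \<in> borel_measurable \<mu>"
    using borel_measurable_continuous_onI[OF cN] measurable_cong_sets[OF sets_\<mu> refl] by blast
  have iN: "integrable \<mu> (\<lambda>x. N x powr p)"
  proof (rule integrable_const_bound[where B="(2 * e) powr p + q"])
    show "AE x in \<mu>. norm (N x powr p) \<le> (2 * e) powr p + q"
    proof (rule AE_I2)
      fix x
      have "q * indicator U x \<le> q" using q by (simp add: indicator_def)
      then show "norm (N x powr p) \<le> (2 * e) powr p + q" using Np[of x] by simp
    qed
    show "(\<lambda>x. N x powr p) \<in> borel_measurable \<mu>" using mN by measurable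
  qed
  have iU: "integrable \<mu> (\<lambda>x. q * indicator U x)"
    using U(1) by (intro integrable_mult_right integrable_real_indicator) (auto simp: emeasure_eq_measure)
  have "(LINT x|\<mu>. N x powr p) \<le> (LINT x|\<mu>. (2 * e) powr p + q * indicator U x)"
    by (rule integral_mono[OF iN _ Np]) (intro Bochner_Integration.integrable_add integrable_const iU)
  also have "\<dots> = (2 * e) powr p * measure \<mu> UNIV + q * measure \<mu> U"
    using iU U(1) by (subst Bochner_Integration.integral_add) (auto simp: mult.commute)
  also have "\<dots> \<le> \<epsilon> powr p / (2 * m) * m + q * e'"
    unfolding ep using m U(2) q by (intro add_mono mult_left_mono) auto
  also have "\<dots> = \<epsilon> powr p" using m q by (simp add: e'_def field_simps)
  finally have le: "(LINT x|\<mu>. N x powr p) \<le> \<epsilon> powr p" .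
  have "(LINT x|\<mu>. N x powr p) \<ge> 0" by (rule integral_nonneg_AE) simp
  then have "(LINT x|\<mu>. N x powr p) powr (1 / p) \<le> (\<epsilon> powr p) powr (1 / p)"
    using le p by (intro powr_mono2) auto
  also have "\<dots> = \<epsilon>" using p \<epsilon> by (simp add: powr_powr)
  finally have "Lp_norm A g p H \<le> \<epsilon>" unfolding Lp_norm_def \<mu>_def[symmetric] N_def .
  moreover have "in_Lp A g p H" using iN unfolding in_Lp_def \<mu>_def[symmetric] N_def .
  ultimately show ?thesis using \<Phi> f unfolding H_def by blast
qed

end

theorem lemma1p1:
  fixes A :: "('m::{t2_space,second_countable_topology}, 'n::{finite,wellorder}) chart set"
    and \<GG> G g :: "('m, 'n) tensor2"
    and p \<epsilon> :: real
  assumes "smooth_atlas A"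
    and "compact (UNIV :: 'm set)"
    and "sub_semi_riemannian_metric A \<GG>"
    and "sub_semi_riemannian_metric A G"
    and "\<And>x. form_rank (tangent_space A x) (\<GG> x) = form_rank (tangent_space A x) (G x)"
    and "\<And>x. signature (tangent_space A x) (\<GG> x) = signature (tangent_space A x) (G x)"
    and "riemannian_metric A g"
    and "1 \<le> p"
    and "0 < \<epsilon>"
  shows "\<exists>(\<Phi> :: 'm \<Rightarrow> 'm) (f :: 'm \<Rightarrow> real).
    smooth_diffeomorphism A \<Phi> \<and> smooth_function A f \<and> (\<forall>x. 0 < f x) \<and>
    in_Lp A g p (pullback A \<Phi> (\<lambda>x u v. f x * G x u v) - \<GG>) \<and>
    Lp_norm A g p (pullback A \<Phi> (\<lambda>x u v. f x * G x u v) - \<GG>) \<le> \<epsilon>"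
proof -
  interpret compact_riemannian_manifold A g
    by unfold_locales (use assms in auto)
  show ?thesis by (rule Lp_approximation[OF assms(3,4,6,8,9)])
qed

end
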